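(* Let $0<p,q,s,t<\infty$, $g\in\mathcal H(\mathbb D)$, $\omega\in\mathcal D$ and denote $\frac1{\tilde p}=\frac1s-\frac1p$ and $\frac1{\tilde q}=\frac1t-\frac1q$. If any of the following conditions holds, then $T_g:A^{p,q}_\omega\to A^{s,t}_\omega$ is bounded if and only if $g$ is a constant function: (a) $p\le s$, $q\le t$ and $\lim_{r\to1^-}\widehat\omega(r)^{\frac1{\tilde q}}(1-r)^{1+\frac1{\tilde p}}=\infty$; (b) $s<p$, $q\le t$ and $\lim_{r\to1^-}\widehat\omega(r)^{\frac1{\tilde q}}(1-r)=\infty$; (c) $p\le s$, $t<q$ and $\int_0^1(1-r)^{\left(1+\frac1{\tilde p}\right)\tilde q}\,\omega(r)\,dr=\infty$.
   Context: $\mathbb D$ is the open unit disc and $\mathcal H(\mathbb D)$ the space of analytic functions in $\mathbb D$. $M_p(r,f)=\left(\int_0^{2\pi}|f(re^{i\theta})|^p\frac{d\theta}{2\pi}\right)^{1/p}$ for $0<p<\infty$. A radial weight is the extension $\omega(z)=\omega(|z|)$ to $\mathbb D$ of a non-negative $\omega\in L^1([0,1))$; write $\widehat\omega(z)=\int_{|z|}^1\omega(r)\,dr$, always assumed $>0$ for all $z\in\mathbb D$. $\omega\in\widehat{\mathcal D}$ means there is $C>0$ with $\widehat\omega(r)\le C\widehat\omega\left(\frac{1+r}2\right)$ for $0\le r<1$. $\omega\in\check{\mathcal D}$ means there are $K>1$, $C>1$ with $\widehat\omega(r)\ge C\widehat\omega\left(1-\frac{1-r}K\right)$ for $0\le r<1$.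 $\mathcal D=\widehat{\mathcal D}\cap\check{\mathcal D}$. For $0<p,q<\infty$, $A^{p,q}_\omega$ is the space of $f\in\mathcal H(\mathbb D)$ with $\|f\|_{A^{p,q}_\omega}^q=\int_0^1M_p^q(r,f)\,\omega(r)\,dr<\infty$. $T_gf(z)=\int_0^zf(\zeta)g'(\zeta)\,d\zeta$; it is bounded from $A^{p,q}_\omega$ to $A^{s,t}_\omega$ if $\|T_gf\|_{A^{s,t}_\omega}\le C\|f\|_{A^{p,q}_\omega}$ for all $f\in A^{p,q}_\omega$. If $p=s$, $\frac1{\tilde p}$ denotes $0$; if $q=t$, $\frac1{\tilde q}$ denotes $0$. *)

theory Defs
  imports "HOL-Complex_Analysis.Complex_Analysis"
begin

text \<open>
  A radial weight is represented by its profile on \<open>[0,1)\<close>; values of \<open>w\<close> outside this interval are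
  never used. Likewise, analytic functions in the unit disc are total functions \<open>complex \<Rightarrow> complex\<close>
  that are holomorphic on \<open>ball 0 1\<close>, and only their values there matter.
\<close>

definition omega_hat :: "(real \<Rightarrow> real) \<Rightarrow> real \<Rightarrow> real" where
  "omega_hat w r = (LINT x:{r..<1}|lebesgue. w x)"

definition radial_weight :: "(real \<Rightarrow> real) \<Rightarrow> bool" where
  "radial_weight w \<longleftrightarrow>
     set_integrable lebesgue {0..<1} w \<and>
     (\<forall>r\<in>{0..<1}. 0 \<le> w r) \<and>
     (\<forall>r\<in>{0..<1}. 0 < omega_hat w r)"

definition D_hat :: "(real \<Rightarrow> real) set" where
  "D_hat = {w. radial_weight w \<and>
     (\<exists>C>0. \<forall>r\<in>{0..<1}. omega_hat w r \<le> C * omega_hat w ((1 + r) / 2))}"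

definition D_check :: "(real \<Rightarrow> real) set" where
  "D_check = {w. radial_weight w \<and>
     (\<exists>K>1. \<exists>C>1. \<forall>r\<in>{0..<1}. omega_hat w r \<ge> C * omega_hat w (1 - (1 - r) / K))}"

definition D_weights :: "(real \<Rightarrow> real) set" where
  "D_weights = D_hat \<inter> D_check"

definition integral_mean :: "real \<Rightarrow> real \<Rightarrow> (complex \<Rightarrow> complex) \<Rightarrow> real" where
  "integral_mean p r f =
     (LBINT \<theta>:{0..2 * pi}. cmod (f (of_real r * exp (\<i> * of_real \<theta>))) powr p / (2 * pi)) powr (1 / p)"

text \<open>The \<open>q\<close>-th power of the mixed norm, as an extended non-negative number.\<close>

definition mixed_norm_pow ::
    "(real \<Rightarrow> real) \<Rightarrow> real \<Rightarrow> real \<Rightarrow> (complex \<Rightarrow> complex) \<Rightarrow> ennreal" where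
  "mixed_norm_pow w p q f =
     (\<integral>\<^sup>+ r\<in>{0..<1}. ennreal (integral_mean p r f powr q * w r) \<partial>lebesgue)"

definition mixed_space ::
    "(real \<Rightarrow> real) \<Rightarrow> real \<Rightarrow> real \<Rightarrow> (complex \<Rightarrow> complex) set" where
  "mixed_space w p q = {f. f holomorphic_on ball 0 1 \<and> mixed_norm_pow w p q f < \<infinity>}"

definition mixed_norm ::
    "(real \<Rightarrow> real) \<Rightarrow> real \<Rightarrow> real \<Rightarrow> (complex \<Rightarrow> complex) \<Rightarrow> real" where
  "mixed_norm w p q f = enn2real (mixed_norm_pow w p q f) powr (1 / q)"

definition T_op :: "(complex \<Rightarrow> complex) \<Rightarrow> (complex \<Rightarrow> complex) \<Rightarrow> complex \<Rightarrow> complex" where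
  "T_op g f z = contour_integral (linepath 0 z) (\<lambda>\<zeta>. f \<zeta> * deriv g \<zeta>)"

text \<open>
  Membership of the image in the target space is required explicitly, because \<^const>\<open>mixed_norm\<close>
  is real-valued and takes the value \<open>0\<close> when the defining integral is infinite.
\<close>

definition T_bounded ::
    "(real \<Rightarrow> real) \<Rightarrow> real \<Rightarrow> real \<Rightarrow> real \<Rightarrow> real \<Rightarrow> (complex \<Rightarrow> complex) \<Rightarrow> bool" where
  "T_bounded w p q s t g \<longleftrightarrow>
     (\<exists>C. \<forall>f\<in>mixed_space w p q.
        T_op g f \<in> mixed_space w s t \<and> mixed_norm w s t (T_op g f) \<le> C * mixed_norm w p q f)"

end

theory Submission
  imports Defs
begin

text \<open>
  A constant symbol gives the zero operator. For the converse, let \<open>T\<^sub>g\<close> be bounded and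
  suppose that \<open>g'\<close> does not vanish identically. Since \<open>(T_op g f)' = f * g'\<close>, lower bounds for
  the norm of \<open>T_op g f\<close> in terms of its derivative, applied to suitable test functions \<open>f\<close>, turn
  boundedness into an upper bound for \<open>g'\<close> that contradicts the maximum principle.

  The estimates of derivatives have to hold for all \<open>s > 0\<close>. They all come from one source: up to an
  arbitrarily small error, \<open>cmod (F z) powr s\<close> has a harmonic majorant in a disc whose value at \<open>0\<close> is the
  average of \<open>cmod (F z) powr s\<close> over the boundary circle (\<open>harmonic_majorant\<close>). Harnack's inequality and the
  mean value property for the majorant give the monotonicity of the integral means, the pointwise bound
  for the derivative (\<open>deriv_powr_pointwise\<close>) and the bound for the means of the derivative
  (\<open>deriv_powr_circ_avg\<close>).

  The weight enters only through the values of \<open>\<omega> = omega_hat w\<close> at radii \<open>r\<^sub>N = 1 - 1 / L ^ N\<close>, at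
  which consecutive values are comparable and decrease geometrically (\<open>D_weights_geometric\<close>). The
  factor \<open>z ^ n\<close> with \<open>n\<close> a large multiple of \<open>L ^ N\<close> confines a test function to \<open>r \<ge> r\<^sub>N\<close> as far
  as the norm is concerned (\<open>weight_moment_le\<close>), yet it is of constant size on the circle of
  radius \<open>r\<^sub>N\<close>. Three kinds of test functions are used, with kernels \<open>(1 - cnj a * z) powr (- 2 / p)\<close>:

  \<^item> The monomial \<open>z ^ n\<close> bounds the mean of \<open>g'\<close> on the circle of radius \<open>r\<^sub>N\<close> by a constant times
    \<open>L ^ N * \<omega> r\<^sub>N powr (1 / q - 1 / t)\<close>. This settles the second condition.

  \<^item> The monomial times a kernel with \<open>cmod a = r\<^sub>N\<close> bounds the value of \<open>cmod (deriv g a)\<close> by a constant times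
    \<open>(L ^ N) powr (1 + 1 / s - 1 / p) * \<omega> r\<^sub>N powr (1 / q - 1 / t)\<close>. This settles the first condition.

  \<^item> If \<open>t < q\<close>, a single circle does not suffice, and the products of monomials and kernels for all
    circles up to index \<open>K\<close> are added, with coefficients \<open>(L ^ k) powr \<sigma>\<close> and signs that prevent cancellation
    (\<open>exists_signs\<close>). Boundedness then says that \<open>S K \<le> C * S K powr (t / q)\<close> for the partial
    sums \<open>S K\<close> of a series that is comparable with the integral in the third condition. Hence the integral is
    finite.
\<close>

section \<open>Averages over circles\<close>

definition circ_avg :: "(complex \<Rightarrow> real) \<Rightarrow> real \<Rightarrow> real" where
  "circ_avg h r = (LBINT \<theta>:{0..2 * pi}. h (of_real r * exp (\<i> * of_real \<theta>)) / (2 * pi))"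

text \<open>
  The averages \<open>circ_avg\<close> of real functions carry the additive structure that the power \<open>1 / p\<close> in
  \<^const>\<open>integral_mean\<close> destroys; all estimates are made for \<open>circ_avg\<close> and transferred by this identity.
\<close>

lemma integral_mean_eq_circ_avg:
  "integral_mean p r f = circ_avg (\<lambda>z. cmod (f z) powr p) r powr (1 / p)"
  by (simp add: integral_mean_def circ_avg_def)

lemma circle_point_in_sphere:
  "0 \<le> r \<Longrightarrow> of_real r * exp (\<i> * of_real \<theta>) \<in> sphere (0::complex) r"
  by (simp add: dist_norm norm_mult)

lemma circ_avg_set_integrable:
  assumes "continuous_on (sphere 0 r) h" "0 \<le> r"
  shows "set_integrable lborel {0..2 * pi} (\<lambda>\<theta>. h (of_real r * exp (\<i> * of_real \<theta>)) / (2 * pi))"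
proof (rule borel_integrable_atLeastAtMost')
  have "continuous_on {0..2 * pi} (h \<circ> (\<lambda>\<theta>. of_real r * exp (\<i> * of_real \<theta>)))"
    using circle_point_in_sphere[OF \<open>0 \<le> r\<close>]
    by (intro continuous_on_compose continuous_intros continuous_on_subset[OF assms(1)]) blast
  then show "continuous_on {0..2 * pi} (\<lambda>\<theta>. h (of_real r * exp (\<i> * of_real \<theta>)) / (2 * pi))"
    by (intro continuous_on_divide) (auto simp: o_def)
qed

lemma circ_avg_mono:
  assumes "continuous_on (sphere 0 r) h" "continuous_on (sphere 0 r) k" "0 \<le> r"
    and "\<And>z. z \<in> sphere 0 r \<Longrightarrow> h z \<le> k z"
  shows "circ_avg h r \<le> circ_avg k r"
  unfolding circ_avg_def
  by (intro set_integral_mono circ_avg_set_integrable assms divide_right_mono circle_point_in_sphere) auto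

lemma circ_avg_cong:
  assumes "0 \<le> r" "\<And>z. z \<in> sphere 0 r \<Longrightarrow> h z = k z"
  shows "circ_avg h r = circ_avg k r"
  unfolding circ_avg_def
  using assms circle_point_in_sphere[OF \<open>0 \<le> r\<close>]
  by (intro set_lebesgue_integral_cong) (auto simp del: mem_sphere mem_sphere_0)

lemma circ_avg_add:
  assumes "continuous_on (sphere 0 r) h" "continuous_on (sphere 0 r) k" "0 \<le> r"
  shows "circ_avg (\<lambda>z. h z + k z) r = circ_avg h r + circ_avg k r"
  unfolding circ_avg_def add_divide_distrib
  by (intro set_integral_add(2) circ_avg_set_integrable assms)

lemma circ_avg_cmult: "circ_avg (\<lambda>z. c * h z) r = c * circ_avg h r"
  unfolding circ_avg_def by (simp flip: set_integral_mult_right)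

lemma circ_avg_const: "circ_avg (\<lambda>z. c) r = c"
  unfolding circ_avg_def
  by (simp add: set_lebesgue_integral_def)

lemma circ_avg_nonneg:
  assumes "\<And>z. 0 \<le> h z"
  shows "0 \<le> circ_avg h r"
  unfolding circ_avg_def set_lebesgue_integral_def
  by (intro Bochner_Integration.integral_nonneg) (auto simp: assms)

lemma circ_avg_sum:
  assumes "finite I" "\<And>i. i \<in> I \<Longrightarrow> continuous_on (sphere 0 r) (h i)" "0 \<le> r"
  shows "circ_avg (\<lambda>z. \<Sum>i\<in>I. h i z) r = (\<Sum>i\<in>I. circ_avg (h i) r)"
  using assms
proof (induction I rule: finite_induct)
  case empty
  show ?case using circ_avg_const[of 0] by simp
next
  case (insert i I)
  then show ?case by (simp add: circ_avg_add continuous_on_sum)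
qed

text \<open>
  The mean value property, read off from Cauchy's integral formula on the circle of radius \<open>r\<close>.
\<close>

lemma circ_avg_Re_holomorphic:
  assumes hol: "Q holomorphic_on ball 0 \<rho>" and r: "0 \<le> r" "r < \<rho>"
  shows "circ_avg (\<lambda>z. Re (Q z)) r = Re (Q 0)"
proof (cases "r = 0")
  case True
  then show ?thesis by (simp add: circ_avg_def set_lebesgue_integral_def)
next
  case False
  with r have r: "0 < r" "r < \<rho>" by auto
  have holc: "Q holomorphic_on cball 0 r"
    by (rule holomorphic_on_subset[OF hol]) (use r in auto)
  have "((\<lambda>u. Q u / (u - 0)) has_contour_integral (2 * of_real pi * \<i> * Q 0)) (circlepath 0 r)"
    by (rule Cauchy_integral_circlepath_simple[OF holc]) (use r in auto)
  then have "((\<lambda>t. Q (r * cis t) / (r * cis t) * r * \<i> * cis t) has_integral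
      (2 * of_real pi * \<i> * Q 0)) {0..2 * pi}"
    unfolding circlepath_def by (subst (asm) has_contour_integral_part_circlepath_iff) auto
  then have "((\<lambda>t. \<i> * Q (r * cis t)) has_integral (\<i> * (2 * of_real pi * Q 0))) {0..2 * pi}"
    using r by (simp add: field_simps)
  from has_integral_mult_right[OF this, of "- \<i>"]
  have "((\<lambda>t. Q (r * cis t)) has_integral (2 * of_real pi * Q 0)) {0..2 * pi}"
    by (simp add: field_simps)
  from has_integral_Re[OF this]
  have "((\<lambda>t. Re (Q (r * cis t))) has_integral (2 * pi * Re (Q 0))) {0..2 * pi}"
    by simp
  from has_integral_mult_right[OF this, of "1 / (2 * pi)"]
  have 1: "((\<lambda>t. Re (Q (of_real r * exp (\<i> * of_real t))) / (2 * pi)) has_integral Re (Q 0)) {0..2 * pi}"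
    by (simp add: cis_conv_exp mult.commute)
  have "continuous_on (sphere 0 r) (\<lambda>z. Re (Q z))"
    by (intro continuous_intros continuous_on_subset[OF holomorphic_on_imp_continuous_on[OF holc]]) auto
  from circ_avg_set_integrable[OF this] r
  have "circ_avg (\<lambda>z. Re (Q z)) r
      = integral {0..2 * pi} (\<lambda>t. Re (Q (of_real r * exp (\<i> * of_real t))) / (2 * pi))"
    unfolding circ_avg_def by (intro set_borel_integral_eq_integral(2)) auto
  with integral_unique[OF 1] show ?thesis by simp
qed

section \<open>Harnack's inequality\<close>

lemma cmod_le_of_Schwarz_quotient:
  fixes \<phi> q :: complex
  assumes "q * (1 - \<phi>) = of_real c * (1 + \<phi>)" "cmod \<phi> \<le> x" "x < 1" "0 \<le> c"
  shows "cmod q \<le> c * (1 + x) / (1 - x)"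
proof -
  have "cmod q * (1 - x) \<le> cmod q * cmod (1 - \<phi>)"
    using norm_triangle_ineq2[of 1 \<phi>] assms by (intro mult_left_mono) auto
  also have "\<dots> = c * cmod (1 + \<phi>)"
    using arg_cong[OF assms(1), of cmod] \<open>0 \<le> c\<close> by (metis abs_of_nonneg norm_mult norm_of_real)
  also have "\<dots> \<le> c * (1 + x)"
    using norm_triangle_ineq[of 1 \<phi>] assms by (intro mult_left_mono) auto
  finally show ?thesis using assms by (simp add: field_simps)
qed

text \<open>
  If \<open>q\<close> maps the disc into the right half plane and \<open>q 0 = c > 0\<close>, then the Cayley transform
  \<open>(q - c) / (q + c)\<close> maps the disc into itself and fixes \<open>0\<close>. The Schwarz lemma bounds it by
  \<open>cmod z\<close>, and inverting the transform gives the estimate.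
\<close>

lemma Harnack_Re_pos_disc:
  fixes q :: "complex \<Rightarrow> complex"
  assumes hol: "q holomorphic_on ball 0 1" and pos: "\<And>z. z \<in> ball 0 1 \<Longrightarrow> 0 < Re (q z)"
    and real: "q 0 = of_real c" and z: "cmod z < 1"
  shows "Re (q z) \<le> c * (1 + cmod z) / (1 - cmod z)"
proof -
  have c: "0 < c" using pos[of 0] real by simp
  have ne: "q w + of_real c \<noteq> 0" if "w \<in> ball 0 1" for w
    using pos[OF that] c by (auto simp: complex_eq_iff)
  define \<phi> where "\<phi> w = (q w - of_real c) / (q w + of_real c)" for w
  have "\<phi> holomorphic_on ball 0 1"
    unfolding \<phi>_def using ne by (intro holomorphic_intros hol) auto
  moreover have "\<phi> 0 = 0" by (simp add: \<phi>_def real)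
  moreover have "cmod (\<phi> w) < 1" if "cmod w < 1" for w
  proof -
    have "0 < 4 * (c * Re (q w))" using pos[of w] that c by simp
    then have "(cmod (q w - of_real c))\<^sup>2 < (cmod (q w + of_real c))\<^sup>2"
      unfolding cmod_power2 by (simp add: power2_eq_square algebra_simps)
    then have "cmod (q w - of_real c) < cmod (q w + of_real c)"
      by (rule power_less_imp_less_base) simp
    then show ?thesis using ne[of w] that by (simp add: \<phi>_def norm_divide)
  qed
  ultimately have le: "cmod (\<phi> z) \<le> cmod z"
    using Schwarz_Lemma(1) z by blast
  have "q z * (1 - \<phi> z) = of_real c * (1 + \<phi> z)"
    using ne[of z] z by (simp add: \<phi>_def field_simps)
  from cmod_le_of_Schwarz_quotient[OF this le z] c
  have "cmod (q z) \<le> c * (1 + cmod z) / (1 - cmod z)" by simp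
  then show ?thesis using complex_Re_le_cmod order_trans by blast
qed

lemma Harnack_inequality:
  assumes hol: "Q holomorphic_on ball a \<rho>"
    and pos: "\<And>z. z \<in> ball a \<rho> \<Longrightarrow> 0 \<le> Re (Q z)" and w: "dist a w < \<rho>"
  shows "Re (Q w) \<le> Re (Q a) * (\<rho> + dist a w) / (\<rho> - dist a w)"
proof -
  have \<rho>: "0 < \<rho>" using w zero_le_dist[of a w] by linarith
  define x where "x = dist a w / \<rho>"
  have x: "0 \<le> x" "x < 1" using w \<rho> by (auto simp: x_def)
  have "Re (Q w) \<le> Re (Q a) * (1 + x) / (1 - x)"
  proof (rule field_le_epsilon)
    fix e :: real assume e: "0 < e"
    \<comment> \<open>Adding a small constant to Q makes its real part strictly positive; this value costs exactly e in the end.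
      Subtracting the imaginary part at the centre makes the value there real.\<close>
    define \<delta> where "\<delta> = e * (1 - x) / (1 + x)"
    have \<delta>: "0 < \<delta>" using e x by (simp add: \<delta>_def)
    define q where "q \<zeta> = Q (a + of_real \<rho> * \<zeta>) + of_real \<delta> - of_real (Im (Q a)) * \<i>" for \<zeta>
    have in_ball: "a + of_real \<rho> * \<zeta> \<in> ball a \<rho>" if "\<zeta> \<in> ball 0 1" for \<zeta>
      using that \<rho> by (simp add: dist_norm norm_mult)
    have "(Q \<circ> (\<lambda>\<zeta>. a + of_real \<rho> * \<zeta>)) holomorphic_on ball 0 1"
      using in_ball by (intro holomorphic_on_compose_gen[OF _ hol]) (auto intro!: holomorphic_intros)
    then have "q holomorphic_on ball 0 1"
      unfolding q_def by (intro holomorphic_intros) (auto simp: o_def)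
    moreover have "0 < Re (q z)" if "z \<in> ball 0 1" for z
      using pos[OF in_ball[OF that]] \<delta> by (simp add: q_def)
    moreover have "q 0 = of_real (Re (Q a) + \<delta>)"
      by (simp add: q_def complex_eq_iff)
    moreover define z where "z = (w - a) / of_real \<rho>"
    moreover have cz: "cmod z = x" using \<rho> by (simp add: z_def x_def norm_divide dist_norm norm_minus_commute)
    ultimately have "Re (q z) \<le> (Re (Q a) + \<delta>) * (1 + x) / (1 - x)"
      using Harnack_Re_pos_disc[of q "Re (Q a) + \<delta>" z] x by auto
    also have "\<dots> = Re (Q a) * (1 + x) / (1 - x) + e"
    proof -
      have "\<delta> * (1 + x) / (1 - x) = e" using x by (simp add: \<delta>_def)
      then show ?thesis by (simp add: distrib_right add_divide_distrib)
    qed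
    finally show "Re (Q w) \<le> Re (Q a) * (1 + x) / (1 - x) + e"
      using \<rho> \<delta> by (simp add: q_def z_def)
  qed
  also have "Re (Q a) * (1 + x) / (1 - x) = Re (Q a) * (\<rho> + dist a w) / (\<rho> - dist a w)"
    using \<rho> w by (simp add: x_def field_simps)
  finally show ?thesis .
qed

section \<open>Harmonic majorants of powers of the modulus\<close>

lemma norm_eq_zcnj: "z \<in> sphere 0 R \<Longrightarrow> z * cnj z = of_real (R\<^sup>2)"
  by (simp add: complex_norm_square[symmetric])

text \<open>
  On a circle about \<open>0\<close> these are the trigonometric polynomials: there \<open>cnj z\<close> equals a constant
  multiple of \<open>1 / z\<close>, so that products can be reduced to sums of this shape again.
\<close>

definition harmonic_poly_on :: "complex set \<Rightarrow> (complex \<Rightarrow> complex) \<Rightarrow> bool" where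
  "harmonic_poly_on S h \<longleftrightarrow> (\<exists>P Q. \<forall>z\<in>S. h z = poly P z + cnj (poly Q z))"

lemma harmonic_poly_add:
  assumes "harmonic_poly_on S h" "harmonic_poly_on S k"
  shows "harmonic_poly_on S (\<lambda>z. h z + k z)"
proof -
  obtain P Q P' Q' where "\<forall>z\<in>S. h z = poly P z + cnj (poly Q z)" "\<forall>z\<in>S. k z = poly P' z + cnj (poly Q' z)"
    using assms unfolding harmonic_poly_on_def by blast
  then have "\<forall>z\<in>S. h z + k z = poly (P + P') z + cnj (poly (Q + Q') z)" by simp
  then show ?thesis unfolding harmonic_poly_on_def by blast
qed

lemma harmonic_poly_cmult:
  assumes "harmonic_poly_on S h"
  shows "harmonic_poly_on S (\<lambda>z. c * h z)"
proof -
  obtain P Q where "\<forall>z\<in>S. h z = poly P z + cnj (poly Q z)"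
    using assms unfolding harmonic_poly_on_def by blast
  then have "\<forall>z\<in>S. c * h z = poly (smult c P) z + cnj (poly (smult (cnj c) Q) z)"
    by (simp add: algebra_simps)
  then show ?thesis unfolding harmonic_poly_on_def by blast
qed

lemma harmonic_poly_cnj:
  assumes "harmonic_poly_on S h"
  shows "harmonic_poly_on S (\<lambda>z. cnj (h z))"
proof -
  obtain P Q where "\<forall>z\<in>S. h z = poly P z + cnj (poly Q z)"
    using assms unfolding harmonic_poly_on_def by blast
  then have "\<forall>z\<in>S. cnj (h z) = poly Q z + cnj (poly P z)" by simp
  then show ?thesis unfolding harmonic_poly_on_def by blast
qed

text \<open>
  The only product that leaves the shape \<open>poly P z + cnj (poly Q z)\<close> is \<open>z * cnj (z * Q' z)\<close>, and
  \<open>z * cnj z\<close> is constant on the circle. Everything else about products follows from this case.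
\<close>

lemma harmonic_poly_mult_z:
  assumes "harmonic_poly_on (sphere 0 R) h"
  shows "harmonic_poly_on (sphere 0 R) (\<lambda>z. z * h z)"
proof -
  obtain P Q where h: "\<forall>z\<in>sphere 0 R. h z = poly P z + cnj (poly Q z)"
    using assms unfolding harmonic_poly_on_def by blast
  obtain b Q' where Q: "Q = pCons b Q'" by (cases Q)
  have "z * h z = poly (pCons 0 P + [:0, cnj b:]) z + cnj (poly (smult (of_real (R\<^sup>2)) Q') z)"
    if z: "z \<in> sphere 0 R" for z
  proof -
    have "z * h z = z * poly P z + z * cnj b + (z * cnj z) * cnj (poly Q' z)"
      using h z by (simp add: Q algebra_simps)
    then show ?thesis unfolding norm_eq_zcnj[OF z] by (simp add: algebra_simps)
  qed
  then show ?thesis unfolding harmonic_poly_on_def by blast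
qed

lemma harmonic_poly_poly_mult:
  assumes "harmonic_poly_on (sphere 0 R) h"
  shows "harmonic_poly_on (sphere 0 R) (\<lambda>z. poly P z * h z)"
proof (induction P)
  case 0
  then show ?case using harmonic_poly_cmult[OF assms, of 0] by simp
next
  case (pCons a P)
  have "(\<lambda>z. poly (pCons a P) z * h z) = (\<lambda>z. a * h z + z * (poly P z * h z))"
    by (simp add: algebra_simps)
  then show ?case
    using harmonic_poly_add[OF harmonic_poly_cmult[OF assms, of a] harmonic_poly_mult_z[OF pCons.IH]]
    by simp
qed

lemma harmonic_poly_mult:
  assumes h: "harmonic_poly_on (sphere 0 R) h" and k: "harmonic_poly_on (sphere 0 R) k"
  shows "harmonic_poly_on (sphere 0 R) (\<lambda>z. h z * k z)"
proof -
  obtain P Q where hz: "\<forall>z\<in>sphere 0 R. h z = poly P z + cnj (poly Q z)"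
    using h unfolding harmonic_poly_on_def by blast
  have "harmonic_poly_on (sphere 0 R) (\<lambda>z. poly P z * k z + cnj (poly Q z * cnj (k z)))"
    by (intro harmonic_poly_add harmonic_poly_cnj harmonic_poly_poly_mult k)
  then show ?thesis
    unfolding harmonic_poly_on_def using hz by (simp add: algebra_simps)
qed

lemma harmonic_poly_of_real_polynomial_function:
  fixes f :: "complex \<Rightarrow> real"
  assumes "real_polynomial_function f"
  shows "harmonic_poly_on (sphere 0 R) (\<lambda>z. of_real (f z))"
  using assms
proof induction
  case (linear f)
  then interpret bounded_linear f .
  define c where "c = Complex (f 1 / 2) (- f \<i> / 2)"
  have "complex_of_real (f z) = poly [:0, c:] z + cnj (poly [:0, c:] z)" for z
  proof -
    have "f z = f (Re z *\<^sub>R 1 + Im z *\<^sub>R \<i>)"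
      by (rule arg_cong[of _ _ f]) (simp add: complex_eq_iff)
    also have "\<dots> = Re z * f 1 + Im z * f \<i>" by (simp only: add scaleR) simp
    also have "\<dots> = 2 * Re (c * z)" by (simp add: c_def)
    finally have "complex_of_real (f z) = c * z + cnj (c * z)" unfolding complex_add_cnj by simp
    then show ?thesis by (simp add: mult.commute)
  qed
  then show ?case unfolding harmonic_poly_on_def by blast
next
  case (const c)
  have "complex_of_real c = poly [:of_real c:] z + cnj (poly 0 z)" for z by simp
  then show ?case unfolding harmonic_poly_on_def by blast
next
  case (add f g)
  then show ?case by (simp add: harmonic_poly_add)
next
  case (mult f g)
  then show ?case by (simp add: harmonic_poly_mult)
qed

text \<open>
  Real polynomials in \<open>Re z\<close> and \<open>Im z\<close> are dense by Stone--Weierstrass, and on a circle each of them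
  is the real part of a complex polynomial. This solves the Dirichlet problem in the disc up to an
  arbitrarily small error, with a boundary function that extends to an entire one.
\<close>

lemma circle_approx_Re_poly:
  fixes h :: "complex \<Rightarrow> real"
  assumes "continuous_on (sphere 0 R) h" "0 < e"
  shows "\<exists>Q. \<forall>z\<in>sphere 0 R. \<bar>h z - Re (poly Q z)\<bar> < e"
proof -
  obtain f where f: "real_polynomial_function f" and close: "\<forall>z\<in>sphere 0 R. \<bar>h z - f z\<bar> < e"
    using Stone_Weierstrass_real_polynomial_function[OF compact_sphere assms] by metis
  obtain P Q where eq: "\<forall>z\<in>sphere 0 R. complex_of_real (f z) = poly P z + cnj (poly Q z)"
    using harmonic_poly_of_real_polynomial_function[OF f, of R] unfolding harmonic_poly_on_def by metis
  have "Re (poly (P + Q) z) = f z" if "z \<in> sphere 0 R" for z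
    using arg_cong[OF bspec[OF eq that], of Re] by simp
  with close show ?thesis by metis
qed

text \<open>
  The local form of subharmonicity of \<open>cmod (F z) powr s\<close>, for every \<open>s > 0\<close>: near each point it dominates the
  modulus of a holomorphic function, with equality at the point. Where \<open>F\<close> does not vanish this
  function is a branch of \<open>F powr s\<close>; at a zero of \<open>F\<close> it is \<open>0\<close>.
\<close>

lemma local_branch_modulus_powr:
  fixes F :: "complex \<Rightarrow> complex"
  assumes hol: "F holomorphic_on S" "open S" and z0: "z0 \<in> S" and s: "0 < s"
  obtains H d where "0 < d" "ball z0 d \<subseteq> S" "H holomorphic_on ball z0 d"
    "H z0 = of_real (cmod (F z0) powr s)" "\<And>z. z \<in> ball z0 d \<Longrightarrow> cmod (H z) \<le> cmod (F z) powr s"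
proof (cases "F z0 = 0")
  case True
  obtain d where "0 < d" "ball z0 d \<subseteq> S"
    using hol(2) z0 open_contains_ball by blast
  then show thesis
    using True s by (intro that[of d "\<lambda>_. 0"]) auto
next
  case False
  define f where "f z = F z / F z0" for z
  have cont: "continuous_on S f"
    unfolding f_def using False by (intro continuous_intros holomorphic_on_imp_continuous_on hol) auto
  have "open (S \<inter> f -` ball 1 1)"
    using continuous_open_preimage[OF cont \<open>open S\<close> open_ball] .
  moreover have "z0 \<in> S \<inter> f -` ball 1 1" using z0 False by (simp add: f_def)
  ultimately obtain d where d: "0 < d" "ball z0 d \<subseteq> S \<inter> f -` ball 1 1"
    using open_contains_ball by blast
  have Re_pos: "0 < Re (f z)" if "z \<in> ball z0 d" for z
  proof -
    have "cmod (1 - f z) < 1" using d that by (auto simp: dist_norm)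
    then show ?thesis using complex_Re_le_cmod[of "1 - f z"] by simp
  qed
  have holf: "f holomorphic_on ball z0 d"
    unfolding f_def using d False by (intro holomorphic_intros holomorphic_on_subset[OF hol(1)]) auto
  define H where "H z = of_real (cmod (F z0) powr s) * (f z powr of_real s)" for z
  show thesis
  proof (rule that[OF d(1)])
    show "ball z0 d \<subseteq> S" using d by blast
    show "H holomorphic_on ball z0 d"
      unfolding H_def using Re_pos
      by (intro holomorphic_intros holf) (auto simp: complex_nonpos_Reals_iff dest: leD)
    show "H z0 = of_real (cmod (F z0) powr s)" using False by (simp add: H_def f_def)
    show "cmod (H z) \<le> cmod (F z) powr s" if "z \<in> ball z0 d" for z
      using False by (simp add: H_def norm_mult norm_powr_real_powr' f_def norm_divide powr_divide)
  qed
qed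

text \<open>
  The maximum principle for the subharmonic function \<open>cmod (F z) powr s - Re (Q z)\<close>. At an interior maximum
  the local branch \<open>H\<close> makes \<open>exp (H - Q)\<close> attain its maximal modulus, so it is constant nearby and
  the maximum is attained on a whole disc.
\<close>

lemma modulus_powr_le_Re_of_boundary:
  assumes hol: "F holomorphic_on S" "open S" "cball 0 R \<subseteq> S" and s: "0 < s"
    and Q: "Q holomorphic_on UNIV"
    and bd: "\<And>z. z \<in> sphere 0 R \<Longrightarrow> cmod (F z) powr s \<le> Re (Q z)"
    and w: "w \<in> cball 0 R"
  shows "cmod (F w) powr s \<le> Re (Q w)"
proof (rule ccontr)
  assume neg: "\<not> ?thesis"
  define u where "u z = cmod (F z) powr s - Re (Q z)" for z
  have contF: "continuous_on (cball 0 R) F"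
    using holomorphic_on_imp_continuous_on[OF hol(1)] continuous_on_subset hol(3) by blast
  have cont: "continuous_on (cball 0 R) u"
    unfolding u_def using s
    by (intro continuous_intros contF continuous_on_powr'
        continuous_on_subset[OF holomorphic_on_imp_continuous_on[OF Q]]) auto
  obtain m where m: "m \<in> cball 0 R" "\<And>z. z \<in> cball 0 R \<Longrightarrow> u z \<le> u m"
    using continuous_attains_sup[OF compact_cball _ cont] w by blast
  \<comment> \<open>A maximizer z0 of largest modulus cannot have a disc of further maximizers around it.\<close>
  define M where "M = {z \<in> cball 0 R. u z = u m}"
  have "compact M"
  proof -
    have "closed M"
      unfolding M_def using continuous_closed_preimage_constant[OF cont closed_cball] by simp
    moreover have "bounded M"
      by (rule bounded_subset[OF bounded_cball[of 0 R]]) (auto simp: M_def)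
    ultimately show ?thesis by (simp add: compact_eq_bounded_closed)
  qed
  moreover have "m \<in> M" using m by (simp add: M_def)
  ultimately obtain z0 where z0: "z0 \<in> M" "\<And>z. z \<in> M \<Longrightarrow> cmod z \<le> cmod z0"
    using continuous_attains_sup[of M cmod] continuous_on_norm_id by blast
  have um: "0 < u m" using m(2)[OF w] neg by (simp add: u_def)
  have "z0 \<notin> sphere 0 R"
    using bd[of z0] um z0(1) by (auto simp: M_def u_def)
  then have z0b: "z0 \<in> ball 0 R" using z0(1) by (auto simp: M_def)
  have holb: "F holomorphic_on ball 0 R"
    using hol(1,3) ball_subset_cball holomorphic_on_subset subset_trans by metis
  obtain H d where d: "0 < d" "ball z0 d \<subseteq> ball 0 R" and H: "H holomorphic_on ball z0 d"
    "H z0 = of_real (cmod (F z0) powr s)" "\<And>z. z \<in> ball z0 d \<Longrightarrow> cmod (H z) \<le> cmod (F z) powr s"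
    using local_branch_modulus_powr[OF holb open_ball z0b s] by metis
  define G where "G z = exp (H z - Q z)" for z
  have holG: "G holomorphic_on ball z0 d"
    unfolding G_def by (intro holomorphic_intros H holomorphic_on_subset[OF Q]) auto
  have uG: "Re (H z - Q z) \<le> u z" if "z \<in> ball z0 d" for z
    using H(3)[OF that] complex_Re_le_cmod[of "H z"] by (simp add: u_def)
  have uG0: "Re (H z0 - Q z0) = u m"
    using z0(1) by (simp add: M_def u_def H(2))
  have "cmod (G z) \<le> cmod (G z0)" if "z \<in> ball z0 d" for z
  proof -
    have "z \<in> cball 0 R" using that d ball_subset_cball by blast
    then show ?thesis using uG[OF that] m(2)[of z] uG0 unfolding G_def norm_exp_eq_Re exp_le_cancel_iff by linarith
  qed
  then have "G constant_on ball z0 d"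
    using maximum_modulus_principle[OF holG open_ball connected_ball open_ball subset_refl, of z0] d by simp
  then have const: "G z = G z0" if "z \<in> ball z0 d" for z
    using that d unfolding constant_on_def by (metis centre_in_ball)
  have inM: "z \<in> M" if "z \<in> ball z0 d" for z
  proof -
    have "exp (Re (H z - Q z)) = exp (Re (H z0 - Q z0))"
      using const[OF that] unfolding G_def by (metis norm_exp_eq_Re)
    then have "u m \<le> u z" using uG[OF that] uG0 by simp
    moreover have "z \<in> cball 0 R" using that d ball_subset_cball by blast
    ultimately show ?thesis using m(2)[of z] by (simp add: M_def)
  qed
  define e :: complex where "e = (if z0 = 0 then 1 else sgn z0)"
  define z1 where "z1 = z0 + of_real (d / 2) * e"
  have "cmod e = 1" by (simp add: e_def norm_sgn)
  then have "z1 \<in> ball z0 d" using d by (simp add: z1_def dist_norm norm_mult)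
  moreover have "cmod z1 > cmod z0"
  proof (cases "z0 = 0")
    case True
    then show ?thesis using d by (simp add: z1_def e_def)
  next
    case False
    have "z1 = of_real (1 + d / 2 / cmod z0) * z0"
      using False by (simp add: z1_def e_def sgn_div_norm scaleR_conv_of_real field_simps)
    then have "cmod z1 = (1 + d / 2 / cmod z0) * cmod z0"
      using d by (metis abs_of_pos add_pos_nonneg divide_nonneg_nonneg less_eq_real_def norm_ge_zero norm_mult norm_of_real zero_le_numeral zero_less_one)
    also have "\<dots> = cmod z0 + d / 2" using False by (simp add: distrib_right)
    finally show ?thesis using d by simp
  qed
  ultimately show False using z0(2)[OF inM[of z1]] by simp
qed

text \<open>
  Close to the boundary values of \<open>cmod (F z) powr s\<close> from above there is the real part of a polynomial, and the
  maximum principle carries the domination inside. The mean value property bounds its value at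
  \<open>0\<close>. Statements about \<open>cmod (F z) powr s\<close>, including those with \<open>s < 1\<close>, are thereby reduced to statements
  about nonnegative harmonic functions.
\<close>

lemma harmonic_majorant:
  assumes hol: "F holomorphic_on S" "open S" "cball 0 R \<subseteq> S" and s: "0 < s" and R: "0 \<le> R" and e: "0 < e"
  obtains Q where "Q holomorphic_on UNIV" "\<And>z. z \<in> cball 0 R \<Longrightarrow> cmod (F z) powr s \<le> Re (Q z)"
    "Re (Q 0) \<le> circ_avg (\<lambda>z. cmod (F z) powr s) R + e"
proof -
  have "continuous_on (sphere 0 R) F"
    using holomorphic_on_imp_continuous_on[OF hol(1)] continuous_on_subset hol(3) sphere_cball subset_trans
    by meson
  then have cont: "continuous_on (sphere 0 R) (\<lambda>z. cmod (F z) powr s)"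
    using s by (intro continuous_intros continuous_on_powr') auto
  then have "continuous_on (sphere 0 R) (\<lambda>z. cmod (F z) powr s + e / 2)" 
    by (intro continuous_on_add continuous_on_const)
  then obtain P where P: "\<forall>z\<in>sphere 0 R. \<bar>cmod (F z) powr s + e / 2 - Re (poly P z)\<bar> < e / 2"
    using circle_approx_Re_poly[of R _ "e / 2"] e by fastforce
  have holP: "poly P holomorphic_on A" for A by (intro holomorphic_intros)
  show thesis
  proof (rule that[OF holP])
    show "cmod (F z) powr s \<le> Re (poly P z)" if "z \<in> cball 0 R" for z
    proof (rule modulus_powr_le_Re_of_boundary[OF hol s holP _ that])
      fix y :: complex assume "y \<in> sphere 0 R"
      with P have "\<bar>cmod (F y) powr s + e / 2 - Re (poly P y)\<bar> < e / 2" by blast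
      then show "cmod (F y) powr s \<le> Re (poly P y)" unfolding abs_less_iff by linarith
    qed
    have "Re (poly P 0) = circ_avg (\<lambda>z. Re (poly P z)) R"
      using circ_avg_Re_holomorphic[OF holP, of R "R + 1"] R by simp
    also have "\<dots> \<le> circ_avg (\<lambda>z. cmod (F z) powr s + e) R"
    proof (rule circ_avg_mono[OF _ _ R])
      fix y :: complex assume "y \<in> sphere 0 R"
      with P have "\<bar>cmod (F y) powr s + e / 2 - Re (poly P y)\<bar> < e / 2" by blast
      then show "Re (poly P y) \<le> cmod (F y) powr s + e" unfolding abs_less_iff by linarith
    qed (intro cont continuous_intros holomorphic_on_imp_continuous_on holP)+
    also have "\<dots> = circ_avg (\<lambda>z. cmod (F z) powr s) R + e"
      by (simp add: circ_avg_add[OF cont _ R] circ_avg_const)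
    finally show "Re (poly P 0) \<le> circ_avg (\<lambda>z. cmod (F z) powr s) R + e" .
  qed
qed

section \<open>Growth of integral means and of derivatives\<close>

text \<open>
  Hardy's theorem: the majorant has the same average on every circle.
\<close>

lemma circ_avg_modulus_powr_mono:
  assumes hol: "F holomorphic_on ball 0 1" and s: "0 < s" and r: "0 \<le> r" "r \<le> R" "R < 1"
  shows "circ_avg (\<lambda>z. cmod (F z) powr s) r \<le> circ_avg (\<lambda>z. cmod (F z) powr s) R"
proof (rule field_le_epsilon)
  fix e :: real assume e: "0 < e"
  have cb: "cball 0 R \<subseteq> ball (0::complex) 1" using r by auto
  obtain Q where Q: "Q holomorphic_on UNIV" "\<And>z. z \<in> cball 0 R \<Longrightarrow> cmod (F z) powr s \<le> Re (Q z)"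
    "Re (Q 0) \<le> circ_avg (\<lambda>z. cmod (F z) powr s) R + e"
    using harmonic_majorant[OF hol open_ball cb s _ e] r by (metis order_trans)
  have sub: "sphere 0 r \<subseteq> ball (0::complex) 1" using r by auto
  have "circ_avg (\<lambda>z. cmod (F z) powr s) r \<le> circ_avg (\<lambda>z. Re (Q z)) r"
    using r s Q(2)
    by (intro circ_avg_mono continuous_intros continuous_on_powr' \<open>0 \<le> r\<close>
        continuous_on_subset[OF holomorphic_on_imp_continuous_on[OF hol] sub]
        continuous_on_subset[OF holomorphic_on_imp_continuous_on[OF Q(1)]]) auto
  also have "\<dots> = Re (Q 0)"
    using circ_avg_Re_holomorphic[of Q "r + 1" r] Q(1) r by (auto intro: holomorphic_on_subset)
  also note Q(3)
  finally show "circ_avg (\<lambda>z. cmod (F z) powr s) r \<le> circ_avg (\<lambda>z. cmod (F z) powr s) R + e" .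
qed

text \<open>
  Harnack's inequality for the majorant gives the sharp factor \<open>1 / (R - cmod z)\<close>, which is the origin of
  the exponent \<open>1 / s\<close> in the conditions of the final theorem.
\<close>

lemma modulus_powr_pointwise:
  assumes hol: "F holomorphic_on ball 0 1" and s: "0 < s" and R: "R < 1" and z: "cmod z < R"
  shows "cmod (F z) powr s \<le> 2 / (R - cmod z) * circ_avg (\<lambda>z. cmod (F z) powr s) R"
proof (rule field_le_epsilon)
  fix e :: real assume e: "0 < e"
  define k where "k = 2 / (R - cmod z)"
  have k: "0 < k" using z by (simp add: k_def)
  have cb: "cball 0 R \<subseteq> ball (0::complex) 1" using R by auto
  have R0: "0 \<le> R" using z norm_ge_zero[of z] by linarith
  obtain Q where Q: "Q holomorphic_on UNIV" "\<And>z. z \<in> cball 0 R \<Longrightarrow> cmod (F z) powr s \<le> Re (Q z)"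
    "Re (Q 0) \<le> circ_avg (\<lambda>z. cmod (F z) powr s) R + e / k"
    using harmonic_majorant[OF hol open_ball cb s R0, of "e / k"] e k by auto
  have Qpos: "0 \<le> Re (Q w)" if "w \<in> cball 0 R" for w
    using Q(2)[OF that] powr_ge_zero order_trans by blast
  have "cmod (F z) powr s \<le> Re (Q z)" using Q(2) z by simp
  also have "\<dots> \<le> Re (Q 0) * (R + dist 0 z) / (R - dist 0 z)"
    using z Qpos by (intro Harnack_inequality holomorphic_on_subset[OF Q(1)]) auto
  also have "\<dots> \<le> Re (Q 0) * 2 / (R - cmod z)"
    using z R Qpos[of 0] R0 by (auto intro!: divide_right_mono mult_left_mono)
  also have "\<dots> = k * Re (Q 0)" by (simp add: k_def)
  also have "\<dots> \<le> k * (circ_avg (\<lambda>z. cmod (F z) powr s) R + e / k)"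
    using Q(3) k by (intro mult_left_mono) auto
  also have "\<dots> = k * circ_avg (\<lambda>z. cmod (F z) powr s) R + e" using k by (simp add: distrib_left)
  finally show "cmod (F z) powr s
      \<le> 2 / (R - cmod z) * circ_avg (\<lambda>z. cmod (F z) powr s) R + e" by (simp add: k_def)
qed

lemma Cauchy_deriv_powr_le:
  assumes hol: "F holomorphic_on ball 0 1" and s: "0 < s" and d: "0 < d" "cmod z + d < 1"
    and B: "\<And>w. w \<in> sphere z d \<Longrightarrow> cmod (F w) powr s \<le> B"
  shows "cmod (deriv F z) powr s \<le> d powr (- s) * B"
proof -
  have "z + of_real d \<in> sphere z d" using d by (simp add: dist_norm)
  from B[OF this] have B0: "0 \<le> B" using powr_ge_zero order_trans by blast
  have subS: "cball z d \<subseteq> ball 0 1"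
  proof
    fix w assume "w \<in> cball z d"
    then show "w \<in> ball 0 1" using d norm_triangle_sub[of w z] by (simp add: dist_norm norm_minus_commute)
  qed
  have "cmod ((deriv ^^ 1) F z) \<le> fact 1 * B powr (1 / s) / d ^ 1"
  proof (rule Cauchy_inequality)
    show "F holomorphic_on ball z d"
      using holomorphic_on_subset[OF hol] subS ball_subset_cball by blast
    show "continuous_on (cball z d) F"
      using holomorphic_on_imp_continuous_on[OF holomorphic_on_subset[OF hol subS]] .
    show "cmod (F w) \<le> B powr (1 / s)" if "cmod (z - w) = d" for w
    proof -
      have "(cmod (F w) powr s) powr (1 / s) \<le> B powr (1 / s)"
        using B[of w] that s by (intro powr_mono2) (auto simp: dist_norm)
      then show ?thesis using s by (simp add: powr_powr)
    qed
  qed (use d in auto)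
  then have "cmod (deriv F z) powr s \<le> (B powr (1 / s) / d) powr s"
    using s by (intro powr_mono2) auto
  also have "\<dots> = d powr (- s) * B"
    using d s B0 by (simp add: powr_divide powr_powr powr_minus_divide)
  finally show ?thesis .
qed

lemma deriv_powr_pointwise:
  assumes hol: "F holomorphic_on ball 0 1" and s: "0 < s" and R: "R < 1" and z: "cmod z < R"
  shows "cmod (deriv F z) powr s
    \<le> ((R - cmod z) / 2) powr (- s) * (4 / (R - cmod z) * circ_avg (\<lambda>z. cmod (F z) powr s) R)"
proof (rule Cauchy_deriv_powr_le[OF hol s])
  show "0 < (R - cmod z) / 2" "cmod z + (R - cmod z) / 2 < 1" using z R by (auto simp: field_simps)
  fix w assume "w \<in> sphere z ((R - cmod z) / 2)"
  then have "cmod (w - z) = (R - cmod z) / 2" by (simp add: dist_norm norm_minus_commute)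
  then have w: "cmod w \<le> cmod z + (R - cmod z) / 2"
    using norm_triangle_sub[of w z] by linarith
  have wR: "cmod w < R" "(R - cmod z) / 2 \<le> R - cmod w"
    using w z by (auto simp: field_simps)
  then have "cmod (F w) powr s \<le> 2 / (R - cmod w) * circ_avg (\<lambda>z. cmod (F z) powr s) R"
    by (intro modulus_powr_pointwise hol s R wR)
  also have "\<dots> \<le> 2 / ((R - cmod z) / 2) * circ_avg (\<lambda>z. cmod (F z) powr s) R"
    using wR z by (intro mult_right_mono divide_left_mono circ_avg_nonneg mult_pos_pos) auto
  finally show "cmod (F w) powr s \<le> 4 / (R - cmod z) * circ_avg (\<lambda>z. cmod (F z) powr s) R" by simp
qed

text \<open>
  On the circle of radius \<open>d = (R - cmod z) / 2\<close> about \<open>z\<close> Harnack's inequality in the disc of radius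
  \<open>2 * d\<close> compares the majorant with its value at the centre: \<open>(2 * d + d) / (2 * d - d) = 3\<close>.
\<close>

lemma deriv_powr_le_majorant:
  assumes hol: "F holomorphic_on ball 0 1" and s: "0 < s" and R: "R < 1"
    and Q: "Q holomorphic_on UNIV" "\<And>z. z \<in> cball 0 R \<Longrightarrow> cmod (F z) powr s \<le> Re (Q z)"
    and z: "cmod z < R"
  shows "cmod (deriv F z) powr s \<le> ((R - cmod z) / 2) powr (- s) * (3 * Re (Q z))"
proof (rule Cauchy_deriv_powr_le[OF hol s])
  define d where "d = (R - cmod z) / 2"
  have d: "0 < d" "cmod z + 2 * d = R" using z by (auto simp: d_def field_simps)
  show "0 < (R - cmod z) / 2" "cmod z + (R - cmod z) / 2 < 1" using z R by (auto simp: field_simps)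
  have sub: "ball z (2 * d) \<subseteq> cball 0 R"
  proof
    fix w assume "w \<in> ball z (2 * d)"
    then show "w \<in> cball 0 R" using d norm_triangle_sub[of w z] by (simp add: dist_norm norm_minus_commute)
  qed
  have Qpos: "0 \<le> Re (Q w)" if "w \<in> cball 0 R" for w
    using Q(2)[OF that] powr_ge_zero order_trans by blast
  fix w assume "w \<in> sphere z ((R - cmod z) / 2)"
  then have w: "dist z w = d" by (simp add: d_def)
  then have wb: "w \<in> ball z (2 * d)" using d by simp
  have "cmod (F w) powr s \<le> Re (Q w)" using Q(2) sub wb by blast
  also have "\<dots> \<le> Re (Q z) * (2 * d + d) / (2 * d - d)"
  proof -
    have "Q holomorphic_on ball z (2 * d)" "\<And>x. x \<in> ball z (2 * d) \<Longrightarrow> 0 \<le> Re (Q x)"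
      using Qpos sub by (auto intro: holomorphic_on_subset[OF Q(1)])
    from Harnack_inequality[OF this, of w] wb w show ?thesis by simp
  qed
  also have "\<dots> = 3 * Re (Q z)" using d by simp
  finally show "cmod (F w) powr s \<le> 3 * Re (Q z)" .
qed

text \<open>
  Since the bound for the derivative involves the majorant at the same point, it can be averaged over
  a circle without loss.
\<close>

lemma deriv_powr_circ_avg:
  assumes hol: "F holomorphic_on ball 0 1" and s: "0 < s" and r: "0 \<le> r" "r < R" "R < 1"
  shows "circ_avg (\<lambda>z. cmod (deriv F z) powr s) r
    \<le> 3 * ((R - r) / 2) powr (- s) * circ_avg (\<lambda>z. cmod (F z) powr s) R"
proof (rule field_le_epsilon)
  fix e :: real assume e: "0 < e"
  define k where "k = 3 * ((R - r) / 2) powr (- s)"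
  have k: "0 < k" using r by (simp add: k_def)
  have cb: "cball 0 R \<subseteq> ball (0::complex) 1" using r by auto
  obtain Q where Q: "Q holomorphic_on UNIV" "\<And>z. z \<in> cball 0 R \<Longrightarrow> cmod (F z) powr s \<le> Re (Q z)"
    "Re (Q 0) \<le> circ_avg (\<lambda>z. cmod (F z) powr s) R + e / k"
    using harmonic_majorant[OF hol open_ball cb s _, of "e / k"] e k r by auto
  have sub: "sphere 0 r \<subseteq> ball (0::complex) 1" using r by auto
  have "circ_avg (\<lambda>z. cmod (deriv F z) powr s) r \<le> circ_avg (\<lambda>z. k * Re (Q z)) r"
  proof (rule circ_avg_mono[OF _ _ r(1)])
    show "continuous_on (sphere 0 r) (\<lambda>z. cmod (deriv F z) powr s)"
      using s by (intro continuous_intros continuous_on_powr' continuous_on_subset[OF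
          holomorphic_on_imp_continuous_on[OF holomorphic_deriv[OF hol open_ball]] sub]) auto
    show "continuous_on (sphere 0 r) (\<lambda>z. k * Re (Q z))"
      by (intro continuous_intros continuous_on_subset[OF holomorphic_on_imp_continuous_on[OF Q(1)]]) auto
    show "cmod (deriv F z) powr s \<le> k * Re (Q z)" if "z \<in> sphere 0 r" for z
      using deriv_powr_le_majorant[OF hol s r(3) Q(1,2), of z] that r by (simp add: k_def mult_ac)
  qed
  also have "\<dots> = k * Re (Q 0)"
    using circ_avg_Re_holomorphic[of Q "r + 1" r] Q(1) r
    by (auto intro: holomorphic_on_subset simp: circ_avg_cmult)
  also have "\<dots> \<le> k * (circ_avg (\<lambda>z. cmod (F z) powr s) R + e / k)"
    using Q(3) k by (intro mult_left_mono) auto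
  also have "\<dots> = k * circ_avg (\<lambda>z. cmod (F z) powr s) R + e" using k by (simp add: distrib_left)
  finally show "circ_avg (\<lambda>z. cmod (deriv F z) powr s) r
    \<le> 3 * ((R - r) / 2) powr (- s) * circ_avg (\<lambda>z. cmod (F z) powr s) R + e" by (simp add: k_def)
qed

section \<open>Radial weights on a geometric sequence of radii\<close>

lemma weight_nonneg: "radial_weight w \<Longrightarrow> 0 \<le> r \<Longrightarrow> r < 1 \<Longrightarrow> 0 \<le> w r"
  by (simp add: radial_weight_def)

lemma weight_set_integrable:
  assumes "radial_weight w" "0 \<le> a" "b \<le> 1"
  shows "set_integrable lebesgue {a..<b} w"
  by (rule set_integrable_subset[of _ "{0..<1}"]) (use assms in \<open>auto simp: radial_weight_def\<close>)

lemma weight_indicator_eq: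
  "ennreal (w r) * indicator A r = ennreal (indicator A r *\<^sub>R w r)"
  by (simp add: indicator_def)

lemma weight_measurable:
  assumes "radial_weight w" "0 \<le> a" "b \<le> 1"
  shows "(\<lambda>r. ennreal (w r) * indicator {a..<b} r) \<in> borel_measurable lebesgue"
  unfolding weight_indicator_eq
  using weight_set_integrable[OF assms] unfolding set_integrable_def
  by (intro measurable_compose[OF _ measurable_ennreal]) auto

lemma weight_nn_integral:
  assumes w: "radial_weight w" and ab: "0 \<le> a" "b \<le> 1"
  shows "(\<integral>\<^sup>+ r\<in>{a..<b}. ennreal (w r) \<partial>lebesgue) = ennreal (LINT r:{a..<b}|lebesgue. w r)"
  unfolding weight_indicator_eq set_lebesgue_integral_def
  using weight_set_integrable[OF assms] unfolding set_integrable_def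
  by (intro nn_integral_eq_integral) (use ab weight_nonneg[OF w] in \<open>auto simp: indicator_def\<close>)

lemma weight_tail:
  assumes "radial_weight w" "0 \<le> a"
  shows "(\<integral>\<^sup>+ r\<in>{a..<1}. ennreal (w r) \<partial>lebesgue) = ennreal (omega_hat w a)"
  using weight_nn_integral[OF assms, of 1] by (simp add: omega_hat_def)

lemma omega_hat_split:
  assumes w: "radial_weight w" and ab: "0 \<le> a" "a \<le> b" "b \<le> 1"
  shows "omega_hat w a = (LINT r:{a..<b}|lebesgue. w r) + omega_hat w b"
proof -
  have eq: "{a..<1} = {a..<b} \<union> {b..<1}" using ab by auto
  show ?thesis
    unfolding omega_hat_def eq
    by (intro set_integral_Un weight_set_integrable w) (use ab in auto)
qed

lemma weight_between:
  assumes w: "radial_weight w" and ab: "0 \<le> a" "a \<le> b" "b \<le> 1"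
  shows "(\<integral>\<^sup>+ r\<in>{a..<b}. ennreal (w r) \<partial>lebesgue) = ennreal (omega_hat w a - omega_hat w b)"
  using weight_nn_integral[OF w ab(1,3)] omega_hat_split[OF assms] by simp

lemma omega_hat_antimono:
  assumes w: "radial_weight w" and ab: "0 \<le> a" "a \<le> b" "b \<le> 1"
  shows "omega_hat w b \<le> omega_hat w a"
proof -
  have "0 \<le> (LINT r:{a..<b}|lebesgue. w r)"
    unfolding set_lebesgue_integral_def
    by (intro Bochner_Integration.integral_nonneg)
       (use ab weight_nonneg[OF w] in \<open>auto simp: indicator_def\<close>)
  then show ?thesis using omega_hat_split[OF assms] by simp
qed

lemma omega_hat_pos: "radial_weight w \<Longrightarrow> 0 \<le> r \<Longrightarrow> r < 1 \<Longrightarrow> 0 < omega_hat w r"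
  by (simp add: radial_weight_def)

text \<open>
  The boundary is approached along \<open>1 - L powr (-k)\<close>. Both weight conditions become comparisons of
  \<^const>\<open>omega_hat\<close> at consecutive nodes, once \<open>L\<close> is large.
\<close>

definition node :: "nat \<Rightarrow> nat \<Rightarrow> real" where
  "node L k = 1 - 1 / real L ^ k"

lemma node_0 [simp]: "node L 0 = 0"
  by (simp add: node_def)

lemma node_Suc: "node L (Suc k) = 1 - (1 - node L k) / real L"
  by (simp add: node_def)

lemma node_bounds:
  assumes "2 \<le> L"
  shows "0 \<le> node L k" "node L k < 1"
  using assms by (auto simp: node_def divide_le_eq)

lemma one_minus_node: "1 - node L k = 1 / real L ^ k"
  by (simp add: node_def)

lemma node_strict_mono: "2 \<le> L \<Longrightarrow> j < k \<Longrightarrow> node L j < node L k"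
  unfolding node_def by (simp add: frac_less2 power_strict_increasing)

lemma node_mono: "2 \<le> L \<Longrightarrow> j \<le> k \<Longrightarrow> node L j \<le> node L k"
  using node_strict_mono[of L j k] by (cases "j = k") auto

lemma node_gap:
  assumes L: "2 \<le> L"
  shows "1 / (2 * real L ^ N) \<le> node L (Suc N) - node L N"
proof -
  have "1 / (real L * real L ^ N) \<le> 1 / (2 * real L ^ N)"
    using L by (intro divide_left_mono mult_right_mono) auto
  then show ?thesis by (simp add: node_def field_simps)
qed

lemma node_tendsto: "2 \<le> L \<Longrightarrow> node L \<longlonglongrightarrow> 1"
proof -
  assume L: "2 \<le> L"
  have "(\<lambda>k. 1 - (1 / real L) ^ k) \<longlonglongrightarrow> 1 - 0"
    by (intro tendsto_intros LIMSEQ_power_zero) (use L in auto)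
  then show ?thesis by (simp add: node_def[abs_def] power_one_over)
qed

lemma filterlim_node: "2 \<le> L \<Longrightarrow> filterlim (node L) (at_left 1) sequentially"
  unfolding filterlim_at using node_tendsto node_bounds(2)
  by (auto intro!: always_eventually simp: less_imp_neq)

lemma D_hat_iterate:
  assumes w: "radial_weight w" and C: "0 < C"
    and doub: "\<And>r. 0 \<le> r \<Longrightarrow> r < 1 \<Longrightarrow> omega_hat w r \<le> C * omega_hat w ((1 + r) / 2)"
    and r: "0 \<le> r" "r < 1"
  shows "omega_hat w r \<le> C ^ m * omega_hat w (1 - (1 - r) / 2 ^ m)"
proof (induction m)
  case (Suc m)
  define x where "x = 1 - (1 - r) / 2 ^ m"
  define u where "u = (1 - r) / 2 ^ m"
  have "u \<le> (1 - r) / 1" unfolding u_def using r by (intro divide_left_mono) auto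
  moreover have "0 < u" using r by (simp add: u_def)
  ultimately have x: "0 \<le> x" "x < 1" using r by (auto simp: x_def u_def[symmetric])
  have "omega_hat w r \<le> C ^ m * (C * omega_hat w ((1 + x) / 2))"
    using Suc.IH doub[OF x] C by (intro order_trans[OF Suc.IH] mult_left_mono) (auto simp: x_def)
  also have "(1 + x) / 2 = 1 - (1 - r) / 2 ^ Suc m" by (simp add: x_def field_simps)
  finally show ?case by (simp add: mult_ac)
qed simp

text \<open>
  The doubling condition is iterated until \<open>2 ^ m\<close> exceeds \<open>L\<close>; the reverse condition holds for \<open>L\<close> because
  \<open>L\<close> is at least its own constant \<open>K\<close>.
\<close>

lemma D_weights_geometric:
  assumes "w \<in> D_weights"
  obtains L :: nat and D e :: real where "2 \<le> L" "1 \<le> D" "e < 1"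
    "\<And>k. omega_hat w (node L k) \<le> D * omega_hat w (node L (Suc k))"
    "\<And>k. omega_hat w (node L (Suc k)) \<le> e * omega_hat w (node L k)"
proof -
  have w: "radial_weight w" using assms by (simp add: D_weights_def D_hat_def)
  obtain C where C: "0 < C" and doub: "\<And>r. 0 \<le> r \<Longrightarrow> r < 1 \<Longrightarrow> omega_hat w r \<le> C * omega_hat w ((1 + r) / 2)"
    using assms unfolding D_weights_def D_hat_def by fastforce
  obtain K c where K: "1 < K" and c: "1 < c"
    and dec: "\<And>r. 0 \<le> r \<Longrightarrow> r < 1 \<Longrightarrow> c * omega_hat w (1 - (1 - r) / K) \<le> omega_hat w r"
    using assms unfolding D_weights_def D_check_def by fastforce
  obtain L0 :: nat where L0: "K \<le> real L0" using real_arch_simple by blast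
  define L where "L = max 2 L0"
  have L: "2 \<le> L" "K \<le> real L" using L0 by (auto simp: L_def)
  obtain m :: nat where m: "real L \<le> 2 ^ m"
    using real_arch_pow[of 2 "real L"] by (auto intro: less_imp_le)
  note nb = node_bounds[OF L(1)]
  have up: "omega_hat w (node L k) \<le> C ^ m * omega_hat w (node L (Suc k))" for k
  proof -
    have "(1 - node L k) / 2 ^ m \<le> (1 - node L k) / real L"
      using nb[of k] m L by (intro divide_left_mono) auto
    then have "omega_hat w (1 - (1 - node L k) / 2 ^ m) \<le> omega_hat w (node L (Suc k))"
      using nb[of k] nb[of "Suc k"] by (intro omega_hat_antimono w) (auto simp: node_Suc)
    then show ?thesis
      using D_hat_iterate[OF w C doub nb(1)[of k] nb(2)[of k], of m] C
      by (meson mult_left_mono order_trans zero_le_power less_imp_le)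
  qed
  have D1: "1 \<le> C ^ m"
  proof -
    have "omega_hat w (node L (Suc 0)) \<le> omega_hat w (node L 0)"
      using nb[of "Suc 0"] by (intro omega_hat_antimono w) auto
    with up[of 0] have "1 * omega_hat w (node L (Suc 0)) \<le> C ^ m * omega_hat w (node L (Suc 0))" by simp
    then show ?thesis using omega_hat_pos[OF w nb[of "Suc 0"]] by (rule mult_right_le_imp_le)
  qed
  have down: "omega_hat w (node L (Suc k)) \<le> (1 / c) * omega_hat w (node L k)" for k
  proof -
    have "(1 - node L k) / real L \<le> (1 - node L k) / K"
      using nb[of k] L K by (intro divide_left_mono) auto
    moreover have "(1 - node L k) / K \<le> 1 - node L k"
      using nb[of k] K by (simp add: divide_le_eq)
    ultimately have "omega_hat w (node L (Suc k)) \<le> omega_hat w (1 - (1 - node L k) / K)"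
      using nb[of k] nb[of "Suc k"] K by (intro omega_hat_antimono w) (auto simp: node_Suc)
    then have "c * omega_hat w (node L (Suc k)) \<le> omega_hat w (node L k)"
      using dec[OF nb[of k]] c by (meson mult_left_mono order_trans less_imp_le zero_less_one)
    then show ?thesis using c by (simp add: field_simps)
  qed
  show thesis by (rule that[OF L(1) D1 _ up down]) (use c in auto)
qed

lemma weight_moment_measurable:
  assumes w: "radial_weight w"
  shows "(\<lambda>r. ennreal (r powr x * w r) * indicator {0..<1} r) \<in> borel_measurable lebesgue"
proof -
  have "(\<lambda>r. ennreal (r powr x * w r) * indicator {0..<1} r)
      = (\<lambda>r. ennreal (r powr x) * (ennreal (w r) * indicator {0..<1} r))"
    by (auto simp: fun_eq_iff indicator_def ennreal_mult' )
  moreover have "(\<lambda>r::real. ennreal (r powr x)) \<in> borel_measurable lebesgue"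
    by (rule measurable_completion) measurable
  ultimately show ?thesis
    using weight_measurable[OF w, of 0 1] by (auto intro: borel_measurable_times_ennreal)
qed

lemma powr_le_exp:
  fixes r x y :: real
  assumes "0 \<le> r" "r \<le> 1 - y" "0 \<le> x"
  shows "r powr x \<le> exp (- x * y)"
proof (cases "r = 0")
  case False
  then have "ln r \<le> - y" using ln_le_minus_one[of r] assms by simp
  then have "x * ln r \<le> x * (- y)" using assms by (intro mult_left_mono)
  then show ?thesis using False by (simp add: powr_def mult.commute)
qed simp

text \<open>
  A high power \<open>r powr x\<close> effectively restricts the integral of the weight to \<open>1 - r \<le> 1 / x\<close>. Induction on \<open>N\<close>:
  with \<open>y = x / L\<close>, below the next node the factor \<open>r powr (x - y)\<close> is at most \<open>1 / (2 * D)\<close>, which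
  beats the doubling constant in the bound for \<open>y\<close>; beyond that node the tail of the weight remains.
\<close>

lemma weight_moment_le:
  assumes w: "radial_weight w" and L: "2 \<le> L" and D: "0 < D"
    and doub: "\<And>k. omega_hat w (node L k) \<le> D * omega_hat w (node L (Suc k))"
    and M: "exp (- M / 2) * D \<le> 1 / 2" "0 \<le> M"
    and x: "M * real L ^ N \<le> x"
  shows "(\<integral>\<^sup>+ r\<in>{0..<1}. ennreal (r powr x * w r) \<partial>lebesgue) \<le> ennreal (2 * omega_hat w (node L N))"
  using x
proof (induction N arbitrary: x)
  case 0
  then have x: "0 \<le> x" using M by simp
  have "(\<integral>\<^sup>+ r\<in>{0..<1}. ennreal (r powr x * w r) \<partial>lebesgue)
      \<le> (\<integral>\<^sup>+ r\<in>{0..<1}. ennreal (w r) \<partial>lebesgue)"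
  proof (intro nn_integral_mono)
    fix r :: real
    have "r powr x * w r \<le> 1 * w r" if "r \<in> {0..<1}"
      using that x weight_nonneg[OF w, of r] by (intro mult_right_mono powr_le1) auto
    then show "ennreal (r powr x * w r) * indicator {0..<1} r \<le> ennreal (w r) * indicator {0..<1} r"
      by (auto simp: indicator_def intro: ennreal_leI)
  qed
  also have "\<dots> = ennreal (omega_hat w 0)" by (rule weight_tail[OF w]) simp
  also have "\<dots> \<le> ennreal (2 * omega_hat w (node L 0))"
    using omega_hat_pos[OF w, of 0] by (intro ennreal_leI) simp
  finally show ?case .
next
  case (Suc N)
  define y where "y = x / real L"
  define \<rho> where "\<rho> = node L (Suc N)"
  have \<rho>: "0 \<le> \<rho>" "\<rho> < 1" using node_bounds[OF L] by (auto simp: \<rho>_def)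
  have L0: "0 < real L" using L by simp
  have y: "M * real L ^ N \<le> y" using Suc.prems L0 by (simp add: y_def field_simps)
  have x0: "0 \<le> x" using Suc.prems M(2) by (meson mult_nonneg_nonneg order_trans of_nat_0_le_iff zero_le_power)
  have xy: "M / 2 \<le> (x - y) * (1 - \<rho>)"
  proof -
    have "x / real L \<le> x / 2" using L x0 by (intro divide_left_mono) auto
    then have "x / 2 \<le> x - y" by (simp add: y_def)
    then have "M * real L ^ Suc N / 2 \<le> x - y" using Suc.prems by linarith
    then have "M * real L ^ Suc N / 2 * (1 / real L ^ Suc N) \<le> (x - y) * (1 - \<rho>)"
      unfolding \<rho>_def one_minus_node by (intro mult_right_mono) auto
    then show ?thesis using L0 by simp
  qed
  have xy0: "0 \<le> x - y"
  proof -
    have "x / real L \<le> x / 1" using L x0 by (intro divide_left_mono) auto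
    then show ?thesis by (simp add: y_def)
  qed
  have ptw: "ennreal (r powr x * w r) * indicator {0..<1} r
      \<le> ennreal (1 / (2 * D)) * (ennreal (r powr y * w r) * indicator {0..<1} r)
        + ennreal (w r) * indicator {\<rho>..<1} r" for r
  proof (cases "r \<in> {0..<1}")
    case r: True
    have wr: "0 \<le> w r" using weight_nonneg[OF w] r by simp
    show ?thesis
    proof (cases "r < \<rho>")
      case True
      have "r powr x = r powr (x - y) * r powr y" by (simp flip: powr_add)
      also have "\<dots> \<le> exp (- (x - y) * (1 - \<rho>)) * r powr y"
        using r True xy0 by (intro mult_right_mono powr_le_exp) auto
      also have "\<dots> \<le> exp (- M / 2) * r powr y"
      proof (intro mult_right_mono)
        have "- (x - y) * (1 - \<rho>) \<le> - M / 2" using xy by linarith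
        then show "exp (- (x - y) * (1 - \<rho>)) \<le> exp (- M / 2)" by (simp only: exp_le_cancel_iff)
      qed simp
      also have "\<dots> \<le> 1 / (2 * D) * r powr y"
        using M D by (intro mult_right_mono) (auto simp: field_simps)
      finally have "r powr x * w r \<le> 1 / (2 * D) * (r powr y * w r)"
        using wr by (metis mult.assoc mult_right_mono)
      then have "ennreal (r powr x * w r) \<le> ennreal (1 / (2 * D)) * ennreal (r powr y * w r)"
        using D by (metis ennreal_leI ennreal_mult' divide_nonneg_pos mult_pos_pos zero_le_one zero_less_numeral)
      then show ?thesis using r True by simp
    next
      case False
      have "r powr x * w r \<le> 1 * w r"
        using r x0 wr by (intro mult_right_mono powr_le1) auto
      then have "ennreal (r powr x * w r) \<le> ennreal (w r)" by (simp add: ennreal_leI)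
      then show ?thesis using r False by (simp add: add_increasing)
    qed
  qed simp
  have "(\<integral>\<^sup>+ r\<in>{0..<1}. ennreal (r powr x * w r) \<partial>lebesgue)
      \<le> (\<integral>\<^sup>+ r. ennreal (1 / (2 * D)) * (ennreal (r powr y * w r) * indicator {0..<1} r)
        + ennreal (w r) * indicator {\<rho>..<1} r \<partial>lebesgue)"
    by (intro nn_integral_mono ptw)
  also have "\<dots> = ennreal (1 / (2 * D)) * (\<integral>\<^sup>+ r\<in>{0..<1}. ennreal (r powr y * w r) \<partial>lebesgue)
      + (\<integral>\<^sup>+ r\<in>{\<rho>..<1}. ennreal (w r) \<partial>lebesgue)"
    using weight_moment_measurable[OF w] weight_measurable[OF w \<rho>(1), of 1]
    by (subst nn_integral_add) (auto simp: nn_integral_cmult)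
  also have "\<dots> \<le> ennreal (1 / (2 * D)) * ennreal (2 * omega_hat w (node L N)) + ennreal (omega_hat w \<rho>)"
    unfolding weight_tail[OF w \<rho>(1)] by (intro add_mono mult_left_mono Suc.IH y) auto
  also have "\<dots> = ennreal (1 / (2 * D) * (2 * omega_hat w (node L N)) + omega_hat w \<rho>)"
    using D omega_hat_pos[OF w \<rho>] omega_hat_pos[OF w node_bounds[OF L], of N]
    by (simp add: ennreal_mult'[symmetric] flip: ennreal_plus)
  also have "\<dots> \<le> ennreal (2 * omega_hat w (node L (Suc N)))"
    using doub[of N] D by (intro ennreal_leI) (simp add: \<rho>_def field_simps)
  finally show ?case .
qed

section \<open>Bounds for the mixed norm\<close>

lemma integral_mean_nonneg: "0 \<le> integral_mean p r f"
  by (simp add: integral_mean_eq_circ_avg)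

lemma integral_mean_mono:
  assumes "F holomorphic_on ball 0 1" "0 < s" "0 \<le> r" "r \<le> R" "R < 1"
  shows "integral_mean s r F \<le> integral_mean s R F"
  unfolding integral_mean_eq_circ_avg
  using assms by (intro powr_mono2 circ_avg_modulus_powr_mono circ_avg_nonneg) auto

text \<open>
  On each interval the monotonicity of the integral means allows their value at the left end point.
  Only the lower bound is made of measurable functions, so no measurability of
  \<open>r \<mapsto> integral_mean s r F\<close> has to be established.
\<close>

lemma mixed_norm_pow_ge_disjoint:
  assumes w: "radial_weight w" and t: "0 < t" and s: "0 < s" and F: "F holomorphic_on ball 0 1"
    and I: "finite I" and disj: "disjoint_family_on (\<lambda>i. {a i..<b i}) I"
    and ab: "\<And>i. i \<in> I \<Longrightarrow> 0 \<le> a i" "\<And>i. i \<in> I \<Longrightarrow> a i \<le> b i" "\<And>i. i \<in> I \<Longrightarrow> b i \<le> 1"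
  shows "ennreal (\<Sum>i\<in>I. integral_mean s (a i) F powr t * (omega_hat w (a i) - omega_hat w (b i)))
    \<le> mixed_norm_pow w s t F"
proof -
  define c where "c i = integral_mean s (a i) F powr t" for i
  have "ennreal (\<Sum>i\<in>I. c i * (omega_hat w (a i) - omega_hat w (b i)))
      = (\<Sum>i\<in>I. ennreal (c i) * (\<integral>\<^sup>+ r\<in>{a i..<b i}. ennreal (w r) \<partial>lebesgue))"
  proof (subst sum_ennreal[symmetric])
    show "0 \<le> c i * (omega_hat w (a i) - omega_hat w (b i))" if "i \<in> I" for i
      using omega_hat_antimono[OF w ab[OF that]] by (simp add: c_def)
    show "(\<Sum>i\<in>I. ennreal (c i * (omega_hat w (a i) - omega_hat w (b i))))
      = (\<Sum>i\<in>I. ennreal (c i) * (\<integral>\<^sup>+ r\<in>{a i..<b i}. ennreal (w r) \<partial>lebesgue))"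
      by (intro sum.cong refl) (simp add: weight_between[OF w ab] ennreal_mult' c_def)
  qed
  also have "\<dots> = (\<integral>\<^sup>+ r. (\<Sum>i\<in>I. ennreal (c i) * (ennreal (w r) * indicator {a i..<b i} r)) \<partial>lebesgue)"
  proof (subst nn_integral_sum)
    show "(\<lambda>r. ennreal (c i) * (ennreal (w r) * indicator {a i..<b i} r)) \<in> borel_measurable lebesgue"
      if "i \<in> I" for i
      by (rule borel_measurable_times_ennreal[OF borel_measurable_const weight_measurable[OF w ab(1,3)[OF that]]])
    show "(\<Sum>i\<in>I. ennreal (c i) * (\<integral>\<^sup>+ r\<in>{a i..<b i}. ennreal (w r) \<partial>lebesgue))
      = (\<Sum>i\<in>I. \<integral>\<^sup>+ r. ennreal (c i) * (ennreal (w r) * indicator {a i..<b i} r) \<partial>lebesgue)"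
      by (intro sum.cong refl nn_integral_cmult[symmetric] weight_measurable[OF w ab(1,3)])
  qed
  also have "\<dots> \<le> mixed_norm_pow w s t F"
    unfolding mixed_norm_pow_def
  proof (intro nn_integral_mono)
    fix r :: real
    show "(\<Sum>i\<in>I. ennreal (c i) * (ennreal (w r) * indicator {a i..<b i} r))
      \<le> ennreal (integral_mean s r F powr t * w r) * indicator {0..<1} r"
    proof (cases "\<exists>i\<in>I. r \<in> {a i..<b i}")
      case True
      then obtain i where i: "i \<in> I" "r \<in> {a i..<b i}" by blast
      have r: "0 \<le> r" "r < 1" "a i \<le> r" using i ab[OF i(1)] by auto
      have "(\<Sum>j\<in>I. ennreal (c j) * (ennreal (w r) * indicator {a j..<b j} r))
          = (\<Sum>j\<in>I. if j = i then ennreal (c i) * ennreal (w r) else 0)"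
      proof (intro sum.cong refl)
        fix j assume j: "j \<in> I"
        have "r \<notin> {a j..<b j}" if "j \<noteq> i"
          using disjoint_family_onD[OF disj i(1) j] i(2) that by blast
        then show "ennreal (c j) * (ennreal (w r) * indicator {a j..<b j} r)
            = (if j = i then ennreal (c i) * ennreal (w r) else 0)"
          using i(2) by (cases "j = i") simp_all
      qed
      also have "\<dots> = ennreal (c i * w r)" using i I by (simp add: ennreal_mult' c_def)
      also have "\<dots> \<le> ennreal (integral_mean s r F powr t * w r)"
        unfolding c_def
      proof (intro ennreal_leI mult_right_mono powr_mono2)
        show "integral_mean s (a i) F \<le> integral_mean s r F"
          using integral_mean_mono[OF F s] ab[OF i(1)] r by simp
      qed (use t integral_mean_nonneg weight_nonneg[OF w r(1,2)] in auto)
      finally show ?thesis using r by simp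
    next
      case False
      then have "(\<Sum>i\<in>I. ennreal (c i) * (ennreal (w r) * indicator {a i..<b i} r)) = 0"
        by (intro sum.neutral) simp
      then show ?thesis by simp
    qed
  qed
  finally show ?thesis by (simp add: c_def)
qed

lemma mixed_norm_pow_ge_tail:
  assumes w: "radial_weight w" and t: "0 < t" and s: "0 < s" and F: "F holomorphic_on ball 0 1"
    and r: "0 \<le> r" "r < 1"
  shows "ennreal (integral_mean s r F powr t * omega_hat w r) \<le> mixed_norm_pow w s t F"
  using mixed_norm_pow_ge_disjoint[OF w t s F, of "{()}" "\<lambda>_. r" "\<lambda>_. 1"] r
  by (simp add: disjoint_family_on_def omega_hat_def set_lebesgue_integral_def)

lemma mixed_norm_pow_le:
  assumes w: "radial_weight w" and q: "0 < q"
    and B: "\<And>r. 0 \<le> r \<Longrightarrow> r < 1 \<Longrightarrow> integral_mean p r f \<le> B r"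
  shows "mixed_norm_pow w p q f \<le> (\<integral>\<^sup>+ r\<in>{0..<1}. ennreal (B r powr q * w r) \<partial>lebesgue)"
  unfolding mixed_norm_pow_def
  by (intro nn_integral_mono)
     (auto simp: indicator_def intro!: ennreal_leI mult_right_mono powr_mono2 B
        integral_mean_nonneg weight_nonneg[OF w] less_imp_le[OF q])

section \<open>The integration operator\<close>

lemma T_op_primitive:
  assumes f: "f holomorphic_on ball 0 1" and g: "g holomorphic_on ball 0 1"
  shows "T_op g f holomorphic_on ball 0 1"
    and "\<And>z. z \<in> ball 0 1 \<Longrightarrow> deriv (T_op g f) z = f z * deriv g z"
proof -
  have "(\<lambda>z. f z * deriv g z) holomorphic_on ball 0 1"
    by (intro holomorphic_intros f g holomorphic_deriv) auto
  then obtain G where G0: "\<And>z. z \<in> ball 0 1 \<Longrightarrow> (G has_field_derivative f z * deriv g z) (at z within ball 0 1)"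
    using holomorphic_convex_primitive'[OF convex_ball open_ball] by blast
  have eq: "T_op g f z = G z - G 0" if "z \<in> ball 0 1" for z
  proof -
    have "closed_segment 0 z \<subseteq> ball 0 1"
      using that by (intro closed_segment_subset) auto
    then show ?thesis
      unfolding T_op_def
      using contour_integral_unique[OF contour_integral_primitive[OF G0 valid_path_linepath]] by simp
  qed
  have G: "(T_op g f has_field_derivative f z * deriv g z) (at z)" if "z \<in> ball 0 1" for z
  proof -
    have "(G has_field_derivative f z * deriv g z) (at z)"
      using G0[OF that] that by (simp add: at_within_open[OF that open_ball])
    then have "((\<lambda>z. G z - G 0) has_field_derivative f z * deriv g z) (at z)"
      using DERIV_diff[OF _ DERIV_const] by fastforce
    then show ?thesis
      by (rule has_field_derivative_transform_within_open[OF _ open_ball that]) (simp add: eq)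
  qed
  show "T_op g f holomorphic_on ball 0 1"
    unfolding holomorphic_on_open[OF open_ball] using G by blast
  show "deriv (T_op g f) z = f z * deriv g z" if "z \<in> ball 0 1" for z
    using G[OF that] by (rule DERIV_imp_deriv)
qed

text \<open>
  Boundedness in a form that only needs an upper bound for the norm of the test function and involves
  extended nonnegative numbers throughout.
\<close>

lemma T_bounded_pow_le:
  assumes T: "T_bounded w p q s t g" and pos: "0 < q" "0 < t"
  obtains C where "0 < C" "\<And>f X. f holomorphic_on ball 0 1 \<Longrightarrow> 0 \<le> X \<Longrightarrow>
    mixed_norm_pow w p q f \<le> ennreal X \<Longrightarrow>
    mixed_norm_pow w s t (T_op g f) \<le> ennreal (C * X powr (t / q))"
proof -
  obtain C0 where C0: "\<And>f. f \<in> mixed_space w p q \<Longrightarrow> T_op g f \<in> mixed_space w s t"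
    "\<And>f. f \<in> mixed_space w p q \<Longrightarrow> mixed_norm w s t (T_op g f) \<le> C0 * mixed_norm w p q f"
    using T unfolding T_bounded_def by blast
  define C1 where "C1 = max C0 1"
  show thesis
  proof (rule that[of "C1 powr t"])
    show "0 < C1 powr t" by (simp add: C1_def)
    fix f X assume f: "f holomorphic_on ball 0 1" and X: "(0::real) \<le> X"
      and le: "mixed_norm_pow w p q f \<le> ennreal X"
    have sp: "f \<in> mixed_space w p q"
      using f le by (auto simp: mixed_space_def intro: le_less_trans ennreal_less_top)
    define Y where "Y = enn2real (mixed_norm_pow w s t (T_op g f))"
    have Y: "mixed_norm_pow w s t (T_op g f) = ennreal Y" "0 \<le> Y"
      using C0(1)[OF sp] by (auto simp: mixed_space_def Y_def)
    have "enn2real (mixed_norm_pow w p q f) \<le> X"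
      using le X by (simp add: enn2real_leI)
    then have "mixed_norm w p q f \<le> X powr (1 / q)"
      unfolding mixed_norm_def using pos by (intro powr_mono2) auto
    have "Y powr (1 / t) \<le> C0 * mixed_norm w p q f"
      using C0(2)[OF sp] by (simp add: mixed_norm_def Y_def)
    also have "\<dots> \<le> C1 * X powr (1 / q)"
      using \<open>mixed_norm w p q f \<le> X powr (1 / q)\<close>
      by (intro mult_mono) (auto simp: C1_def mixed_norm_def)
    finally have "(Y powr (1 / t)) powr t \<le> (C1 * X powr (1 / q)) powr t"
      using pos by (intro powr_mono2) auto
    then have "Y \<le> C1 powr t * X powr (t / q)"
      using pos Y(2) by (simp add: powr_powr powr_mult C1_def)
    then show "mixed_norm_pow w s t (T_op g f) \<le> ennreal (C1 powr t * X powr (t / q))"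
      unfolding Y(1) by (rule ennreal_leI)
  qed
qed

lemma T_bounded_of_constant:
  assumes g: "g constant_on ball 0 1"
  shows "T_bounded w p q s t g"
proof -
  obtain c where c: "\<And>z. z \<in> ball 0 1 \<Longrightarrow> g z = c" using g by (auto simp: constant_on_def)
  have g': "deriv g z = 0" if "z \<in> ball 0 1" for z
  proof -
    have "((\<lambda>_. c) has_field_derivative 0) (at z)" by simp
    then have "(g has_field_derivative 0) (at z)"
      by (rule has_field_derivative_transform_within_open[OF _ open_ball that]) (simp add: c)
    then show ?thesis by (rule DERIV_imp_deriv)
  qed
  have zero: "T_op g f z = 0" if z: "z \<in> ball 0 1" for f z
  proof -
    have "closed_segment 0 z \<subseteq> ball 0 1"
      using z by (intro closed_segment_subset) auto
    then have "((\<lambda>\<zeta>. f \<zeta> * deriv g \<zeta>) has_contour_integral 0) (linepath 0 z)"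
      using g' by (intro has_contour_integral_eq[OF has_contour_integral_0]) auto
    then show ?thesis unfolding T_op_def by (rule contour_integral_unique)
  qed
  have mean0: "integral_mean s r (T_op g f) = 0" if "0 \<le> r" "r < 1" for r f
  proof -
    have "circ_avg (\<lambda>z. cmod (T_op g f z) powr s) r = circ_avg (\<lambda>z. 0) r"
      using that by (intro circ_avg_cong) (auto simp: zero)
    then show ?thesis by (simp add: integral_mean_eq_circ_avg circ_avg_const)
  qed
  have pow0: "mixed_norm_pow w s t (T_op g f) = 0" for f
  proof -
    have "mixed_norm_pow w s t (T_op g f) = (\<integral>\<^sup>+ r. 0 \<partial>(lebesgue :: real measure))"
      unfolding mixed_norm_pow_def by (intro nn_integral_cong) (auto simp: indicator_def mean0)
    then show ?thesis by simp
  qed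
  have "T_op g f holomorphic_on ball 0 1" for f
    by (rule holomorphic_transform[of "\<lambda>_. 0"]) (auto simp: zero)
  then show ?thesis
    unfolding T_bounded_def mixed_space_def mixed_norm_def
    by (intro exI[of _ 0]) (auto simp: pow0)
qed

section \<open>Kernels concentrated at a boundary arc\<close>

lemma one_minus_cnj_mult_pos:
  assumes "cmod a < 1" "cmod z < 1"
  shows "0 < Re (1 - cnj a * z)"
proof -
  have "cmod (cnj a * z) < 1 * 1"
    unfolding norm_mult complex_mod_cnj
    using assms by (intro mult_strict_mono') auto
  then show ?thesis using complex_Re_le_cmod[of "cnj a * z"] by simp
qed

lemma one_minus_cnj_mult_nonzero:
  "cmod a < 1 \<Longrightarrow> cmod z < 1 \<Longrightarrow> 1 - cnj a * z \<noteq> 0"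
  using one_minus_cnj_mult_pos[of a z] by (metis less_irrefl zero_complex.sel(1))

text \<open>
  On a circle the integrand is a constant multiple of the Poisson kernel, the real part of
  \<open>(1 + cnj a * z) / (1 - cnj a * z)\<close>; the mean value property evaluates the integral.
\<close>

lemma circ_avg_inverse_square:
  assumes a: "cmod a < 1" and r: "0 \<le> r" "r < 1"
  shows "circ_avg (\<lambda>z. 1 / (cmod (1 - cnj a * z))\<^sup>2) r = 1 / (1 - (cmod a * r)\<^sup>2)"
proof -
  define Q where "Q z = (1 + cnj a * z) / (1 - cnj a * z)" for z
  have ne: "1 - cnj a * z \<noteq> 0" if "cmod z < 1" for z
    using one_minus_cnj_mult_nonzero[OF a that] .
  have hol: "Q holomorphic_on ball 0 1"
    unfolding Q_def using ne by (intro holomorphic_intros) auto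
  define k where "k = 1 - (cmod a * r)\<^sup>2"
  have "cmod a * r < 1 * 1" using a r by (intro mult_strict_mono') auto
  then have k: "0 < k" using r unfolding k_def by (simp add: power_less_one_iff abs_square_less_1)
  have "circ_avg (\<lambda>z. k * (1 / (cmod (1 - cnj a * z))\<^sup>2)) r = circ_avg (\<lambda>z. Re (Q z)) r"
  proof (rule circ_avg_cong[OF r(1)])
    fix z :: complex assume z: "z \<in> sphere 0 r"
    have "(cmod a * r)\<^sup>2 = (cmod (cnj a * z))\<^sup>2" using z by (simp add: norm_mult)
    then show "k * (1 / (cmod (1 - cnj a * z))\<^sup>2) = Re (Q z)"
      unfolding k_def Q_def Re_divide cmod_power2
      by (simp add: power2_eq_square algebra_simps diff_divide_distrib add_divide_distrib)
  qed
  also have "\<dots> = Re (Q 0)" by (rule circ_avg_Re_holomorphic[OF hol r])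
  finally show ?thesis
    using k unfolding circ_avg_cmult by (simp add: Q_def k_def field_simps)
qed

lemma integral_mean_monomial_mult:
  assumes r: "0 \<le> r" and p: "0 < p"
  shows "integral_mean p r (\<lambda>z. z ^ n * h z) = r ^ n * integral_mean p r h"
proof -
  have "circ_avg (\<lambda>z. cmod (z ^ n * h z) powr p) r
      = circ_avg (\<lambda>z. (r ^ n) powr p * cmod (h z) powr p) r"
    by (rule circ_avg_cong[OF r]) (use r in \<open>auto simp: norm_mult norm_power powr_mult\<close>)
  also have "\<dots> = (r ^ n) powr p * circ_avg (\<lambda>z. cmod (h z) powr p) r"
    by (rule circ_avg_cmult)
  finally show ?thesis
    unfolding integral_mean_eq_circ_avg using r p
    by (simp add: powr_mult powr_powr circ_avg_nonneg)
qed

text \<open>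
  The exponent makes \<open>cmod (kern p a z) powr p\<close> a Poisson kernel up to a factor, for which the integral mean is
  explicit. Concentration in the radial direction is supplied separately by a factor \<open>z ^ n\<close>.
\<close>

definition kern :: "real \<Rightarrow> complex \<Rightarrow> complex \<Rightarrow> complex" where
  "kern p a z = (1 - cnj a * z) powr of_real (- (2 / p))"

lemma kern_holomorphic:
  assumes "cmod a < 1"
  shows "kern p a holomorphic_on ball 0 1"
  unfolding kern_def using one_minus_cnj_mult_pos[OF assms]
  by (intro holomorphic_intros) (force simp: complex_nonpos_Reals_iff)+

lemma cmod_kern: "cmod (kern p a z) = cmod (1 - cnj a * z) powr (- (2 / p))"
  unfolding kern_def by (subst norm_powr_real_powr') auto

lemma circ_avg_kern:
  assumes p: "0 < p" and a: "cmod a < 1" and r: "0 \<le> r" "r < 1"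
  shows "circ_avg (\<lambda>z. cmod (kern p a z) powr p) r \<le> 1 / (1 - cmod a)"
proof -
  have "circ_avg (\<lambda>z. cmod (kern p a z) powr p) r = circ_avg (\<lambda>z. 1 / (cmod (1 - cnj a * z))\<^sup>2) r"
  proof (rule circ_avg_cong[OF r(1)])
    fix z :: complex assume "z \<in> sphere 0 r"
    then have "1 - cnj a * z \<noteq> 0" using one_minus_cnj_mult_nonzero[OF a, of z] r by auto
    then have x: "0 < cmod (1 - cnj a * z)" by simp
    have "cmod (kern p a z) powr p = cmod (1 - cnj a * z) powr (- 2)"
      unfolding cmod_kern powr_powr using p by simp
    also have "\<dots> = 1 / (cmod (1 - cnj a * z))\<^sup>2"
      using x by (simp add: powr_minus_divide)
    finally show "cmod (kern p a z) powr p = 1 / (cmod (1 - cnj a * z))\<^sup>2" .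
  qed
  also have "\<dots> = 1 / (1 - (cmod a * r)\<^sup>2)" by (rule circ_avg_inverse_square[OF a r])
  also have "\<dots> \<le> 1 / (1 - cmod a)"
  proof -
    have "(cmod a * r)\<^sup>2 \<le> cmod a * r"
      using a r mult_left_le_one_le[of "cmod a" r] unfolding power2_eq_square
      by (intro mult_left_le_one_le) (auto simp: mult.commute)
    also have "\<dots> \<le> cmod a" using a r by (simp add: mult_left_le)
    finally show ?thesis using a by (intro divide_left_mono mult_pos_pos) auto
  qed
  finally show ?thesis .
qed

lemma integral_mean_kern:
  assumes p: "0 < p" and a: "cmod a < 1" and r: "0 \<le> r" "r < 1"
  shows "integral_mean p r (kern p a) \<le> (1 - cmod a) powr (- (1 / p))"
proof -
  have "integral_mean p r (kern p a) \<le> (1 / (1 - cmod a)) powr (1 / p)"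
    unfolding integral_mean_eq_circ_avg using p
    by (intro powr_mono2 circ_avg_kern assms circ_avg_nonneg) auto
  also have "\<dots> = (1 - cmod a) powr (- (1 / p))"
    using a by (simp add: powr_divide powr_minus_divide)
  finally show ?thesis .
qed

lemma cmod_kern_diag:
  assumes p: "0 < p" and a: "cmod a < 1"
  shows "(2 * (1 - cmod a)) powr (- (2 / p)) \<le> cmod (kern p a a)"
proof -
  have eq: "cmod (1 - cnj a * a) = 1 - (cmod a)\<^sup>2"
  proof -
    have "1 - cnj a * a = of_real (1 - (cmod a)\<^sup>2)"
      using complex_norm_square[of a] by (simp add: mult.commute)
    then have "cmod (1 - cnj a * a) = \<bar>1 - (cmod a)\<^sup>2\<bar>" by (simp only: norm_of_real)
    then show ?thesis using a by (simp add: abs_square_le_1)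
  qed
  have "1 - (cmod a)\<^sup>2 = (1 + cmod a) * (1 - cmod a)" by (simp add: power2_eq_square algebra_simps)
  also have "\<dots> \<le> 2 * (1 - cmod a)" using a by (intro mult_right_mono) auto
  finally have "1 - (cmod a)\<^sup>2 \<le> 2 * (1 - cmod a)" .
  moreover have "0 < 1 - (cmod a)\<^sup>2" using a by (simp add: abs_square_less_1)
  ultimately show ?thesis unfolding cmod_kern eq using p
    by (intro powr_mono2') auto
qed

text \<open>
  The radial factor with \<open>n\<close> proportional to \<open>L ^ N\<close> is still of constant size on the circle through the
  node \<open>N\<close>.
\<close>

lemma node_power_ge:
  assumes L: "2 \<le> L" and N: "1 \<le> N"
  shows "exp (- 2 * real m) \<le> node L N ^ (m * L ^ N)"
proof -
  define x where "x = 1 / real L ^ N"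
  have LN: "2 \<le> real L ^ N"
  proof -
    have "real L \<le> real L ^ N" using L N by (intro self_le_power) auto
    moreover have "2 \<le> real L" using L by simp
    ultimately show ?thesis by linarith
  qed
  then have x: "0 \<le> x" "x \<le> 1 / 2" "x * real L ^ N = 1"
    using L LN by (auto simp: x_def divide_le_eq)
  have "- 2 * x \<le> ln (1 - x)"
  proof -
    have "x * x \<le> x * (1 / 2)" using x by (intro mult_left_mono) auto
    then have "- 2 * x \<le> - x - 2 * x\<^sup>2" by (simp add: power2_eq_square)
    also have "\<dots> \<le> ln (1 - x)" using ln_one_minus_pos_lower_bound[OF x(1,2)] .
    finally show ?thesis .
  qed
  then have "real (m * L ^ N) * (- 2 * x) \<le> real (m * L ^ N) * ln (1 - x)"
    by (intro mult_left_mono) auto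
  moreover have "real (m * L ^ N) * (- 2 * x) = - 2 * real m"
  proof -
    have "real (m * L ^ N) * (- 2 * x) = - 2 * real m * (x * real L ^ N)" by simp
    then show ?thesis unfolding x(3) by simp
  qed
  ultimately have "exp (- 2 * real m) \<le> exp (real (m * L ^ N) * ln (1 - x))"
    by (simp only: exp_le_cancel_iff)
  also have "\<dots> = (1 - x) ^ (m * L ^ N)" using x by (simp only: exp_of_nat_mult) simp
  finally show ?thesis by (simp add: node_def x_def)
qed

section \<open>Derivative estimates on consecutive circles\<close>

lemma deriv_node_pointwise:
  assumes s: "0 < s" and L: "2 \<le> L"
  obtains C where "0 < C" "\<And>F N z. F holomorphic_on ball 0 1 \<Longrightarrow> cmod z = node L N \<Longrightarrow>
    cmod (deriv F z) \<le> C * (real L ^ N) powr (1 + 1 / s) * integral_mean s (node L (Suc N)) F"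
proof (rule that)
  define C where "C = (8 * 4 powr s) powr (1 / s)"
  show "0 < C" by (simp add: C_def)
  fix F N z assume F: "F holomorphic_on ball 0 1" and z: "cmod z = node L N"
  define X where "X = real L ^ N"
  have X: "0 < X" using L by (simp add: X_def)
  define I where "I = circ_avg (\<lambda>z. cmod (F z) powr s) (node L (Suc N))"
  have I: "0 \<le> I" by (simp add: I_def circ_avg_nonneg)
  define \<delta> where "\<delta> = node L (Suc N) - node L N"
  have \<delta>: "1 / (2 * X) \<le> \<delta>" unfolding X_def \<delta>_def by (rule node_gap[OF L])
  then have \<delta>0: "0 < \<delta>" using X by (meson divide_pos_pos less_le_trans mult_pos_pos zero_less_numeral zero_less_one)
  have "cmod (deriv F z) powr s \<le> (\<delta> / 2) powr (- s) * (4 / \<delta> * I)"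
    using deriv_powr_pointwise[OF F s node_bounds(2)[OF L], of z "Suc N"] z \<delta>0
    by (simp add: \<delta>_def I_def)
  also have "\<dots> \<le> (1 / (4 * X)) powr (- s) * (4 / (1 / (2 * X)) * I)"
    using \<delta> \<delta>0 X s I
    by (intro mult_mono powr_mono2' mult_right_mono divide_left_mono mult_pos_pos) auto
  also have "\<dots> = (8 * 4 powr s) * (X powr (1 + s)) * I"
    using X by (simp add: powr_minus_divide powr_divide powr_mult powr_add)
  finally have "(cmod (deriv F z) powr s) powr (1 / s) \<le> ((8 * 4 powr s) * (X powr (1 + s)) * I) powr (1 / s)"
    using s by (intro powr_mono2) auto
  also have "\<dots> = C * (X powr (1 + s)) powr (1 / s) * I powr (1 / s)"
    using X I by (simp add: C_def powr_mult)
  also have "(X powr (1 + s)) powr (1 / s) = X powr (1 + 1 / s)"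
    using s by (simp add: powr_powr field_simps)
  finally show "cmod (deriv F z) \<le> C * (real L ^ N) powr (1 + 1 / s) * integral_mean s (node L (Suc N)) F"
    using s by (simp add: powr_powr X_def I_def integral_mean_eq_circ_avg)
qed

lemma deriv_node_mean:
  assumes s: "0 < s" and L: "2 \<le> L"
  obtains C where "0 < C" "\<And>F N. F holomorphic_on ball 0 1 \<Longrightarrow>
    integral_mean s (node L N) (deriv F) \<le> C * real L ^ N * integral_mean s (node L (Suc N)) F"
proof (rule that)
  define C where "C = (3 * 4 powr s) powr (1 / s)"
  show "0 < C" by (simp add: C_def)
  fix F N assume F: "F holomorphic_on ball 0 1"
  define X where "X = real L ^ N"
  have X: "0 < X" using L by (simp add: X_def)
  define I where "I = circ_avg (\<lambda>z. cmod (F z) powr s) (node L (Suc N))"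
  have I: "0 \<le> I" by (simp add: I_def circ_avg_nonneg)
  define \<delta> where "\<delta> = node L (Suc N) - node L N"
  have \<delta>: "1 / (2 * X) \<le> \<delta>" unfolding X_def \<delta>_def by (rule node_gap[OF L])
  have "circ_avg (\<lambda>z. cmod (deriv F z) powr s) (node L N) \<le> 3 * (\<delta> / 2) powr (- s) * I"
    using deriv_powr_circ_avg[OF F s node_bounds(1)[OF L] _ node_bounds(2)[OF L], of N "Suc N"]
      node_strict_mono[OF L, of N "Suc N"]
    by (simp add: \<delta>_def I_def)
  also have "\<dots> \<le> 3 * (1 / (4 * X)) powr (- s) * I"
    using \<delta> X s I by (intro mult_right_mono mult_left_mono powr_mono2') auto
  also have "\<dots> = (3 * 4 powr s) * X powr s * I"
    using X by (simp add: powr_minus_divide powr_divide powr_mult)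
  finally have "circ_avg (\<lambda>z. cmod (deriv F z) powr s) (node L N) powr (1 / s)
      \<le> ((3 * 4 powr s) * X powr s * I) powr (1 / s)"
    using s by (intro powr_mono2 circ_avg_nonneg) auto
  also have "\<dots> = C * (X powr s) powr (1 / s) * I powr (1 / s)"
    using X I by (simp add: C_def powr_mult)
  also have "(X powr s) powr (1 / s) = X" using X s by (simp add: powr_powr)
  finally show "integral_mean s (node L N) (deriv F) \<le> C * real L ^ N * integral_mean s (node L (Suc N)) F"
    by (simp add: X_def I_def integral_mean_eq_circ_avg)
qed

lemma maximum_modulus_sphere:
  assumes h: "h holomorphic_on ball 0 1" and z: "cmod z \<le> r" and r: "r < 1"
  obtains a where "cmod a = r" "cmod (h z) \<le> cmod (h a)"
proof -
  have r0: "0 \<le> r" using z norm_ge_zero order_trans by blast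
  have cb: "cball 0 r \<subseteq> ball (0::complex) 1" using r by auto
  have cont: "continuous_on (cball 0 r) h"
    using holomorphic_on_imp_continuous_on[OF holomorphic_on_subset[OF h cb]] .
  have "sphere (0::complex) r \<noteq> {}" using r0 by simp
  moreover have "continuous_on (sphere 0 r) (\<lambda>z. cmod (h z))"
    by (intro continuous_intros continuous_on_subset[OF cont]) auto
  ultimately obtain a where a: "a \<in> sphere 0 r" "\<And>y. y \<in> sphere 0 r \<Longrightarrow> cmod (h y) \<le> cmod (h a)"
    using continuous_attains_sup[OF compact_sphere] by metis
  have "cmod (h z) \<le> cmod (h a)"
  proof (cases "r = 0")
    case True
    then show ?thesis using a(2)[of z] z by simp
  next
    case False
    show ?thesis
    proof (rule maximum_modulus_frontier[of h "cball 0 r"])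
      show "h holomorphic_on interior (cball 0 r)"
        using cb interior_subset by (blast intro: holomorphic_on_subset[OF h])
    qed (use cont a z False r0 in \<open>auto simp: frontier_cball\<close>)
  qed
  with a that show thesis by simp
qed

lemma nonzero_in_smaller_ball:
  assumes h: "h holomorphic_on ball 0 1" and \<xi>: "\<xi> \<in> ball 0 1" "h \<xi> \<noteq> 0" and \<rho>: "0 < \<rho>" "\<rho> < 1"
  shows "\<exists>z\<in>ball 0 \<rho>. h z \<noteq> 0"
proof (rule ccontr)
  assume zero: "\<not> ?thesis"
  have "h \<xi> = (\<lambda>_. 0) \<xi>"
  proof (rule analytic_continuation_open[of "ball 0 \<rho>" "ball 0 1" h "\<lambda>_. 0" \<xi>])
    show "ball 0 \<rho> \<subseteq> ball (0::complex) 1" using \<rho> by (intro subset_ball) auto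
  qed (use zero \<rho> h \<xi>(1) in auto)
  with \<xi>(2) show False by simp
qed

text \<open>
  Maximum modulus: a value that occurs in the small disc is matched on every larger circle, so one
  lower bound serves all radii.
\<close>

lemma modulus_ge_on_circles:
  assumes h: "h holomorphic_on ball 0 1" and \<xi>: "\<xi> \<in> ball 0 1" "h \<xi> \<noteq> 0" and \<rho>: "0 < \<rho>" "\<rho> < 1"
  obtains c where "0 < c" "\<And>r. \<rho> \<le> r \<Longrightarrow> r < 1 \<Longrightarrow> \<exists>a. cmod a = r \<and> c \<le> cmod (h a)"
proof -
  have "\<exists>z\<in>ball 0 \<rho>. h z \<noteq> 0" by (rule nonzero_in_smaller_ball[OF h \<xi> \<rho>])
  then obtain z where z: "cmod z < \<rho>" "h z \<noteq> 0" by auto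
  show thesis
  proof (rule that)
    show "0 < cmod (h z)" using z by simp
    show "\<exists>a. cmod a = r \<and> cmod (h z) \<le> cmod (h a)" if "\<rho> \<le> r" "r < 1" for r
      using maximum_modulus_sphere[OF h, of z r] z that by (metis less_imp_le order_trans)
  qed
qed

lemma nonconstant_deriv_nonzero:
  assumes g: "g holomorphic_on ball 0 1" and nc: "\<not> g constant_on ball 0 1"
  obtains \<xi> where "\<xi> \<in> ball 0 1" "deriv g \<xi> \<noteq> 0"
proof (rule ccontr)
  assume "\<not> thesis"
  with that have "\<And>z. z \<in> ball 0 1 \<Longrightarrow> deriv g z = 0" by blast
  then have "(g has_field_derivative 0) (at z within ball 0 1)" if "z \<in> ball 0 1" for z
    using holomorphic_derivI[OF g open_ball that] that
    by (metis has_field_derivative_at_within)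
  then have "g constant_on ball 0 1"
    using has_field_derivative_zero_constant[OF convex_ball, of 0 1 g] unfolding constant_on_def by blast
  with nc show False ..
qed

section \<open>Constancy from one test function per radius\<close>

text \<open>
  A test function whose means are at most \<open>A * r ^ (m * L ^ N)\<close> has norm at most a constant times
  \<open>A * omega_hat w (node L N) powr (1 / q)\<close> by the moment estimate. On the image only the part of the norm beyond the
  next node is kept. The angular shape of the test function enters through \<open>A\<close> alone.
\<close>

lemma T_bounded_peak:
  assumes T: "T_bounded w p q s t g" and pos: "0 < p" "0 < q" "0 < s" "0 < t"
    and g: "g holomorphic_on ball 0 1" and w: "radial_weight w" and L: "2 \<le> L" and D: "1 \<le> D"
    and doub: "\<And>k. omega_hat w (node L k) \<le> D * omega_hat w (node L (Suc k))"
  obtains m C where "0 < C" "\<And>f A N. f holomorphic_on ball 0 1 \<Longrightarrow> 0 < A \<Longrightarrow>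
      (\<And>r. 0 \<le> r \<Longrightarrow> r < 1 \<Longrightarrow> integral_mean p r f \<le> A * r ^ (m * L ^ N)) \<Longrightarrow>
      integral_mean s (node L (Suc N)) (T_op g f)
        \<le> C * A * omega_hat w (node L N) powr (1 / q - 1 / t)"
proof -
  obtain C0 where C0: "0 < C0" "\<And>f X. f holomorphic_on ball 0 1 \<Longrightarrow> 0 \<le> X \<Longrightarrow>
    mixed_norm_pow w p q f \<le> ennreal X \<Longrightarrow> mixed_norm_pow w s t (T_op g f) \<le> ennreal (C0 * X powr (t / q))"
    using T_bounded_pow_le[OF T pos(2,4)] by blast
  \<comment> \<open>The constant required by the moment estimate for the doubling constant D.\<close>
  define M where "M = 2 * ln (2 * D)"
  have M: "exp (- M / 2) * D \<le> 1 / 2" "0 \<le> M"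
  proof -
    have "exp (- M / 2) = inverse (2 * D)" using D by (simp add: M_def exp_minus)
    then show "exp (- M / 2) * D \<le> 1 / 2" using D by (simp only:) simp
    show "0 \<le> M" using D by (simp add: M_def)
  qed
  obtain m0 :: nat where m0: "M / q \<le> real m0" using real_arch_simple by blast
  \<comment> \<open>The exponent has to be positive: at r = 0 the powers r ^ 0 = 1 and r powr 0 = 0 differ.\<close>
  define m where "m = Suc m0"
  have m: "M \<le> q * real m" "0 < m" using m0 pos by (auto simp: m_def field_simps)
  define C where "C = (D * C0 * 2 powr (t / q)) powr (1 / t)"
  show thesis
  proof (rule that[of C m])
    show "0 < C" using C0 D by (simp add: C_def)
    fix f A N assume f: "f holomorphic_on ball 0 1" and A: "(0::real) < A"
      and le: "\<And>r. 0 \<le> r \<Longrightarrow> r < 1 \<Longrightarrow> integral_mean p r f \<le> A * r ^ (m * L ^ N)"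
    define n where "n = m * L ^ N"
    have n: "0 < n" using m L by (simp add: n_def)
    define W where "W = omega_hat w (node L N)"
    have W: "0 < W" using omega_hat_pos[OF w node_bounds[OF L]] by (simp add: W_def)
    define I where "I = integral_mean s (node L (Suc N)) (T_op g f)"
    have I: "0 \<le> I" by (simp add: I_def integral_mean_nonneg)
    have "mixed_norm_pow w p q f \<le> (\<integral>\<^sup>+ r\<in>{0..<1}. ennreal ((A * r ^ n) powr q * w r) \<partial>lebesgue)"
      unfolding n_def by (intro mixed_norm_pow_le w pos le)
    also have "\<dots> = (\<integral>\<^sup>+ r. ennreal (A powr q) * (ennreal (r powr (q * n) * w r) * indicator {0..<1} r) \<partial>lebesgue)"
    proof (intro nn_integral_cong)
      fix r :: real
      have "(A * r ^ n) powr q * w r = A powr q * (r powr (q * n) * w r)" if "0 \<le> r"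
        using that n A pos by (cases "r = 0") (auto simp: powr_mult powr_powr mult.commute powr_realpow[symmetric] zero_power)
      then show "ennreal ((A * r ^ n) powr q * w r) * indicator {0..<1} r
          = ennreal (A powr q) * (ennreal (r powr (q * n) * w r) * indicator {0..<1} r)"
        by (auto simp: indicator_def ennreal_mult' mult.assoc)
    qed
    also have "\<dots> = ennreal (A powr q) * (\<integral>\<^sup>+ r\<in>{0..<1}. ennreal (r powr (q * n) * w r) \<partial>lebesgue)"
      by (intro nn_integral_cmult weight_moment_measurable w)
    also have "\<dots> \<le> ennreal (A powr q) * ennreal (2 * W)"
      unfolding W_def
    proof (intro mult_left_mono weight_moment_le[OF w L _ doub M])
      have "M * real L ^ N \<le> (q * real m) * real L ^ N" using m by (intro mult_right_mono) auto
      then show "M * real L ^ N \<le> q * real n" by (simp add: n_def mult_ac)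
    qed (use D in auto)
    also have "\<dots> = ennreal (A powr q * (2 * W))" by (simp add: ennreal_mult')
    finally have "mixed_norm_pow w s t (T_op g f) \<le> ennreal (C0 * (A powr q * (2 * W)) powr (t / q))"
      using W by (intro C0(2) f) auto
    moreover have "ennreal (I powr t * omega_hat w (node L (Suc N))) \<le> mixed_norm_pow w s t (T_op g f)"
      unfolding I_def
      by (intro mixed_norm_pow_ge_tail w pos T_op_primitive f g node_bounds L)
    ultimately have "ennreal (I powr t * omega_hat w (node L (Suc N)))
        \<le> ennreal (C0 * (A powr q * (2 * W)) powr (t / q))"
      by (rule order_trans[rotated])
    then have "I powr t * omega_hat w (node L (Suc N)) \<le> C0 * (A powr q * (2 * W)) powr (t / q)"
      using C0 by (subst (asm) ennreal_le_iff) auto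
    moreover have "I powr t * (W / D) \<le> I powr t * omega_hat w (node L (Suc N))"
      using doub[of N] D by (intro mult_left_mono) (auto simp: W_def field_simps)
    ultimately have "I powr t * (W / D) \<le> C0 * (A powr q * (2 * W)) powr (t / q)" by linarith
    then have "I powr t \<le> D * C0 * (A powr q * (2 * W)) powr (t / q) / W"
      using D W by (simp add: field_simps)
    also have "\<dots> = (D * C0 * 2 powr (t / q)) * A powr t * W powr (t / q - 1)"
      using pos A W by (simp add: powr_mult powr_powr powr_diff)
    finally have "(I powr t) powr (1 / t) \<le> ((D * C0 * 2 powr (t / q)) * A powr t * W powr (t / q - 1)) powr (1 / t)"
      using pos by (intro powr_mono2) auto
    also have "\<dots> = C * (A powr t) powr (1 / t) * (W powr (t / q - 1)) powr (1 / t)"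
      using D C0 by (simp add: powr_mult C_def)
    also have "(A powr t) powr (1 / t) = A" using pos A by (simp add: powr_powr)
    also have "(W powr (t / q - 1)) powr (1 / t) = W powr (1 / q - 1 / t)"
    proof -
      have "(t / q - 1) * (1 / t) = 1 / q - 1 / t" using pos by (simp add: field_simps)
      then show ?thesis by (simp only: powr_powr)
    qed
    finally show "integral_mean s (node L (Suc N)) (T_op g f)
        \<le> C * A * omega_hat w (node L N) powr (1 / q - 1 / t)"
      using pos I by (simp add: powr_powr I_def[symmetric] W_def)
  qed
qed

lemma not_at_top_if_bounded_on_nodes:
  assumes lim: "filterlim \<phi> at_top (at_left (1::real))" and L: "2 \<le> L"
    and bd: "\<And>N. 1 \<le> N \<Longrightarrow> \<phi> (node L N) \<le> (B::real)"
  shows False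
proof -
  have "filterlim (\<lambda>N. \<phi> (node L N)) at_top sequentially"
    using filterlim_compose[OF lim filterlim_node[OF L]] .
  then have "eventually (\<lambda>N. B + 1 \<le> \<phi> (node L N)) sequentially"
    by (simp add: filterlim_at_top)
  then have "eventually (\<lambda>N. False) sequentially"
    using eventually_ge_at_top[of 1]
  proof eventually_elim
    case (elim N)
    then show ?case using bd[of N] by linarith
  qed
  then show False by simp
qed

text \<open>
  Monomials have integral means that do not depend on the exponent, and multiplication of \<open>g'\<close> by
  \<open>z ^ n\<close> only changes its means by a constant factor at the relevant node. Hence the means of
  \<open>g'\<close> at the node are bounded by \<open>L ^ N\<close> times a power of the weight, and the limit
  condition makes this bound tend to \<open>0\<close>, while the means of \<open>g'\<close> increase with the radius.
\<close>

lemma T_bounded_imp_constant_lim_mean: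
  assumes T: "T_bounded w p q s t g" and pos: "0 < p" "0 < q" "0 < s" "0 < t"
    and g: "g holomorphic_on ball 0 1" and w: "w \<in> D_weights"
    and lim: "filterlim (\<lambda>r. omega_hat w r powr (1 / t - 1 / q) * (1 - r)) at_top (at_left 1)"
  shows "g constant_on ball 0 1"
proof (rule ccontr)
  assume nc: "\<not> g constant_on ball 0 1"
  have rw: "radial_weight w" using w by (simp add: D_weights_def D_hat_def)
  obtain L D where L: "2 \<le> L" and D: "1 \<le> (D::real)"
    and doub: "\<And>k. omega_hat w (node L k) \<le> D * omega_hat w (node L (Suc k))"
    using D_weights_geometric[OF w] by metis
  obtain C m where C: "0 < C" and peak: "\<And>f A N. f holomorphic_on ball 0 1 \<Longrightarrow> 0 < A \<Longrightarrow>
      (\<And>r. 0 \<le> r \<Longrightarrow> r < 1 \<Longrightarrow> integral_mean p r f \<le> A * r ^ (m * L ^ N)) \<Longrightarrow>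
      integral_mean s (node L (Suc N)) (T_op g f)
        \<le> C * A * omega_hat w (node L N) powr (1 / q - 1 / t)"
    using T_bounded_peak[OF T pos g rw L D doub] by metis
  obtain C' where C': "0 < C'" and der: "\<And>F N. F holomorphic_on ball 0 1 \<Longrightarrow>
    integral_mean s (node L N) (deriv F) \<le> C' * real L ^ N * integral_mean s (node L (Suc N)) F"
    using deriv_node_mean[OF pos(3) L] by metis
  have hol': "deriv g holomorphic_on ball 0 1" by (intro holomorphic_deriv g) auto
  obtain \<xi> where \<xi>: "\<xi> \<in> ball 0 1" "deriv g \<xi> \<noteq> 0" using nonconstant_deriv_nonzero[OF g nc] by blast
  have "0 < node L 1" using node_strict_mono[OF L, of 0 1] by simp
  then have "\<exists>z\<in>ball 0 (node L 1). deriv g z \<noteq> 0"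
    by (intro nonzero_in_smaller_ball[OF hol' \<xi>] node_bounds L)
  then obtain z0 where z0: "cmod z0 < node L 1" "deriv g z0 \<noteq> 0" by auto
  \<comment> \<open>The pointwise bound shows that this mean is positive, as g' does not vanish at z0.\<close>
  define c where "c = integral_mean s (node L 1) (deriv g)"
  have c: "0 < c"
  proof -
    have "0 < cmod (deriv g z0) powr s" using z0 by simp
    also have "\<dots> \<le> 2 / (node L 1 - cmod z0) * circ_avg (\<lambda>z. cmod (deriv g z) powr s) (node L 1)"
      by (intro modulus_powr_pointwise hol' pos z0 node_bounds L)
    finally have "circ_avg (\<lambda>z. cmod (deriv g z) powr s) (node L 1) \<noteq> 0" by auto
    then show ?thesis by (simp add: c_def integral_mean_eq_circ_avg)
  qed
  define B where "B = C' * C * exp (2 * real m) / c"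
  show False
  proof (rule not_at_top_if_bounded_on_nodes[OF lim L])
    fix N :: nat assume N: "1 \<le> N"
    define W where "W = omega_hat w (node L N)"
    define X where "X = real L ^ N"
    have X: "0 < X" using L by (simp add: X_def)
    have W: "0 < W" using omega_hat_pos[OF rw node_bounds[OF L]] by (simp add: W_def)
    define n where "n = m * L ^ N"
    define F where "F = T_op g (\<lambda>z. z ^ n)"
    have monom: "(\<lambda>z::complex. z ^ n) holomorphic_on ball 0 1" by (intro holomorphic_intros)
    have "integral_mean p r (\<lambda>z. z ^ n * 1) = r ^ n" if "0 \<le> r" for r
      unfolding integral_mean_monomial_mult[OF that pos(1)]
      by (simp add: integral_mean_eq_circ_avg circ_avg_const)
    then have "integral_mean s (node L (Suc N)) F \<le> C * 1 * W powr (1 / q - 1 / t)"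
      unfolding F_def W_def by (intro peak monom) (auto simp: n_def)
    moreover have "integral_mean s (node L N) (deriv F) \<le> C' * X * integral_mean s (node L (Suc N)) F"
      unfolding F_def X_def by (intro der T_op_primitive monom g)
    ultimately have up: "integral_mean s (node L N) (deriv F) \<le> C' * X * (C * W powr (1 / q - 1 / t))"
      using C' X by (smt (verit) mult_left_mono mult_pos_pos mult_1_right)
    have "integral_mean s (node L N) (deriv F) = integral_mean s (node L N) (\<lambda>z. z ^ n * deriv g z)"
    proof -
      have "circ_avg (\<lambda>z. cmod (deriv F z) powr s) (node L N)
          = circ_avg (\<lambda>z. cmod (z ^ n * deriv g z) powr s) (node L N)"
        unfolding F_def
        by (intro circ_avg_cong node_bounds L)
           (use node_bounds(2)[OF L] in \<open>auto simp: T_op_primitive(2)[OF monom g]\<close>)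
      then show ?thesis by (simp add: integral_mean_eq_circ_avg)
    qed
    also have "\<dots> = node L N ^ n * integral_mean s (node L N) (deriv g)"
      by (intro integral_mean_monomial_mult node_bounds L pos)
    also have "\<dots> \<ge> exp (- 2 * real m) * c"
      unfolding c_def n_def
      by (intro mult_mono node_power_ge integral_mean_mono hol' pos node_bounds node_mono L N
          integral_mean_nonneg zero_le_power less_imp_le[OF c[unfolded c_def]])
    finally have low: "exp (- 2 * real m) * c \<le> integral_mean s (node L N) (deriv F)" .
    have "exp (- 2 * real m) * c \<le> C' * C * X / W powr (1 / t - 1 / q)"
      using low up W by (simp add: powr_diff mult_ac)
    then have "W powr (1 / t - 1 / q) * (1 / X) \<le> C' * C * exp (2 * real m) / c"
      using X c W by (simp add: exp_minus field_simps)
    then show "omega_hat w (node L N) powr (1 / t - 1 / q) * (1 - node L N) \<le> B"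
      by (simp add: one_minus_node W_def X_def B_def)
  qed
qed

text \<open>
  The test function is now peaked at a point \<open>a\<close> of the circle through the node \<open>N\<close> where
  \<open>cmod (deriv g a)\<close> is bounded below. The kernel gains \<open>(L ^ N) powr (1 / p)\<close> at the point over its
  mean, and point evaluation of the derivative costs \<open>(L ^ N) powr (1 + 1 / s)\<close>.
\<close>

lemma T_bounded_imp_constant_lim_pointwise:
  assumes T: "T_bounded w p q s t g" and pos: "0 < p" "0 < q" "0 < s" "0 < t"
    and g: "g holomorphic_on ball 0 1" and w: "w \<in> D_weights"
    and lim: "filterlim (\<lambda>r. omega_hat w r powr (1 / t - 1 / q) * (1 - r) powr (1 + (1 / s - 1 / p)))
      at_top (at_left 1)"
  shows "g constant_on ball 0 1"
proof (rule ccontr)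
  assume nc: "\<not> g constant_on ball 0 1"
  have rw: "radial_weight w" using w by (simp add: D_weights_def D_hat_def)
  obtain L D where L: "2 \<le> L" and D: "1 \<le> (D::real)"
    and doub: "\<And>k. omega_hat w (node L k) \<le> D * omega_hat w (node L (Suc k))"
    using D_weights_geometric[OF w] by metis
  obtain C m where C: "0 < C" and peak: "\<And>f A N. f holomorphic_on ball 0 1 \<Longrightarrow> 0 < A \<Longrightarrow>
      (\<And>r. 0 \<le> r \<Longrightarrow> r < 1 \<Longrightarrow> integral_mean p r f \<le> A * r ^ (m * L ^ N)) \<Longrightarrow>
      integral_mean s (node L (Suc N)) (T_op g f)
        \<le> C * A * omega_hat w (node L N) powr (1 / q - 1 / t)"
    using T_bounded_peak[OF T pos g rw L D doub] by metis
  obtain C' where C': "0 < C'" and der: "\<And>F N z. F holomorphic_on ball 0 1 \<Longrightarrow> cmod z = node L N \<Longrightarrow>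
    cmod (deriv F z) \<le> C' * (real L ^ N) powr (1 + 1 / s) * integral_mean s (node L (Suc N)) F"
    using deriv_node_pointwise[OF pos(3) L] by metis
  have hol': "deriv g holomorphic_on ball 0 1" by (intro holomorphic_deriv g) auto
  obtain \<xi> where \<xi>: "\<xi> \<in> ball 0 1" "deriv g \<xi> \<noteq> 0" using nonconstant_deriv_nonzero[OF g nc] by blast
  have "0 < node L 1" using node_strict_mono[OF L, of 0 1] by simp
  then obtain c where c: "0 < c" and
    circ: "\<And>r. node L 1 \<le> r \<Longrightarrow> r < 1 \<Longrightarrow> \<exists>a. cmod a = r \<and> c \<le> cmod (deriv g a)"
    using modulus_ge_on_circles[OF hol' \<xi>] node_bounds(2)[OF L, of 1] by metis
  define B where "B = C' * C * exp (2 * real m) * 2 powr (2 / p) / c"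
  show False
  proof (rule not_at_top_if_bounded_on_nodes[OF lim L])
    fix N :: nat assume N: "1 \<le> N"
    define W where "W = omega_hat w (node L N)"
    define X where "X = real L ^ N"
    have X: "0 < X" using L by (simp add: X_def)
    have W: "0 < W" using omega_hat_pos[OF rw node_bounds[OF L]] by (simp add: W_def)
    obtain a where a: "cmod a = node L N" "c \<le> cmod (deriv g a)"
      using circ[of "node L N"] node_mono[OF L N] node_bounds[OF L] by blast
    have a1: "cmod a < 1" using a node_bounds[OF L] by simp
    have aX: "1 - cmod a = 1 / X" using a by (simp add: one_minus_node X_def)
    define n where "n = m * L ^ N"
    define f where "f z = z ^ n * kern p a z" for z
    have f: "f holomorphic_on ball 0 1"
      unfolding f_def[abs_def] by (intro holomorphic_intros kern_holomorphic a1)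
    define F where "F = T_op g f"
    have "integral_mean p r f \<le> X powr (1 / p) * r ^ n" if "0 \<le> r" "r < 1" for r
    proof -
      have "integral_mean p r f = r ^ n * integral_mean p r (kern p a)"
        unfolding f_def[abs_def] by (rule integral_mean_monomial_mult[OF that(1) pos(1)])
      also have "\<dots> \<le> r ^ n * X powr (1 / p)"
        using integral_mean_kern[OF pos(1) a1 that] that X
        by (intro mult_left_mono) (auto simp: aX powr_divide powr_minus_divide)
      finally show ?thesis by (simp add: mult.commute)
    qed
    then have "integral_mean s (node L (Suc N)) F \<le> C * X powr (1 / p) * W powr (1 / q - 1 / t)"
      unfolding F_def W_def using X by (intro peak f) (auto simp: n_def)
    moreover have "cmod (deriv F a) \<le> C' * X powr (1 + 1 / s) * integral_mean s (node L (Suc N)) F"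
      unfolding F_def X_def by (intro der T_op_primitive f g a)
    ultimately have up: "cmod (deriv F a) \<le> C' * X powr (1 + 1 / s) * (C * X powr (1 / p) * W powr (1 / q - 1 / t))"
      using C' X by (smt (verit) mult_left_mono mult_pos_pos powr_gt_zero)
    have "cmod (deriv F a) = cmod (f a) * cmod (deriv g a)"
      unfolding F_def using T_op_primitive(2)[OF f g] a1 by (simp add: norm_mult)
    also have "\<dots> \<ge> (exp (- 2 * real m) * (2 / X) powr (- (2 / p))) * c"
    proof (intro mult_mono)
      have "exp (- 2 * real m) * (2 / X) powr (- (2 / p)) \<le> node L N ^ n * cmod (kern p a a)"
        using cmod_kern_diag[OF pos(1) a1] unfolding n_def aX
        by (intro mult_mono node_power_ge L N zero_le_power node_bounds) auto
      then show "exp (- 2 * real m) * (2 / X) powr (- (2 / p)) \<le> cmod (f a)"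
        by (simp add: f_def norm_mult norm_power a)
    qed (use a c in auto)
    finally have low: "(exp (- 2 * real m) * (2 / X) powr (- (2 / p))) * c \<le> cmod (deriv F a)" .
    have e1: "(2 / X) powr (- (2 / p)) = X powr (2 / p) / 2 powr (2 / p)"
      using X by (simp add: powr_divide powr_minus_divide)
    have e2: "W powr (1 / q - 1 / t) = 1 / W powr (1 / t - 1 / q)" using W by (simp add: powr_diff)
    have e3: "X powr (1 + 1 / s) * X powr (1 / p) = X powr (1 + (1 / s - 1 / p)) * X powr (2 / p)"
      unfolding powr_add[symmetric] by (rule arg_cong[of _ _ "(powr) X"]) (simp add: field_simps)
    have "X powr (2 / p) * (exp (- 2 * real m) * c / 2 powr (2 / p))
        \<le> X powr (2 / p) * (C' * C * X powr (1 + (1 / s - 1 / p)) / W powr (1 / t - 1 / q))"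
    proof -
      have "X powr (2 / p) * (exp (- 2 * real m) * c / 2 powr (2 / p))
          \<le> C' * C * (X powr (1 + 1 / s) * X powr (1 / p)) / W powr (1 / t - 1 / q)"
        using order_trans[OF low up] unfolding e1 e2 by (simp add: mult_ac)
      then show ?thesis unfolding e3 by (simp add: mult_ac)
    qed
    then have "exp (- 2 * real m) * c / 2 powr (2 / p)
        \<le> C' * C * X powr (1 + (1 / s - 1 / p)) / W powr (1 / t - 1 / q)"
      using X by (simp only: mult_le_cancel_left_pos powr_gt_zero)
    then have "W powr (1 / t - 1 / q) * (1 / X powr (1 + (1 / s - 1 / p))) \<le> B"
      using X c W unfolding B_def by (simp add: exp_minus field_simps)
    then show "omega_hat w (node L N) powr (1 / t - 1 / q) * (1 - node L N) powr (1 + (1 / s - 1 / p)) \<le> B"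
      using X by (simp add: one_minus_node W_def X_def powr_divide)
  qed
qed

section \<open>Averaging over signs\<close>

lemma cmod_signed_pair_ge:
  fixes y z :: complex
  assumes "z - y = 2 * x \<or> y - z = 2 * x" "0 < t"
  shows "cmod x powr t \<le> cmod y powr t + cmod z powr t"
proof -
  have "cmod x \<le> cmod y \<or> cmod x \<le> cmod z"
  proof (rule ccontr)
    assume "\<not> ?thesis"
    then have lt: "cmod y < cmod x" "cmod z < cmod x" by auto
    have "2 * cmod x = cmod (2 * x)" by (simp add: norm_mult)
    also have "\<dots> \<le> cmod y + cmod z"
      using assms(1) norm_triangle_ineq4[of z y] norm_triangle_ineq4[of y z] by auto
    finally show False using lt by simp
  qed
  then have "cmod x powr t \<le> cmod y powr t \<or> cmod x powr t \<le> cmod z powr t"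
    using assms(2) by (auto intro: powr_mono2)
  then show ?thesis by (auto intro: add_increasing add_increasing2)
qed

text \<open>
  Averaging over all choices of signs. For fixed \<open>k\<close>, switching the sign of the \<open>k\<close>-th summand pairs up
  the choices, and the two sums in a pair differ by \<open>2 * x k k\<close>, so that the modulus of one of them is at least
  that of \<open>x k k\<close>. Thus the diagonal terms survive on average, whatever the other terms are, and some
  choice is at least as good as the average.
\<close>

lemma exists_signs:
  fixes x :: "'i \<Rightarrow> 'i \<Rightarrow> complex" and v :: "'i \<Rightarrow> real"
  assumes I: "finite I" and t: "0 < t" and v: "\<And>k. k \<in> I \<Longrightarrow> 0 \<le> v k"
  obtains \<epsilon> :: "'i \<Rightarrow> complex" where "\<And>i. cmod (\<epsilon> i) = 1"
    "(\<Sum>k\<in>I. v k * cmod (x k k) powr t) \<le> 2 * (\<Sum>k\<in>I. v k * cmod (\<Sum>j\<in>I. \<epsilon> j * x k j) powr t)"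
proof -
  define sg :: "'i set \<Rightarrow> 'i \<Rightarrow> complex" where "sg A j = (if j \<in> A then 1 else - 1)" for A j
  define G where "G k A = cmod (\<Sum>j\<in>I. sg A j * x k j) powr t" for k A
  define flip where "flip k A = (if k \<in> A then A - {k} else insert k A)" for k and A :: "'i set"
  have flip_flip: "flip k (flip k A) = A" for k A by (auto simp: flip_def)
  have pair: "cmod (x k k) powr t \<le> G k A + G k (flip k A)" if k: "k \<in> I" for k A
  proof -
    have split: "(\<Sum>j\<in>I. sg B j * x k j) = sg B k * x k k + (\<Sum>j\<in>I - {k}. sg B j * x k j)" for B
      using I k by (rule sum.remove)
    have "(\<Sum>j\<in>I - {k}. sg (flip k A) j * x k j) = (\<Sum>j\<in>I - {k}. sg A j * x k j)"
      by (intro sum.cong) (auto simp: sg_def flip_def)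
    then have "(\<Sum>j\<in>I. sg (flip k A) j * x k j) - (\<Sum>j\<in>I. sg A j * x k j)
        = (sg (flip k A) k - sg A k) * x k k"
      unfolding split by (simp add: left_diff_distrib)
    moreover have "sg (flip k A) k - sg A k = 2 \<or> sg A k - sg (flip k A) k = 2"
      by (auto simp: sg_def flip_def)
    ultimately show ?thesis
      unfolding G_def by (intro cmod_signed_pair_ge t) (metis minus_diff_eq mult_minus_left)
  qed
  have avg: "card (Pow I) * cmod (x k k) powr t \<le> 2 * (\<Sum>A\<in>Pow I. G k A)" if k: "k \<in> I" for k
  proof -
    have "(\<Sum>A\<in>Pow I. G k (flip k A)) = (\<Sum>A\<in>Pow I. G k A)"
      by (rule sum.reindex_bij_witness[of _ "flip k" "flip k"])
         (use k flip_flip in \<open>auto simp: flip_def\<close>)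
    moreover have "(\<Sum>A\<in>Pow I. cmod (x k k) powr t) \<le> (\<Sum>A\<in>Pow I. G k A + G k (flip k A))"
      by (intro sum_mono pair k)
    ultimately show ?thesis by (simp add: sum.distrib)
  qed
  define S where "S = (\<Sum>k\<in>I. v k * cmod (x k k) powr t)"
  have "\<exists>A\<in>Pow I. S \<le> 2 * (\<Sum>k\<in>I. v k * G k A)"
  proof (rule ccontr)
    assume "\<not> ?thesis"
    then have "2 * (\<Sum>k\<in>I. v k * G k A) < S" if "A \<in> Pow I" for A
      using that not_le by blast
    then have "(\<Sum>A\<in>Pow I. 2 * (\<Sum>k\<in>I. v k * G k A)) < (\<Sum>A\<in>Pow I. S)"
      using I by (intro sum_strict_mono) auto
    also have "\<dots> = (\<Sum>k\<in>I. v k * (card (Pow I) * cmod (x k k) powr t))"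
      by (simp add: S_def sum_distrib_left mult_ac)
    also have "\<dots> \<le> (\<Sum>k\<in>I. v k * (2 * (\<Sum>A\<in>Pow I. G k A)))"
      by (intro sum_mono mult_left_mono avg v)
    also have "\<dots> = (\<Sum>k\<in>I. \<Sum>A\<in>Pow I. 2 * (v k * G k A))"
      by (simp add: sum_distrib_left mult_ac)
    also have "\<dots> = (\<Sum>A\<in>Pow I. \<Sum>k\<in>I. 2 * (v k * G k A))"
      by (rule sum.swap)
    finally show False by (simp add: sum_distrib_left)
  qed
  then obtain A where "S \<le> 2 * (\<Sum>k\<in>I. v k * G k A)" by blast
  then show thesis by (intro that[of "sg A"]) (auto simp: S_def G_def sg_def)
qed

section \<open>Sums of test functions over many radii\<close>

text \<open>
  A substitute for Minkowski's inequality that is valid for all \<open>p > 0\<close>: the sum is at most the sum of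
  the \<open>a i\<close> times the largest \<open>b i\<close>, and the maximum is below the sum of the powers.
\<close>

lemma sum_mult_powr_le:
  fixes a b :: "'i \<Rightarrow> real"
  assumes I: "finite I" and p: "0 < p" and a: "\<And>i. i \<in> I \<Longrightarrow> 0 \<le> a i" and b: "\<And>i. i \<in> I \<Longrightarrow> 0 \<le> b i"
  shows "(\<Sum>i\<in>I. a i * b i) powr p \<le> (\<Sum>i\<in>I. a i) powr p * (\<Sum>i\<in>I. b i powr p)"
proof (cases "I = {}")
  case False
  define m where "m = Max (b ` I)"
  have le: "b i \<le> m" if "i \<in> I" for i using I that by (simp add: m_def)
  have "m \<in> b ` I" unfolding m_def using I False by (intro Max_in) auto
  then obtain i where i: "i \<in> I" "m = b i" by blast
  have "(\<Sum>i\<in>I. a i * b i) \<le> (\<Sum>i\<in>I. a i * m)"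
    by (intro sum_mono mult_left_mono le a)
  then have "(\<Sum>i\<in>I. a i * b i) powr p \<le> ((\<Sum>i\<in>I. a i) * m) powr p"
    using p a b by (intro powr_mono2) (auto simp: sum_distrib_right intro!: sum_nonneg)
  also have "\<dots> = (\<Sum>i\<in>I. a i) powr p * b i powr p"
    using i a b by (simp add: powr_mult sum_nonneg)
  also have "\<dots> \<le> (\<Sum>i\<in>I. a i) powr p * (\<Sum>i\<in>I. b i powr p)"
    using I i by (intro mult_left_mono member_le_sum) auto
  finally show ?thesis .
qed simp

text \<open>
  Each coefficient \<open>c i\<close> is split evenly between the two factors of the preceding inequality. The loss is
  harmless for coefficients that decay geometrically away from one index.
\<close>

lemma integral_mean_sum_le:
  assumes I: "finite I" and p: "0 < p" and r: "0 \<le> r"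
    and c: "\<And>i. i \<in> I \<Longrightarrow> 0 \<le> c i"
    and h: "\<And>i. i \<in> I \<Longrightarrow> continuous_on (sphere 0 r) (h i)"
    and avg: "\<And>i. i \<in> I \<Longrightarrow> circ_avg (\<lambda>z. cmod (h i z) powr p) r \<le> 1"
    and f: "continuous_on (sphere 0 r) f"
    and le: "\<And>z. z \<in> sphere 0 r \<Longrightarrow> cmod (f z) \<le> (\<Sum>i\<in>I. c i * cmod (h i z))"
  shows "integral_mean p r f \<le> (\<Sum>i\<in>I. c i powr (1 / 2)) * (\<Sum>i\<in>I. c i powr (p / 2)) powr (1 / p)"
proof -
  define A where "A = (\<Sum>i\<in>I. c i powr (1 / 2))"
  have A: "0 \<le> A" by (simp add: A_def sum_nonneg)
  have cont: "continuous_on (sphere 0 r) (\<lambda>z. cmod (h i z) powr p)" if "i \<in> I" for i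
    using p by (intro continuous_intros continuous_on_powr' h that) auto
  have "circ_avg (\<lambda>z. cmod (f z) powr p) r
      \<le> circ_avg (\<lambda>z. A powr p * (\<Sum>i\<in>I. c i powr (p / 2) * cmod (h i z) powr p)) r"
  proof (rule circ_avg_mono[OF _ _ r])
    show "continuous_on (sphere 0 r) (\<lambda>z. cmod (f z) powr p)"
      using p by (intro continuous_intros continuous_on_powr' f) auto
    show "continuous_on (sphere 0 r) (\<lambda>z. A powr p * (\<Sum>i\<in>I. c i powr (p / 2) * cmod (h i z) powr p))"
      by (intro continuous_on_mult continuous_on_sum continuous_on_const cont)
    fix z :: complex assume z: "z \<in> sphere 0 r"
    have "(\<Sum>i\<in>I. c i * cmod (h i z)) = (\<Sum>i\<in>I. c i powr (1 / 2) * (c i powr (1 / 2) * cmod (h i z)))"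
      using c by (intro sum.cong refl) (simp add: mult.assoc[symmetric] flip: powr_add)
    then have "cmod (f z) powr p \<le> (\<Sum>i\<in>I. c i powr (1 / 2) * (c i powr (1 / 2) * cmod (h i z))) powr p"
      using le[OF z] p by (intro powr_mono2) auto
    also have "\<dots> \<le> A powr p * (\<Sum>i\<in>I. (c i powr (1 / 2) * cmod (h i z)) powr p)"
      unfolding A_def by (intro sum_mult_powr_le I p) auto
    also have "\<dots> = A powr p * (\<Sum>i\<in>I. c i powr (p / 2) * cmod (h i z) powr p)"
      by (simp add: powr_mult powr_powr)
    finally show "cmod (f z) powr p \<le> A powr p * (\<Sum>i\<in>I. c i powr (p / 2) * cmod (h i z) powr p)" .
  qed
  also have "\<dots> = A powr p * (\<Sum>i\<in>I. c i powr (p / 2) * circ_avg (\<lambda>z. cmod (h i z) powr p) r)"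
    by (simp add: circ_avg_cmult circ_avg_sum[OF I _ r] continuous_on_mult_left cont)
  also have "\<dots> \<le> A powr p * (\<Sum>i\<in>I. c i powr (p / 2) * 1)"
    by (intro mult_left_mono sum_mono avg) auto
  finally have "integral_mean p r f \<le> (A powr p * (\<Sum>i\<in>I. c i powr (p / 2))) powr (1 / p)"
    unfolding integral_mean_eq_circ_avg using p by (intro powr_mono2 circ_avg_nonneg) auto
  also have "\<dots> = A * (\<Sum>i\<in>I. c i powr (p / 2)) powr (1 / p)"
    using A p by (simp add: powr_mult powr_powr sum_nonneg)
  finally show ?thesis by (simp add: A_def)
qed

lemma summable_power_exp_neg_power:
  fixes b \<eta> :: real
  assumes b: "0 < b" and \<eta>: "0 < \<eta>" and L: "2 \<le> L"
  shows "summable (\<lambda>i. b ^ i * exp (- \<eta> * real L ^ i))"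
proof -
  obtain N :: nat where N: "ln (2 * b) / \<eta> \<le> real N" using real_arch_simple by blast
  show ?thesis
  proof (rule summable_ratio_test[of "1 / 2" N])
    fix n assume n: "N \<le> n"
    have "real n \<le> real (L ^ n)" using L power_gt_expt[of L n] by simp
    then have Ln: "real n \<le> real L ^ n" by simp
    have "2 * real L ^ n \<le> real L * real L ^ n" using L by (intro mult_right_mono) auto
    then have "real L ^ n + real n \<le> real L ^ Suc n" using Ln unfolding power_Suc by linarith
    then have "\<eta> * (real L ^ n + real n) \<le> \<eta> * real L ^ Suc n" using \<eta> by (intro mult_left_mono) auto
    moreover have "ln (2 * b) \<le> \<eta> * real n"
    proof -
      have "ln (2 * b) / \<eta> \<le> real n" using N n by linarith
      then show ?thesis using \<eta> by (simp add: field_simps)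
    qed
    ultimately have "ln (2 * b) + (- \<eta> * real L ^ Suc n) \<le> - \<eta> * real L ^ n"
      by (simp add: algebra_simps)
    then have "exp (ln (2 * b) + (- \<eta> * real L ^ Suc n)) \<le> exp (- \<eta> * real L ^ n)"
      by (simp only: exp_le_cancel_iff)
    moreover have "exp (ln (2 * b)) = 2 * b" using b by simp
    ultimately have "2 * b * exp (- \<eta> * real L ^ Suc n) \<le> exp (- \<eta> * real L ^ n)"
      by (simp only: exp_add)
    then have "b ^ n * (2 * b * exp (- \<eta> * real L ^ Suc n)) \<le> b ^ n * exp (- \<eta> * real L ^ n)"
      using b by (intro mult_left_mono) auto
    then show "norm (b ^ Suc n * exp (- \<eta> * real L ^ Suc n)) \<le> 1 / 2 * norm (b ^ n * exp (- \<eta> * real L ^ n))"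
      using b by (simp add: abs_mult mult_ac)
  qed simp
qed

text \<open>
  A geometric sum up to \<open>j\<close> is comparable with its last term, and beyond \<open>j\<close> the doubly exponential
  decay outweighs the growth. For \<open>j = K\<close> the second hypothesis on \<open>u\<close> is vacuous.
\<close>

lemma cutoff_geometric_sum_le:
  fixes b \<eta> :: real
  assumes b: "1 < b" and \<eta>: "0 < \<eta>" and L: "2 \<le> L"
  obtains G where "0 < G" "\<And>j K u. j \<le> K \<Longrightarrow> (\<And>k. k \<le> K \<Longrightarrow> u k \<le> 1) \<Longrightarrow>
    (\<And>k. j < k \<Longrightarrow> k \<le> K \<Longrightarrow> u k \<le> exp (- \<eta> * real L ^ (k - j))) \<Longrightarrow>
    (\<Sum>k\<le>K. b ^ k * u k) \<le> G * b ^ j"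
proof -
  define E where "E = (\<Sum>i. b ^ i * exp (- \<eta> * real L ^ i))"
  have sm: "summable (\<lambda>i. b ^ i * exp (- \<eta> * real L ^ i))"
    using summable_power_exp_neg_power[OF _ \<eta> L] b by simp
  have E: "0 \<le> E" unfolding E_def using b by (intro suminf_nonneg sm) simp
  show thesis
  proof (rule that[of "b / (b - 1) + E"])
    show "0 < b / (b - 1) + E" using b E by (intro add_pos_nonneg) auto
    fix j K :: nat and u :: "nat \<Rightarrow> real"
    assume jK: "j \<le> K" and u1: "\<And>k. k \<le> K \<Longrightarrow> u k \<le> 1"
      and u2: "\<And>k. j < k \<Longrightarrow> k \<le> K \<Longrightarrow> u k \<le> exp (- \<eta> * real L ^ (k - j))"
    have "{..K} = {..j} \<union> {j<..K}" using jK by auto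
    then have "(\<Sum>k\<le>K. b ^ k * u k) = (\<Sum>k\<le>j. b ^ k * u k) + (\<Sum>k\<in>{j<..K}. b ^ k * u k)"
      by (simp only:) (intro sum.union_disjoint, auto)
    also have "(\<Sum>k\<le>j. b ^ k * u k) \<le> (\<Sum>k\<le>j. b ^ k * 1)"
      using b jK by (intro sum_mono mult_left_mono u1) auto
    also have "\<dots> = (b ^ Suc j - 1) / (b - 1)"
      using b by (simp add: geometric_sum lessThan_Suc_atMost[symmetric] del: sum.lessThan_Suc power_Suc)
    also have "\<dots> \<le> b / (b - 1) * b ^ j"
      using b by (simp add: divide_right_mono)
    also have "(\<Sum>k\<in>{j<..K}. b ^ k * u k) \<le> (\<Sum>k\<in>{j<..K}. b ^ k * exp (- \<eta> * real L ^ (k - j)))"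
      using b by (intro sum_mono mult_left_mono u2) auto
    also have "\<dots> = (\<Sum>i\<in>{0<..K - j}. b ^ (i + j) * exp (- \<eta> * real L ^ i))"
      by (rule sum.reindex_bij_witness[of _ "\<lambda>i. i + j" "\<lambda>k. k - j"]) auto
    also have "\<dots> = b ^ j * (\<Sum>i\<in>{0<..K - j}. b ^ i * exp (- \<eta> * real L ^ i))"
      by (simp add: sum_distrib_left power_add mult_ac)
    also have "\<dots> \<le> b ^ j * E"
      unfolding E_def using b by (intro mult_left_mono sum_le_suminf sm) auto
    finally show "(\<Sum>k\<le>K. b ^ k * u k) \<le> (b / (b - 1) + E) * b ^ j"
      by (simp add: algebra_simps)
  qed
qed

lemma nat_interval_of_node:
  assumes L: "2 \<le> L" and r: "0 \<le> r" "r < 1"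
  obtains j where "node L j \<le> r" "r < node L (Suc j)"
proof -
  have "eventually (\<lambda>k. r < node L k) sequentially"
    using order_tendstoD(1)[OF node_tendsto[OF L] r(2)] .
  then obtain k where k: "r < node L k" by (auto simp: eventually_sequentially)
  define m where "m = (LEAST k. r < node L k)"
  have m: "r < node L m" unfolding m_def by (rule LeastI[of _ k]) (rule k)
  then obtain j where j: "m = Suc j" using r by (cases m) auto
  have "\<not> r < node L j" using not_less_Least[of j "\<lambda>k. r < node L k"] j by (simp add: m_def)
  with m j show thesis by (intro that[of j]) auto
qed

lemma mixed_norm_pow_le_sum:
  assumes w: "radial_weight w" and q: "0 < q" and L: "2 \<le> L"
    and H: "\<And>j. 0 \<le> H j"
    and le: "\<And>r j. 0 \<le> r \<Longrightarrow> r < 1 \<Longrightarrow> j \<le> K \<Longrightarrow> j = K \<or> r < node L (Suc j) \<Longrightarrow>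
      integral_mean p r f \<le> H j"
  shows "mixed_norm_pow w p q f \<le> ennreal (\<Sum>j\<le>K. H j powr q * omega_hat w (node L j))"
proof -
  note nb = node_bounds[OF L]
  have "mixed_norm_pow w p q f
      \<le> (\<integral>\<^sup>+ r. (\<Sum>j\<le>K. ennreal (H j powr q) * (ennreal (w r) * indicator {node L j..<1} r)) \<partial>lebesgue)"
    unfolding mixed_norm_pow_def
  proof (intro nn_integral_mono)
    fix r :: real
    show "ennreal (integral_mean p r f powr q * w r) * indicator {0..<1} r
      \<le> (\<Sum>j\<le>K. ennreal (H j powr q) * (ennreal (w r) * indicator {node L j..<1} r))"
    proof (cases "r \<in> {0..<1}")
      case True
      then have r: "0 \<le> r" "r < 1" by auto
      obtain i where i: "node L i \<le> r" "r < node L (Suc i)" using nat_interval_of_node[OF L r] by blast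
      define j where "j = min i K"
      have j: "node L j \<le> r" "j \<le> K" "j = K \<or> r < node L (Suc j)"
        using i node_mono[OF L, of j i] by (auto simp: j_def min_def)
      have "integral_mean p r f powr q * w r \<le> H j powr q * w r"
        using q by (intro mult_right_mono powr_mono2 le r j integral_mean_nonneg weight_nonneg[OF w]) auto
      then have "ennreal (integral_mean p r f powr q * w r) * indicator {0..<1} r
          \<le> ennreal (H j powr q) * (ennreal (w r) * indicator {node L j..<1} r)"
        using r j by (simp add: ennreal_mult'[symmetric] ennreal_leI)
      also have "\<dots> \<le> (\<Sum>j\<le>K. ennreal (H j powr q) * (ennreal (w r) * indicator {node L j..<1} r))"
        using j(2) by (intro member_le_sum) auto
      finally show ?thesis .
    qed simp
  qed
  also have "\<dots> = (\<Sum>j\<le>K. ennreal (H j powr q) * ennreal (omega_hat w (node L j)))"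
  proof (subst nn_integral_sum)
    show "(\<lambda>r. ennreal (H j powr q) * (ennreal (w r) * indicator {node L j..<1} r)) \<in> borel_measurable lebesgue" for j
      by (rule borel_measurable_times_ennreal[OF borel_measurable_const weight_measurable[OF w nb(1) order_refl]])
    show "(\<Sum>j\<le>K. \<integral>\<^sup>+ r. ennreal (H j powr q) * (ennreal (w r) * indicator {node L j..<1} r) \<partial>lebesgue)
        = (\<Sum>j\<le>K. ennreal (H j powr q) * ennreal (omega_hat w (node L j)))"
      by (intro sum.cong refl)
         (simp add: nn_integral_cmult[OF weight_measurable[OF w nb(1) order_refl]] weight_tail[OF w nb(1)])
  qed
  also have "\<dots> = ennreal (\<Sum>j\<le>K. H j powr q * omega_hat w (node L j))"
  proof (subst sum_ennreal[symmetric])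
    show "0 \<le> H j powr q * omega_hat w (node L j)" for j
      using omega_hat_pos[OF w nb] by (simp add: less_imp_le)
  qed (simp add: ennreal_mult')
  finally show ?thesis .
qed

text \<open>
  The integral is cut at the nodes: between consecutive ones \<open>1 - r\<close> is constant up to the factor \<open>L\<close>.
\<close>

lemma weight_power_integral_finite:
  assumes w: "radial_weight w" and L: "2 \<le> L" and \<gamma>: "0 \<le> \<gamma>"
    and bd: "\<And>K. (\<Sum>k\<le>K. (real L ^ k) powr \<gamma> * omega_hat w (node L k)) \<le> B"
  shows "(\<integral>\<^sup>+ r\<in>{0..<1}. ennreal ((1 - r) powr (- \<gamma>) * w r) \<partial>lebesgue) < \<infinity>"
proof -
  note nb = node_bounds[OF L]
  define c where "c = real L powr \<gamma>"
  define X where "X j = (real L ^ j) powr \<gamma>" for j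
  have X: "0 < X j" "X (Suc j) = c * X j" for j
    using L by (auto simp: X_def c_def powr_mult)
  have c: "0 < c" using L by (simp add: c_def)
  have "(\<integral>\<^sup>+ r\<in>{0..<1}. ennreal ((1 - r) powr (- \<gamma>) * w r) \<partial>lebesgue)
      \<le> (\<integral>\<^sup>+ r. (\<Sum>j. ennreal (X (Suc j)) * (ennreal (w r) * indicator {node L j..<1} r)) \<partial>lebesgue)"
  proof (intro nn_integral_mono)
    fix r :: real
    show "ennreal ((1 - r) powr (- \<gamma>) * w r) * indicator {0..<1} r
      \<le> (\<Sum>j. ennreal (X (Suc j)) * (ennreal (w r) * indicator {node L j..<1} r))"
    proof (cases "r \<in> {0..<1}")
      case True
      then have r: "0 \<le> r" "r < 1" by auto
      obtain j where j: "node L j \<le> r" "r < node L (Suc j)" using nat_interval_of_node[OF L r] by blast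
      have "(1 - r) powr (- \<gamma>) \<le> (1 / real L ^ Suc j) powr (- \<gamma>)"
        using j(2) L \<gamma> by (intro powr_mono2') (auto simp: node_def)
      also have "\<dots> = X (Suc j)" using L by (simp add: X_def powr_minus_divide powr_divide)
      finally have "(1 - r) powr (- \<gamma>) * w r \<le> X (Suc j) * w r"
        using weight_nonneg[OF w r] by (intro mult_right_mono)
      then have "ennreal ((1 - r) powr (- \<gamma>) * w r) * indicator {0..<1} r
          \<le> ennreal (X (Suc j)) * (ennreal (w r) * indicator {node L j..<1} r)"
        using r j X(1)[of "Suc j"] by (simp add: ennreal_mult'[symmetric] ennreal_leI)
      also have "\<dots> = (\<Sum>i\<in>{j}. ennreal (X (Suc i)) * (ennreal (w r) * indicator {node L i..<1} r))"
        by simp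
      also have "\<dots> \<le> (\<Sum>j. ennreal (X (Suc j)) * (ennreal (w r) * indicator {node L j..<1} r))"
        by (intro sum_le_suminf) auto
      finally show ?thesis .
    qed simp
  qed
  also have "\<dots> = (\<Sum>j. \<integral>\<^sup>+ r. ennreal (X (Suc j)) * (ennreal (w r) * indicator {node L j..<1} r) \<partial>lebesgue)"
    by (intro nn_integral_suminf borel_measurable_times_ennreal[OF borel_measurable_const
          weight_measurable[OF w nb(1) order_refl]])
  also have "\<dots> = (\<Sum>j. ennreal (X (Suc j) * omega_hat w (node L j)))"
    using X(1)
    by (simp add: nn_integral_cmult[OF weight_measurable[OF w nb(1) order_refl]] weight_tail[OF w nb(1)]
        ennreal_mult' less_imp_le)
  also have "\<dots> \<le> ennreal (c * B)"
  proof (rule suminf_le_const)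
    fix n
    have nonneg: "0 \<le> X j * omega_hat w (node L j)" for j
      using X(1)[of j] omega_hat_pos[OF w nb, of j] by simp
    have "(\<Sum>j<n. ennreal (X (Suc j) * omega_hat w (node L j)))
        = ennreal (\<Sum>j<n. c * (X j * omega_hat w (node L j)))"
      using nonneg c by (subst sum_ennreal) (auto simp: X(2) mult.assoc)
    also have "\<dots> \<le> ennreal (c * (\<Sum>j\<le>n. X j * omega_hat w (node L j)))"
      unfolding sum_distrib_left using nonneg c
      by (intro ennreal_leI sum_mono2) auto
    also have "\<dots> \<le> ennreal (c * B)"
      using bd c by (intro ennreal_leI mult_left_mono) (auto simp: X_def)
    finally show "(\<Sum>j<n. ennreal (X (Suc j) * omega_hat w (node L j))) \<le> ennreal (c * B)" .
  qed simp
  also have "\<dots> < \<infinity>" by simp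
  finally show ?thesis .
qed

lemma power_powr_swap: "0 < x \<Longrightarrow> (x ^ k) powr a = (x powr a) ^ k" for x a :: real
  by (simp add: powr_realpow[symmetric] powr_powr mult.commute)

text \<open>
  The summand with index \<open>k\<close> has size \<open>(L ^ k) powr \<sigma>\<close> and is negligible for \<open>1 - r\<close> much larger than
  \<open>1 / L ^ k\<close>. As the sizes grow geometrically, at radius \<open>r\<close> the whole sum is comparable with the
  single block that belongs to \<open>r\<close>, or with the last one if \<open>r\<close> is beyond all of them.
\<close>

lemma block_sum_mean_le:
  assumes p: "0 < p" and \<sigma>: "0 < \<sigma>" and L: "2 \<le> L"
  obtains A where "0 < A" "\<And>K h \<epsilon> r j. 
    (\<And>k. k \<le> K \<Longrightarrow> h k holomorphic_on ball 0 1) \<Longrightarrow>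
    (\<And>k r. k \<le> K \<Longrightarrow> 0 \<le> r \<Longrightarrow> r < 1 \<Longrightarrow> circ_avg (\<lambda>z. cmod (h k z) powr p) r \<le> 1) \<Longrightarrow>
    (\<And>k. cmod (\<epsilon> k) = 1) \<Longrightarrow> 0 \<le> r \<Longrightarrow> r < 1 \<Longrightarrow> j \<le> K \<Longrightarrow> j = K \<or> r < node L (Suc j) \<Longrightarrow>
    integral_mean p r (\<lambda>z. \<Sum>k\<le>K. \<epsilon> k * (of_real ((real L ^ k) powr \<sigma>) * (z ^ (L ^ Suc k) * h k z)))
      \<le> A * (real L ^ j) powr \<sigma>"
proof -
  have L0: "1 < real L" "0 < real L" using L by auto
  have cutoff: "\<exists>G>0. \<forall>K r j. 0 \<le> r \<longrightarrow> r < 1 \<longrightarrow> j \<le> K \<longrightarrow> (j = K \<or> r < node L (Suc j)) \<longrightarrow>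
      (\<Sum>k\<le>K. ((real L ^ k) powr \<sigma> * r ^ (L ^ Suc k)) powr \<eta>) \<le> G * (real L ^ j) powr (\<sigma> * \<eta>)"
    if \<eta>: "0 < \<eta>" for \<eta> :: real
  proof -
    define b where "b = real L powr (\<sigma> * \<eta>)"
    have b: "1 < b" using L0 \<sigma> \<eta> by (simp add: b_def gr_one_powr)
    have bk: "(real L ^ k) powr (\<sigma> * \<eta>) = b ^ k" for k
      unfolding b_def using L0 by (intro power_powr_swap)
    obtain G where G: "0 < G" "\<And>j K u. j \<le> K \<Longrightarrow> (\<And>k. k \<le> K \<Longrightarrow> u k \<le> 1) \<Longrightarrow>
        (\<And>k. j < k \<Longrightarrow> k \<le> K \<Longrightarrow> u k \<le> exp (- \<eta> * real L ^ (k - j))) \<Longrightarrow>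
        (\<Sum>k\<le>K. b ^ k * u k) \<le> G * b ^ j"
      using cutoff_geometric_sum_le[OF b \<eta> L] by blast
    show ?thesis
    proof (intro exI[of _ G] conjI allI impI)
      show "0 < G" by (rule G(1))
      fix K j :: nat and r :: real
      assume r: "0 \<le> r" "r < 1" and j: "j \<le> K" "j = K \<or> r < node L (Suc j)"
      have "(\<Sum>k\<le>K. ((real L ^ k) powr \<sigma> * r ^ (L ^ Suc k)) powr \<eta>)
          = (\<Sum>k\<le>K. b ^ k * (r ^ (L ^ Suc k)) powr \<eta>)"
        using r by (intro sum.cong refl) (simp add: powr_mult powr_powr bk del: power_Suc)
      also have "\<dots> \<le> G * b ^ j"
      proof (rule G(2)[OF j(1)])
        show "(r ^ (L ^ Suc k)) powr \<eta> \<le> 1" for k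
          using r \<eta> power_le_one[of r "L ^ Suc k"] by (intro powr_le1) auto
        show "(r ^ (L ^ Suc k)) powr \<eta> \<le> exp (- \<eta> * real L ^ (k - j))" if k: "j < k" "k \<le> K" for k
        proof -
          have rn: "r \<le> 1 - 1 / real L ^ Suc j" using j k by (auto simp: node_def)
          have n: "0 < L ^ Suc k" using L by simp
          have "(r ^ (L ^ Suc k)) powr \<eta> = r powr (\<eta> * real (L ^ Suc k))"
            using r n by (cases "r = 0") (auto simp: powr_realpow[symmetric] powr_powr mult.commute zero_power)
          also have "\<dots> \<le> exp (- (\<eta> * real (L ^ Suc k)) * (1 / real L ^ Suc j))"
            using \<eta> by (intro powr_le_exp r rn) auto
          also have "- (\<eta> * real (L ^ Suc k)) * (1 / real L ^ Suc j) = - \<eta> * real L ^ (k - j)"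
            using L0 k by (simp add: power_diff)
          finally show ?thesis .
        qed
      qed
      finally show "(\<Sum>k\<le>K. ((real L ^ k) powr \<sigma> * r ^ (L ^ Suc k)) powr \<eta>) \<le> G * (real L ^ j) powr (\<sigma> * \<eta>)"
        by (simp only: bk)
    qed
  qed
  obtain G1 where G1: "0 < G1" "\<And>K r j. 0 \<le> r \<Longrightarrow> r < 1 \<Longrightarrow> j \<le> K \<Longrightarrow> (j = K \<or> r < node L (Suc j)) \<Longrightarrow>
      (\<Sum>k\<le>K. ((real L ^ k) powr \<sigma> * r ^ (L ^ Suc k)) powr (1 / 2)) \<le> G1 * (real L ^ j) powr (\<sigma> * (1 / 2))"
    using cutoff[of "1 / 2"] by auto
  obtain G2 where G2: "0 < G2" "\<And>K r j. 0 \<le> r \<Longrightarrow> r < 1 \<Longrightarrow> j \<le> K \<Longrightarrow> (j = K \<or> r < node L (Suc j)) \<Longrightarrow>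
      (\<Sum>k\<le>K. ((real L ^ k) powr \<sigma> * r ^ (L ^ Suc k)) powr (p / 2)) \<le> G2 * (real L ^ j) powr (\<sigma> * (p / 2))"
    using cutoff[of "p / 2"] p by auto
  show thesis
  proof (rule that[of "G1 * G2 powr (1 / p)"])
    show "0 < G1 * G2 powr (1 / p)" using G1 G2 by simp
    fix K j :: nat and h :: "nat \<Rightarrow> complex \<Rightarrow> complex" and \<epsilon> :: "nat \<Rightarrow> complex" and r :: real
    assume h: "\<And>k. k \<le> K \<Longrightarrow> h k holomorphic_on ball 0 1"
      and avg: "\<And>k r. k \<le> K \<Longrightarrow> 0 \<le> r \<Longrightarrow> r < 1 \<Longrightarrow> circ_avg (\<lambda>z. cmod (h k z) powr p) r \<le> 1"
      and \<epsilon>: "\<And>k. cmod (\<epsilon> k) = 1" and r: "0 \<le> r" "r < 1"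
      and j: "j \<le> K" "j = K \<or> r < node L (Suc j)"
    define X where "X = (real L ^ j) powr \<sigma>"
    have X: "0 < X" using L by (simp add: X_def)
    define c where "c k = (real L ^ k) powr \<sigma> * r ^ (L ^ Suc k)" for k
    define f where "f z = (\<Sum>k\<le>K. \<epsilon> k * (of_real ((real L ^ k) powr \<sigma>) * (z ^ (L ^ Suc k) * h k z)))" for z
    have sub: "sphere (0::complex) r \<subseteq> ball 0 1" using r by auto
    have conth: "continuous_on (sphere 0 r) (h k)" if "k \<le> K" for k
      using holomorphic_on_imp_continuous_on[OF holomorphic_on_subset[OF h[OF that] sub]] .
    have "integral_mean p r f \<le> (\<Sum>k\<in>{..K}. c k powr (1 / 2)) * (\<Sum>k\<in>{..K}. c k powr (p / 2)) powr (1 / p)"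
    proof (rule integral_mean_sum_le[OF _ p r(1), where h = h])
      show "continuous_on (sphere 0 r) f"
        unfolding f_def[abs_def] by (intro continuous_intros conth) auto
      show "cmod (f z) \<le> (\<Sum>k\<in>{..K}. c k * cmod (h k z))" if "z \<in> sphere 0 r" for z
        unfolding f_def c_def
        by (rule order_trans[OF norm_sum])
           (use that in \<open>auto simp: norm_mult norm_power \<epsilon> mult.assoc intro!: sum_mono\<close>)
    qed (use r avg conth in \<open>auto simp: c_def\<close>)
    also have "\<dots> \<le> (G1 * (real L ^ j) powr (\<sigma> * (1 / 2))) * (G2 * (real L ^ j) powr (\<sigma> * (p / 2))) powr (1 / p)"
      unfolding c_def using p G1(1)
      by (intro mult_mono G1(2) powr_mono2 G2(2) r j sum_nonneg mult_nonneg_nonneg) auto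
    also have "\<dots> = (G1 * G2 powr (1 / p)) * ((real L ^ j) powr (\<sigma> / 2) * (real L ^ j) powr (\<sigma> / 2))"
      using p G2(1) by (simp add: powr_mult powr_powr)
    also have "\<dots> = (G1 * G2 powr (1 / p)) * X" by (simp add: X_def flip: powr_add)
    finally show "integral_mean p r (\<lambda>z. \<Sum>k\<le>K. \<epsilon> k * (of_real ((real L ^ k) powr \<sigma>) * (z ^ (L ^ Suc k) * h k z)))
      \<le> (G1 * G2 powr (1 / p)) * (real L ^ j) powr \<sigma>"
      by (simp only: f_def[abs_def] X_def)
  qed
qed

text \<open>
  Scaled so that its integral means are at most \<open>1\<close> when \<open>a\<close> lies on the circle through the node \<open>k\<close>.
\<close>

definition normalized_kern :: "nat \<Rightarrow> real \<Rightarrow> nat \<Rightarrow> complex \<Rightarrow> complex \<Rightarrow> complex" where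
  "normalized_kern L p k a z = of_real ((real L ^ k) powr (- (1 / p))) * kern p a z"

lemma normalized_kern_holomorphic:
  "cmod a < 1 \<Longrightarrow> normalized_kern L p k a holomorphic_on ball 0 1"
  unfolding normalized_kern_def[abs_def] by (intro holomorphic_intros kern_holomorphic)

lemma circ_avg_normalized_kern:
  assumes p: "0 < p" and L: "2 \<le> L" and a: "cmod a = node L k" and r: "0 \<le> r" "r < 1"
  shows "circ_avg (\<lambda>z. cmod (normalized_kern L p k a z) powr p) r \<le> 1"
proof -
  have a1: "cmod a < 1" using a node_bounds[OF L] by simp
  define X where "X = real L ^ k"
  have X: "0 < X" using L by (simp add: X_def)
  have Xp: "(X powr (- (1 / p))) powr p = 1 / X"
    unfolding powr_powr using p X by (simp add: powr_minus_divide)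
  have "circ_avg (\<lambda>z. cmod (normalized_kern L p k a z) powr p) r
      = circ_avg (\<lambda>z. 1 / X * cmod (kern p a z) powr p) r"
    unfolding normalized_kern_def X_def[symmetric]
    by (intro circ_avg_cong r) (simp add: norm_mult powr_mult Xp)
  also have "\<dots> = 1 / X * circ_avg (\<lambda>z. cmod (kern p a z) powr p) r" by (rule circ_avg_cmult)
  also have "\<dots> \<le> 1 / X * (1 / (1 - cmod a))"
    using X by (intro mult_left_mono circ_avg_kern p a1 r) auto
  also have "\<dots> = 1" using X by (simp add: a one_minus_node X_def)
  finally show ?thesis .
qed

lemma cmod_normalized_kern_diag:
  assumes p: "0 < p" and L: "2 \<le> L" and a: "cmod a = node L k"
  shows "2 powr (- (2 / p)) * (real L ^ k) powr (1 / p) \<le> cmod (normalized_kern L p k a a)"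
proof -
  have a1: "cmod a < 1" using a node_bounds[OF L] by simp
  define X where "X = real L ^ k"
  have X: "0 < X" using L by (simp add: X_def)
  have "2 powr (- (2 / p)) * X powr (1 / p) = X powr (- (1 / p)) * (2 powr (- (2 / p)) * X powr (2 / p))"
  proof -
    have "X powr (- (1 / p)) * X powr (2 / p) = X powr (1 / p)"
      unfolding powr_add[symmetric] by (rule arg_cong[of _ _ "(powr) X"]) (simp add: field_simps)
    then show ?thesis by (simp add: mult_ac)
  qed
  also have "2 powr (- (2 / p)) * X powr (2 / p) = (2 * (1 - cmod a)) powr (- (2 / p))"
    using X unfolding a one_minus_node X_def[symmetric]
    by (simp add: powr_divide powr_minus_divide)
  also have "X powr (- (1 / p)) * (2 * (1 - cmod a)) powr (- (2 / p))
      \<le> X powr (- (1 / p)) * cmod (kern p a a)"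
    by (intro mult_left_mono cmod_kern_diag p a1) auto
  finally show ?thesis by (simp add: normalized_kern_def norm_mult X_def)
qed

section \<open>Constancy when the target exponent is smaller\<close>

text \<open>
  The norm dominates a discrete sum of derivatives at one point on each circle. The derivative at node
  \<open>k + 1\<close> is controlled by the mean at node \<open>k + 2\<close>, which is integrated up to node \<open>k + 3\<close>; the weight of
  this interval is comparable with \<open>omega_hat w (node L k)\<close> because the tails decrease geometrically,
  but not faster.
\<close>

lemma mixed_norm_pow_ge_deriv_sum:
  assumes s: "0 < s" and t: "0 < t" and rw: "radial_weight w" and L: "2 \<le> L" and D: "1 \<le> D"
    and e: "e < 1"
    and doub: "\<And>k. omega_hat w (node L k) \<le> D * omega_hat w (node L (Suc k))"
    and dec: "\<And>k. omega_hat w (node L (Suc k)) \<le> e * omega_hat w (node L k)"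
  obtains C where "0 < C" "\<And>F K a B. F holomorphic_on ball 0 1 \<Longrightarrow> 
    (\<And>k. cmod (a k) = node L (Suc k)) \<Longrightarrow> 0 \<le> B \<Longrightarrow> mixed_norm_pow w s t F \<le> ennreal B \<Longrightarrow>
    (\<Sum>k\<le>K. (real L ^ Suc k) powr (- (t * (1 + 1 / s))) * omega_hat w (node L k)
        * cmod (deriv F (a k)) powr t) \<le> C * B"
proof -
  obtain C' where C': "0 < C'" and der: "\<And>F N z. F holomorphic_on ball 0 1 \<Longrightarrow> cmod z = node L N \<Longrightarrow>
    cmod (deriv F z) \<le> C' * (real L ^ N) powr (1 + 1 / s) * integral_mean s (node L (Suc N)) F"
    using deriv_node_pointwise[OF s L] by metis
  note nb = node_bounds[OF L]
  define C where "C = C' powr t * (D\<^sup>2 / (1 - e))"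
  show thesis
  proof (rule that[of C])
    show "0 < C" using C' D e by (simp add: C_def)
    fix F and a :: "nat \<Rightarrow> complex" and K :: nat and B :: real
    assume F: "F holomorphic_on ball 0 1" and a: "\<And>k. cmod (a k) = node L (Suc k)"
      and B: "0 \<le> B" "mixed_norm_pow w s t F \<le> ennreal B"
    define I where "I k = integral_mean s (node L (Suc (Suc k))) F powr t" for k
    define W where "W k = omega_hat w (node L k)" for k
    have W: "0 < W k" for k using omega_hat_pos[OF rw nb] by (simp add: W_def)
    have term_le: "(real L ^ Suc k) powr (- (t * (1 + 1 / s))) * W k * cmod (deriv F (a k)) powr t
        \<le> C * (I k * (W (Suc (Suc k)) - W (Suc (Suc (Suc k)))))" for k
    proof -
      define X where "X = real L ^ Suc k"
      have X: "0 < X" using L by (simp add: X_def)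
      have "cmod (deriv F (a k)) powr t
          \<le> (C' * X powr (1 + 1 / s) * integral_mean s (node L (Suc (Suc k))) F) powr t"
        unfolding X_def using t by (intro powr_mono2 der F a) auto
      also have "\<dots> = C' powr t * X powr (t * (1 + 1 / s)) * I k"
        using C' X integral_mean_nonneg[of s _ F] by (simp add: powr_mult powr_powr I_def mult.commute)
      finally have d: "cmod (deriv F (a k)) powr t \<le> C' powr t * X powr (t * (1 + 1 / s)) * I k" .
      have Wk: "W k \<le> D\<^sup>2 / (1 - e) * (W (Suc (Suc k)) - W (Suc (Suc (Suc k))))"
      proof -
        have "W k \<le> D * (D * W (Suc (Suc k)))"
          using doub[of k] doub[of "Suc k"] D unfolding W_def
          by (meson mult_left_mono order_trans zero_le_one)
        moreover have "W (Suc (Suc k)) \<le> (W (Suc (Suc k)) - W (Suc (Suc (Suc k)))) / (1 - e)"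
          using dec[of "Suc (Suc k)"] e by (simp add: W_def field_simps)
        then have "D * (D * W (Suc (Suc k))) \<le> D * (D * ((W (Suc (Suc k)) - W (Suc (Suc (Suc k)))) / (1 - e)))"
          using D by (intro mult_left_mono) auto
        ultimately show ?thesis by (simp add: power2_eq_square mult_ac)
      qed
      have "X powr (- (t * (1 + 1 / s))) * W k * cmod (deriv F (a k)) powr t
          \<le> X powr (- (t * (1 + 1 / s))) * W k * (C' powr t * X powr (t * (1 + 1 / s)) * I k)"
        using W[of k] by (intro mult_left_mono d) auto
      also have "\<dots> = C' powr t * I k * W k"
        using X by (simp add: powr_minus_divide)
      also have "\<dots> \<le> C' powr t * I k * (D\<^sup>2 / (1 - e) * (W (Suc (Suc k)) - W (Suc (Suc (Suc k)))))"
        by (intro mult_left_mono Wk) (simp add: I_def)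
      also have "\<dots> = C * (I k * (W (Suc (Suc k)) - W (Suc (Suc (Suc k)))))"
        by (simp add: C_def mult_ac)
      finally show ?thesis by (simp only: X_def)
    qed
    have "ennreal (\<Sum>k\<in>{..K}. I k * (W (Suc (Suc k)) - W (Suc (Suc (Suc k))))) \<le> mixed_norm_pow w s t F"
      unfolding I_def W_def
    proof (rule mixed_norm_pow_ge_disjoint[OF rw t s F])
      show "disjoint_family_on (\<lambda>i. {node L (Suc (Suc i))..<node L (Suc (Suc (Suc i)))}) {..K}"
        unfolding disjoint_family_on_def
      proof (intro ballI impI)
        have dis: "{node L (Suc (Suc i))..<node L (Suc (Suc (Suc i)))}
            \<inter> {node L (Suc (Suc j))..<node L (Suc (Suc (Suc j)))} = {}" if "i < j" for i j
          using node_mono[OF L, of "Suc (Suc (Suc i))" "Suc (Suc j)"] that by auto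
        show "{node L (Suc (Suc i))..<node L (Suc (Suc (Suc i)))}
            \<inter> {node L (Suc (Suc j))..<node L (Suc (Suc (Suc j)))} = {}" if "i \<noteq> j" for i j
          using dis[of i j] dis[of j i] that by (metis inf_commute linorder_neqE_nat)
      qed
    qed (auto intro: nb less_imp_le node_mono[OF L])
    then have "ennreal (\<Sum>k\<le>K. I k * (W (Suc (Suc k)) - W (Suc (Suc (Suc k))))) \<le> ennreal B"
      using B(2) by (rule order_trans)
    then have low: "(\<Sum>k\<le>K. I k * (W (Suc (Suc k)) - W (Suc (Suc (Suc k))))) \<le> B"
      using B(1) by (simp add: ennreal_le_iff)
    have "(\<Sum>k\<le>K. (real L ^ Suc k) powr (- (t * (1 + 1 / s))) * W k * cmod (deriv F (a k)) powr t)
        \<le> (\<Sum>k\<le>K. C * (I k * (W (Suc (Suc k)) - W (Suc (Suc (Suc k))))))"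
      by (intro sum_mono term_le)
    also have "\<dots> \<le> C * B"
      unfolding sum_distrib_left[symmetric] using low \<open>0 < C\<close> by (intro mult_left_mono) auto
    finally show "(\<Sum>k\<le>K. (real L ^ Suc k) powr (- (t * (1 + 1 / s))) * omega_hat w (node L k)
        * cmod (deriv F (a k)) powr t) \<le> C * B" by (simp only: W_def)
  qed
qed

text \<open>
  The test function is a signed sum of kernels, one for each circle, peaked at a point of the circle where
  \<open>g'\<close> is bounded below. The signs are chosen so that at each of these points the
  sum is, on average over the circles and up to a factor, no smaller than its diagonal term. Comparing the norms of the test
  function and of its image yields the inequality between the two discrete sums.
\<close>

lemma T_bounded_imp_node_sum_le:
  assumes T: "T_bounded w p q s t g" and pos: "0 < p" "0 < q" "0 < s" "0 < t"
    and g: "g holomorphic_on ball 0 1" and nc: "\<not> g constant_on ball 0 1"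
    and rw: "radial_weight w" and L: "2 \<le> L" and D: "1 \<le> D" and e: "e < 1"
    and doub: "\<And>k. omega_hat w (node L k) \<le> D * omega_hat w (node L (Suc k))"
    and dec: "\<And>k. omega_hat w (node L (Suc k)) \<le> e * omega_hat w (node L k)"
    and \<sigma>: "0 < \<sigma>"
  obtains C where "0 < C" "\<And>K. (\<Sum>k\<le>K. (real L ^ k) powr (t * (\<sigma> - (1 + (1 / s - 1 / p)))) * omega_hat w (node L k))
    \<le> C * (\<Sum>k\<le>K. (real L ^ k) powr (\<sigma> * q) * omega_hat w (node L k)) powr (t / q)"
proof -
  define \<beta> where "\<beta> = 1 + (1 / s - 1 / p)"
  note nb = node_bounds[OF L]
  obtain C0 where C0: "0 < C0" "\<And>f X. f holomorphic_on ball 0 1 \<Longrightarrow> 0 \<le> X \<Longrightarrow>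
    mixed_norm_pow w p q f \<le> ennreal X \<Longrightarrow> mixed_norm_pow w s t (T_op g f) \<le> ennreal (C0 * X powr (t / q))"
    using T_bounded_pow_le[OF T pos(2,4)] by blast
  obtain A where A: "0 < A" and mean_le: "\<And>K h \<epsilon> r j. 
    (\<And>k. k \<le> K \<Longrightarrow> h k holomorphic_on ball 0 1) \<Longrightarrow>
    (\<And>k r. k \<le> K \<Longrightarrow> 0 \<le> r \<Longrightarrow> r < 1 \<Longrightarrow> circ_avg (\<lambda>z. cmod (h k z) powr p) r \<le> 1) \<Longrightarrow>
    (\<And>k. cmod (\<epsilon> k) = 1) \<Longrightarrow> 0 \<le> r \<Longrightarrow> r < 1 \<Longrightarrow> j \<le> K \<Longrightarrow> j = K \<or> r < node L (Suc j) \<Longrightarrow>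
    integral_mean p r (\<lambda>z. \<Sum>k\<le>K. \<epsilon> k * (of_real ((real L ^ k) powr \<sigma>) * (z ^ (L ^ Suc k) * h k z)))
      \<le> A * (real L ^ j) powr \<sigma>"
    using block_sum_mean_le[OF pos(1) \<sigma> L] by blast
  obtain C1 where C1: "0 < C1" "\<And>F K a B. F holomorphic_on ball 0 1 \<Longrightarrow> 
    (\<And>k. cmod (a k) = node L (Suc k)) \<Longrightarrow> 0 \<le> B \<Longrightarrow> mixed_norm_pow w s t F \<le> ennreal B \<Longrightarrow>
    (\<Sum>k\<le>K. (real L ^ Suc k) powr (- (t * (1 + 1 / s))) * omega_hat w (node L k)
        * cmod (deriv F (a k)) powr t) \<le> C1 * B"
    using mixed_norm_pow_ge_deriv_sum[OF pos(3,4) rw L D e doub dec] by blast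
  have hol': "deriv g holomorphic_on ball 0 1" by (intro holomorphic_deriv g) auto
  obtain \<xi> where \<xi>: "\<xi> \<in> ball 0 1" "deriv g \<xi> \<noteq> 0" using nonconstant_deriv_nonzero[OF g nc] by blast
  have "0 < node L 1" using node_strict_mono[OF L, of 0 1] by simp
  then obtain c where c: "0 < c" and
    circ: "\<And>r. node L 1 \<le> r \<Longrightarrow> r < 1 \<Longrightarrow> \<exists>a. cmod a = r \<and> c \<le> cmod (deriv g a)"
    using modulus_ge_on_circles[OF hol' \<xi>] nb(2)[of 1] by metis
  have "\<exists>a. cmod a = node L (Suc k) \<and> c \<le> cmod (deriv g a)" for k
    using circ[of "node L (Suc k)"] node_mono[OF L, of 1 "Suc k"] nb[of "Suc k"] by simp
  then obtain a where a: "\<And>k. cmod (a k) = node L (Suc k)" "\<And>k. c \<le> cmod (deriv g (a k))"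
    by metis
  have a1: "cmod (a k) < 1" for k using a nb by simp
  define h where "h k = normalized_kern L p (Suc k) (a k)" for k
  have h: "h k holomorphic_on ball 0 1" for k
    unfolding h_def by (intro normalized_kern_holomorphic a1)
  have havg: "circ_avg (\<lambda>z. cmod (h k z) powr p) r \<le> 1" if "0 \<le> r" "r < 1" for k r
    unfolding h_def by (intro circ_avg_normalized_kern pos L a that)
  define W where "W k = omega_hat w (node L k)" for k
  have W: "0 < W k" for k using omega_hat_pos[OF rw nb] by (simp add: W_def)
  define v where "v k = (real L ^ Suc k) powr (- (t * (1 + 1 / s))) * W k" for k
  have v: "0 \<le> v k" for k using W[of k] by (simp add: v_def)
  define x where "x k j = of_real ((real L ^ j) powr \<sigma>) * (a k ^ (L ^ Suc j) * h j (a k))" for k j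
  define c' where "c' = exp (- 2) * 2 powr (- (2 / p))"
  have diag: "(c' powr t * real L powr (- (t * \<beta>))) * ((real L ^ k) powr (t * (\<sigma> - \<beta>)) * W k)
      \<le> v k * cmod (x k k) powr t" for k
  proof -
    define X where "X = real L ^ k"
    have X: "0 < X" and L0: "0 < real L" using L by (auto simp: X_def)
    have "c' * (X powr \<sigma> * (real L * X) powr (1 / p))
        = X powr \<sigma> * (exp (- 2 * real 1) * (2 powr (- (2 / p)) * (real L ^ Suc k) powr (1 / p)))"
      by (simp add: c'_def X_def)
    also have "\<dots> \<le> X powr \<sigma> * (node L (Suc k) ^ (1 * L ^ Suc k) * cmod (h k (a k)))"
      unfolding h_def
      by (intro mult_left_mono mult_mono node_power_ge cmod_normalized_kern_diag L a pos
          zero_le_power nb) auto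
    also have "\<dots> = cmod (x k k)"
      by (simp add: x_def norm_mult norm_power a X_def)
    finally have "(c' * (X powr \<sigma> * (real L * X) powr (1 / p))) powr t \<le> cmod (x k k) powr t"
      using pos by (intro powr_mono2) (auto simp: c'_def)
    then have "v k * (c' * (X powr \<sigma> * (real L * X) powr (1 / p))) powr t \<le> v k * cmod (x k k) powr t"
      using v by (intro mult_left_mono)
    moreover have "v k * (c' * (X powr \<sigma> * (real L * X) powr (1 / p))) powr t
        = (c' powr t * real L powr (- (t * \<beta>))) * (X powr (t * (\<sigma> - \<beta>)) * W k)"
    proof -
      define Y where "Y = real L * X"
      have Y: "0 < Y" using X L0 by (simp add: Y_def)
      have "v k * (c' * (X powr \<sigma> * Y powr (1 / p))) powr t
          = c' powr t * (Y powr (- (t * (1 + 1 / s))) * Y powr (t / p)) * (X powr (t * \<sigma>) * W k)"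
        by (simp add: v_def Y_def X_def c'_def powr_mult powr_powr mult_ac)
      also have "Y powr (- (t * (1 + 1 / s))) * Y powr (t / p) = Y powr (- (t * \<beta>))"
        unfolding powr_add[symmetric] by (rule arg_cong[of _ _ "(powr) Y"]) (simp add: \<beta>_def algebra_simps)
      also have "\<dots> = real L powr (- (t * \<beta>)) * X powr (- (t * \<beta>))"
        using L0 X by (simp add: Y_def powr_mult)
      also have "c' powr t * (real L powr (- (t * \<beta>)) * X powr (- (t * \<beta>))) * (X powr (t * \<sigma>) * W k)
          = (c' powr t * real L powr (- (t * \<beta>))) * ((X powr (- (t * \<beta>)) * X powr (t * \<sigma>)) * W k)"
        by (simp add: mult_ac)
      also have "X powr (- (t * \<beta>)) * X powr (t * \<sigma>) = X powr (t * (\<sigma> - \<beta>))"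
        unfolding powr_add[symmetric] by (rule arg_cong[of _ _ "(powr) X"]) (simp add: algebra_simps)
      finally show ?thesis by (simp only: Y_def)
    qed
    ultimately show ?thesis by (simp add: X_def)
  qed
  define k0 where "k0 = c' powr t * real L powr (- (t * \<beta>))"
  have k0: "0 < k0" using L by (simp add: k0_def c'_def)
  define C where "C = 2 * (C1 * (C0 * A powr t)) / c powr t / k0"
  show thesis
  proof (rule that[of C])
    show "0 < C" using C0 C1 A c k0 by (simp add: C_def)
    fix K :: nat
    define S where "S = (\<Sum>k\<le>K. (real L ^ k) powr (\<sigma> * q) * W k)"
    have S: "0 \<le> S" unfolding S_def using W by (intro sum_nonneg) (auto simp: less_imp_le)
    obtain \<epsilon> :: "nat \<Rightarrow> complex" where \<epsilon>: "\<And>i. cmod (\<epsilon> i) = 1"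
      "(\<Sum>k\<in>{..K}. v k * cmod (x k k) powr t)
        \<le> 2 * (\<Sum>k\<in>{..K}. v k * cmod (\<Sum>j\<in>{..K}. \<epsilon> j * x k j) powr t)"
      using exists_signs[of "{..K}" t v x, OF finite_atMost pos(4) v] by blast
    define f where "f z = (\<Sum>k\<le>K. \<epsilon> k * (of_real ((real L ^ k) powr \<sigma>) * (z ^ (L ^ Suc k) * h k z)))" for z
    have f: "f holomorphic_on ball 0 1"
      unfolding f_def[abs_def] by (intro holomorphic_intros h)
    have "mixed_norm_pow w p q f \<le> ennreal (\<Sum>j\<le>K. (A * (real L ^ j) powr \<sigma>) powr q * omega_hat w (node L j))"
    proof (rule mixed_norm_pow_le_sum[OF rw pos(2) L])
      show "0 \<le> A * (real L ^ j) powr \<sigma>" for j using A by simp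
      show "integral_mean p r f \<le> A * (real L ^ j) powr \<sigma>"
        if "0 \<le> r" "r < 1" "j \<le> K" "j = K \<or> r < node L (Suc j)" for r j
        unfolding f_def[abs_def] by (intro mean_le h havg \<epsilon> that)
    qed
    also have "(\<Sum>j\<le>K. (A * (real L ^ j) powr \<sigma>) powr q * omega_hat w (node L j)) = A powr q * S"
      using A by (simp add: S_def W_def powr_mult powr_powr sum_distrib_left mult.assoc)
    finally have "mixed_norm_pow w s t (T_op g f) \<le> ennreal (C0 * (A powr q * S) powr (t / q))"
      using S by (intro C0(2) f) auto
    also have "C0 * (A powr q * S) powr (t / q) = C0 * (A powr t * S powr (t / q))"
      using A S pos by (simp add: powr_mult powr_powr)
    finally have pow: "mixed_norm_pow w s t (T_op g f) \<le> ennreal (C0 * (A powr t * S powr (t / q)))" .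
    have "(\<Sum>k\<le>K. v k * cmod (deriv (T_op g f) (a k)) powr t) \<le> C1 * (C0 * (A powr t * S powr (t / q)))"
      unfolding v_def W_def
      by (intro C1(2) T_op_primitive f g a pow) (use C0 in auto)
    moreover have "c powr t * (\<Sum>k\<le>K. v k * cmod (f (a k)) powr t)
        \<le> (\<Sum>k\<le>K. v k * cmod (deriv (T_op g f) (a k)) powr t)"
      unfolding sum_distrib_left
    proof (intro sum_mono)
      fix k
      have "c powr t * cmod (f (a k)) powr t \<le> cmod (deriv g (a k)) powr t * cmod (f (a k)) powr t"
        using c pos a(2)[of k] by (intro mult_right_mono powr_mono2) auto
      also have "\<dots> = cmod (deriv (T_op g f) (a k)) powr t"
        using T_op_primitive(2)[OF f g, of "a k"] a1[of k] by (simp add: norm_mult powr_mult mult.commute)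
      finally have "v k * (c powr t * cmod (f (a k)) powr t) \<le> v k * cmod (deriv (T_op g f) (a k)) powr t"
        using v by (intro mult_left_mono)
      then show "c powr t * (v k * cmod (f (a k)) powr t) \<le> v k * cmod (deriv (T_op g f) (a k)) powr t"
        by (simp add: mult_ac)
    qed
    ultimately have up: "c powr t * (\<Sum>k\<le>K. v k * cmod (f (a k)) powr t) \<le> C1 * (C0 * (A powr t * S powr (t / q)))"
      by linarith
    have fx: "f (a k) = (\<Sum>j\<le>K. \<epsilon> j * x k j)" for k by (simp add: f_def x_def)
    have "k0 * (\<Sum>k\<le>K. (real L ^ k) powr (t * (\<sigma> - \<beta>)) * W k) \<le> (\<Sum>k\<le>K. v k * cmod (x k k) powr t)"
      unfolding sum_distrib_left k0_def by (intro sum_mono diag)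
    also have "\<dots> \<le> 2 * (\<Sum>k\<le>K. v k * cmod (f (a k)) powr t)"
      using \<epsilon>(2) by (simp only: fx)
    also have "\<dots> \<le> 2 * (C1 * (C0 * (A powr t * S powr (t / q))) / c powr t)"
      using up c by (simp add: field_simps)
    finally have "(\<Sum>k\<le>K. (real L ^ k) powr (t * (\<sigma> - \<beta>)) * W k) \<le> C * S powr (t / q)"
      using k0 c by (simp add: C_def field_simps)
    then show "(\<Sum>k\<le>K. (real L ^ k) powr (t * (\<sigma> - (1 + (1 / s - 1 / p)))) * omega_hat w (node L k))
      \<le> C * (\<Sum>k\<le>K. (real L ^ k) powr (\<sigma> * q) * omega_hat w (node L k)) powr (t / q)"
      by (simp only: S_def W_def \<beta>_def)
  qed
qed

lemma le_powr_imp_bounded: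
  fixes S C \<theta> :: real
  assumes "0 < S" "S \<le> C * S powr \<theta>" "\<theta> < 1"
  shows "S \<le> C powr (1 / (1 - \<theta>))"
proof -
  have "S powr (1 - \<theta>) \<le> C"
    using assms by (simp add: powr_diff field_simps)
  then have "(S powr (1 - \<theta>)) powr (1 / (1 - \<theta>)) \<le> C powr (1 / (1 - \<theta>))"
    using assms by (intro powr_mono2) auto
  then show ?thesis using assms by (simp add: powr_powr)
qed

text \<open>
  The exponent \<open>\<sigma>\<close> is chosen so that the two sums in the preceding inequality coincide. Then
  \<open>S K \<le> C * S K powr (t / q)\<close> with \<open>t < q\<close> bounds the partial sums \<open>S K\<close>, and the integral in
  the hypothesis converges, a contradiction.
\<close>

lemma T_bounded_imp_constant_integral:
  assumes T: "T_bounded w p q s t g" and pos: "0 < p" "0 < q" "0 < s" "0 < t"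
    and g: "g holomorphic_on ball 0 1" and w: "w \<in> D_weights" and tq: "t < q"
    and inf: "(\<integral>\<^sup>+ r\<in>{0..<1}. ennreal ((1 - r) powr ((1 + (1 / s - 1 / p)) * (1 / (1 / t - 1 / q))) * w r)
      \<partial>lebesgue) = \<infinity>"
  shows "g constant_on ball 0 1"
proof (rule ccontr)
  assume nc: "\<not> g constant_on ball 0 1"
  have rw: "radial_weight w" using w by (simp add: D_weights_def D_hat_def)
  obtain L D e where L: "2 \<le> L" and D: "1 \<le> (D::real)" and e: "e < (1::real)"
    and doub: "\<And>k. omega_hat w (node L k) \<le> D * omega_hat w (node L (Suc k))"
    and dec: "\<And>k. omega_hat w (node L (Suc k)) \<le> e * omega_hat w (node L k)"
    using D_weights_geometric[OF w] by metis
  define \<beta> where "\<beta> = 1 + (1 / s - 1 / p)"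
  define Q where "Q = 1 / (1 / t - 1 / q)"
  have Q: "0 < Q" "Q = t * q / (q - t)" using pos tq by (auto simp: Q_def field_simps)
  \<comment> \<open>Otherwise the integrand is bounded by the integrable weight.\<close>
  have \<beta>: "\<beta> < 0"
  proof (rule ccontr)
    assume "\<not> \<beta> < 0"
    then have "0 \<le> \<beta> * Q" using Q(1) by simp
    have "(\<integral>\<^sup>+ r\<in>{0..<1}. ennreal ((1 - r) powr (\<beta> * Q) * w r) \<partial>lebesgue)
        \<le> (\<integral>\<^sup>+ r\<in>{0..<1}. ennreal (w r) \<partial>lebesgue)"
    proof (intro nn_integral_mono)
      fix r :: real
      have "(1 - r) powr (\<beta> * Q) * w r \<le> 1 * w r" if "r \<in> {0..<1}"
        using that \<open>0 \<le> \<beta> * Q\<close> weight_nonneg[OF rw, of r] by (intro mult_right_mono powr_le1) auto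
      then show "ennreal ((1 - r) powr (\<beta> * Q) * w r) * indicator {0..<1} r \<le> ennreal (w r) * indicator {0..<1} r"
        by (auto simp: indicator_def intro: ennreal_leI)
    qed
    also have "\<dots> < \<infinity>" by (simp add: weight_tail[OF rw])
    finally show False using inf by (simp add: \<beta>_def Q_def)
  qed
  define \<sigma> where "\<sigma> = - \<beta> * Q / q"
  have \<sigma>: "0 < \<sigma>" using \<beta> Q(1) pos by (simp add: \<sigma>_def divide_neg_pos mult_neg_pos)
  have \<sigma>q: "\<sigma> * q = - (\<beta> * Q)" using pos by (simp add: \<sigma>_def)
  have exps: "t * (\<sigma> - \<beta>) = \<sigma> * q"
  proof -
    have "t * (Q / q + 1) = Q" unfolding Q(2) using pos tq by (simp add: field_simps)
    moreover have "t * (\<sigma> - \<beta>) = - \<beta> * (t * (Q / q + 1))"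
      by (simp add: \<sigma>_def algebra_simps)
    ultimately show ?thesis unfolding \<sigma>q by simp
  qed
  define S where "S K = (\<Sum>k\<le>K. (real L ^ k) powr (\<sigma> * q) * omega_hat w (node L k))" for K
  obtain C where C: "0 < C" "\<And>K. S K \<le> C * S K powr (t / q)"
    using T_bounded_imp_node_sum_le[OF T pos g nc rw L D e doub dec \<sigma>]
    unfolding \<beta>_def[symmetric] exps S_def by blast
  have "0 < S K" for K
    unfolding S_def using L omega_hat_pos[OF rw node_bounds[OF L]]
    by (intro sum_pos mult_pos_pos) auto
  then have "S K \<le> C powr (1 / (1 - t / q))" for K
    using C tq pos by (intro le_powr_imp_bounded) auto
  then have "(\<integral>\<^sup>+ r\<in>{0..<1}. ennreal ((1 - r) powr (- (\<sigma> * q)) * w r) \<partial>lebesgue) < \<infinity>"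
    unfolding S_def using \<sigma> pos by (intro weight_power_integral_finite[OF rw L]) auto
  then show False using inf unfolding \<sigma>q by (simp add: \<beta>_def Q_def)
qed

theorem corollary1p3:
  fixes p q s t p_inv q_inv :: real
    and g :: "complex \<Rightarrow> complex"
    and w :: "real \<Rightarrow> real"
  assumes "0 < p" and "0 < q" and "0 < s" and "0 < t"
    and "g holomorphic_on ball 0 1"
    and "w \<in> D_weights"
    and "p_inv = 1 / s - 1 / p"
    and "q_inv = 1 / t - 1 / q"
    and "(p \<le> s \<and> q \<le> t \<and>
            filterlim (\<lambda>r. omega_hat w r powr q_inv * (1 - r) powr (1 + p_inv)) at_top (at_left 1))
       \<or> (s < p \<and> q \<le> t \<and>
            filterlim (\<lambda>r. omega_hat w r powr q_inv * (1 - r)) at_top (at_left 1))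
       \<or> (p \<le> s \<and> t < q \<and>
            (\<integral>\<^sup>+ r\<in>{0..<1}. ennreal ((1 - r) powr ((1 + p_inv) * (1 / q_inv)) * w r) \<partial>lebesgue) = \<infinity>)"
  shows "T_bounded w p q s t g \<longleftrightarrow> g constant_on ball 0 1"
proof
  assume "g constant_on ball 0 1"
  then show "T_bounded w p q s t g" by (rule T_bounded_of_constant)
next
  assume T: "T_bounded w p q s t g"
  from assms(9) show "g constant_on ball 0 1"
    unfolding assms(7,8)
    using T_bounded_imp_constant_lim_pointwise[OF T assms(1-6)]
      T_bounded_imp_constant_lim_mean[OF T assms(1-6)]
      T_bounded_imp_constant_integral[OF T assms(1-6)]
    by blast
qed

end
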